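(* Assume $\int_{\mathbb R}|x|\ell(x)\,dx<\infty$, $\int_{\mathbb R}|x|^{3}|g(x)|\,dx<\infty$, and $g\in\mathbb L^2(\mathbb R)$. Then there is a constant $K$, not depending on $n$ or $m$, such that for all $n$ and all integers $m\ge1$, $$\mathbb E(\|g-\hat g_m\|^2)\le\|g-g_m\|^2+K\,\frac{\mathbb E^{1/2}[(Z_1^\Delta)^4]\int_{-\pi m}^{\pi m}dx/|\psi_\Delta(x)|^2}{n\Delta^2}.$$
   Context: Setting: $\Delta>0$ is fixed. $(L_t)_{t\ge0}$ is a real-valued pure jump Lévy process (no drift, no Gaussian component) with finite variation on compacts, whose Lévy measure has a density $\ell(x)$ on $\mathbb R$. The observations are the i.i.d. variables $Z_k^\Delta=L_{k\Delta}-L_{(k-1)\Delta}$, $k=1,\dots,n$, with characteristic function $\psi_\Delta(u)=\mathbb E(e^{iuZ_1^\Delta})=\exp\left(\Delta\int_{\mathbb R}(e^{iux}-1)\ell(x)\,dx\right)$. Set $g(x)=x\,\ell(x)$. Notation: $u^*(y)=\int e^{iyx}u(x)\,dx$ is the Fourier transform, $\|\cdot\|$ the $\mathbb L^2(\mathbb R)$ norm, $\mathbb E^{q}[X]=(\mathbb E[X])^q$. Projection spaces: $\varphi(x)=\sin(\pi x)/(\pi x)$, $\varphi_{m,j}(x)=\sqrt m\,\varphi(mx-j)$ for $j\in\mathbb Z$; $(\varphi_{m,j})_{j\in\mathbb Z}$ is an orthonormal basis of $S_m=\{h\in\mathbb L^2(\mathbb R):\mathrm{supp}(h^* )\subset[-\pi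 m,\pi m]\}$, and $\varphi_{m,j}^*(x)=m^{-1/2}e^{ixj/m}\mathbf 1_{[-\pi m,\pi m]}(x)$. $g_m$ is the orthogonal projection of $g$ on $S_m$. Estimators: $\hat\psi_\Delta(x)=\frac1n\sum_{k=1}^ne^{ixZ_k^\Delta}$, $\hat\theta_\Delta(x)=\frac1n\sum_{k=1}^nZ_k^\Delta e^{ixZ_k^\Delta}$, and $\frac1{\tilde\psi_\Delta(x)}=\frac1{\hat\psi_\Delta(x)}\mathbf 1_{|\hat\psi_\Delta(x)|>\kappa_\psi n^{-1/2}}$ (equal to $0$ when the indicator vanishes), where $\kappa_\psi>0$ is a fixed constant. The estimator is $\hat g_m=\sum_{j\in\mathbb Z}\hat a_{m,j}\varphi_{m,j}$ with $\hat a_{m,j}=\frac1{2\pi\Delta}\int\hat\theta_\Delta(x)\frac{\varphi_{m,j}^*(-x)}{\tilde\psi_\Delta(x)}\,dx$. *)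

theory Defs
  imports "HOL-Probability.Probability"
begin

section \<open>L\'evy processes of pure jump type with finite variation\<close>

definition cadlag :: "(real \<Rightarrow> real) \<Rightarrow> bool" where
  "cadlag f \<longleftrightarrow>
     (\<forall>t\<ge>0. (f \<longlongrightarrow> f t) (at_right t)) \<and> (\<forall>t>0. \<exists>y. (f \<longlongrightarrow> y) (at_left t))"

definition finite_variation_on_compacts :: "(real \<Rightarrow> real) \<Rightarrow> bool" where
  "finite_variation_on_compacts f \<longleftrightarrow>
     (\<forall>T\<ge>0. \<exists>B. \<forall>(n::nat) t. 0 \<le> t 0 \<and> mono t \<and> t n \<le> T \<longrightarrow>
        (\<Sum>k<n. \<bar>f (t (Suc k)) - f (t k)\<bar>) \<le> B)"

definition levy_process :: "'w measure \<Rightarrow> (real \<Rightarrow> 'w \<Rightarrow> real) \<Rightarrow> bool" where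
  "levy_process M L \<longleftrightarrow>
     prob_space M \<and>
     (\<forall>t\<ge>0. L t \<in> borel_measurable M) \<and>
     (AE w in M. L 0 w = 0) \<and>
     (\<forall>(n::nat) t. 0 \<le> t 0 \<and> mono t \<longrightarrow>
        prob_space.indep_vars M (\<lambda>_. borel) (\<lambda>k w. L (t (Suc k)) w - L (t k) w) {..<n}) \<and>
     (\<forall>s\<ge>0. \<forall>h\<ge>0. distr M borel (\<lambda>w. L (s + h) w - L s w) = distr M borel (L h)) \<and>
     (AE w in M. cadlag (\<lambda>t. L t w))"

text \<open>The absence of drift and of a Gaussian component, and the fact that the L\'evy measure
  has density \<open>l\<close>, are expressed through the L\'evy--Khintchine formula; its uncompensated form
  requires \<open>\<integral> min 1 \<bar>x\<bar> l(x) dx < \<infinity>\<close>, which is the finite variation condition on the L\'evy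
  measure.\<close>

definition pure_jump_fv_levy :: "'w measure \<Rightarrow> (real \<Rightarrow> 'w \<Rightarrow> real) \<Rightarrow> (real \<Rightarrow> real) \<Rightarrow> bool" where
  "pure_jump_fv_levy M L l \<longleftrightarrow>
     levy_process M L \<and>
     (AE w in M. finite_variation_on_compacts (\<lambda>t. L t w)) \<and>
     l \<in> borel_measurable borel \<and> (\<forall>x. 0 \<le> l x) \<and>
     integrable lborel (\<lambda>x. min 1 \<bar>x\<bar> * l x) \<and>
     (\<forall>t\<ge>0. \<forall>u. char (distr M borel (L t)) u =
        exp (of_real t * (CLINT x|lborel. (iexp (u * x) - 1) * of_real (l x))))"

definition increment :: "(real \<Rightarrow> 'w \<Rightarrow> real) \<Rightarrow> real \<Rightarrow> nat \<Rightarrow> 'w \<Rightarrow> real" where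
  "increment L \<Delta> k w = L (real k * \<Delta>) w - L ((real k - 1) * \<Delta>) w"

definition jump_g :: "(real \<Rightarrow> real) \<Rightarrow> real \<Rightarrow> real" where
  "jump_g l x = x * l x"


section \<open>The space of square integrable functions and its Fourier transform\<close>

text \<open>\<open>L\<^sup>2\<close> functions are represented by complex-valued Borel functions, not by equivalence
  classes. The squared norm takes values in \<^typ>\<open>ennreal\<close>.\<close>

definition L2_space :: "(real \<Rightarrow> complex) set" where
  "L2_space = {h \<in> borel_measurable lborel. integrable lborel (\<lambda>x. (cmod (h x))\<^sup>2)}"

definition L2_norm_sq :: "(real \<Rightarrow> complex) \<Rightarrow> ennreal" where
  "L2_norm_sq h = (\<integral>\<^sup>+ x. ennreal ((cmod (h x))\<^sup>2) \<partial>lborel)"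

text \<open>For \<open>h\<close> in \<open>L\<^sup>2\<close> the transform \<open>h\<^sup>*(y) = \<integral> exp(iyx) h(x) dx\<close> is the \<open>L\<^sup>2\<close> limit of the
  truncated integrals; it is determined up to null sets, hence a relation.\<close>

definition has_L2_fourier :: "(real \<Rightarrow> complex) \<Rightarrow> (real \<Rightarrow> complex) \<Rightarrow> bool" where
  "has_L2_fourier h u \<longleftrightarrow>
     h \<in> L2_space \<and> u \<in> L2_space \<and>
     ((\<lambda>R. L2_norm_sq (\<lambda>y. u y - (CLINT x:{-R..R}|lborel. iexp (y * x) * h x))) \<longlongrightarrow> 0) at_top"

definition L2_orth_proj :: "(real \<Rightarrow> complex) set \<Rightarrow> (real \<Rightarrow> complex) \<Rightarrow> (real \<Rightarrow> complex)" where
  "L2_orth_proj S f =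
     (SOME p. p \<in> S \<and> (\<forall>h\<in>S. (CLINT x|lborel. (f x - p x) * cnj (h x)) = 0))"

text \<open>A representative of the sum of the series \<open>\<Sum>j. f j\<close>, convergent in \<open>L\<^sup>2\<close>.\<close>

definition L2_series :: "(int \<Rightarrow> real \<Rightarrow> complex) \<Rightarrow> (real \<Rightarrow> complex)" where
  "L2_series f =
     (SOME s. s \<in> L2_space \<and>
        ((\<lambda>F. L2_norm_sq (\<lambda>x. s x - (\<Sum>j\<in>F. f j x))) \<longlongrightarrow> 0) (finite_subsets_at_top UNIV))"


section \<open>Projection spaces\<close>

text \<open>The function \<^term>\<open>sinc\<close> of the library is unnormalised, \<open>sinc x = sin x / x\<close>.\<close>

definition phi :: "nat \<Rightarrow> int \<Rightarrow> real \<Rightarrow> real" where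
  "phi m j x = sqrt (real m) * sinc (pi * (real m * x - of_int j))"

definition phi_star :: "nat \<Rightarrow> int \<Rightarrow> real \<Rightarrow> complex" where
  "phi_star m j x =
     of_real (real m powr (-1/2)) * iexp (x * of_int j / real m) *
     indicator {- pi * real m..pi * real m} x"

definition S_space :: "nat \<Rightarrow> (real \<Rightarrow> complex) set" where
  "S_space m = {h \<in> L2_space. \<exists>u. has_L2_fourier h u \<and>
     (AE y in lborel. y \<notin> {- pi * real m..pi * real m} \<longrightarrow> u y = 0)}"


section \<open>The estimator\<close>

text \<open>Here \<open>z 1, \<dots>, z n\<close> are the observed increments.\<close>

definition psi_hat :: "nat \<Rightarrow> (nat \<Rightarrow> real) \<Rightarrow> real \<Rightarrow> complex" where
  "psi_hat n z x = (\<Sum>k=1..n. iexp (x * z k)) / of_nat n"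

definition theta_hat :: "nat \<Rightarrow> (nat \<Rightarrow> real) \<Rightarrow> real \<Rightarrow> complex" where
  "theta_hat n z x = (\<Sum>k=1..n. of_real (z k) * iexp (x * z k)) / of_nat n"

definition inv_psi_tilde :: "real \<Rightarrow> nat \<Rightarrow> (nat \<Rightarrow> real) \<Rightarrow> real \<Rightarrow> complex" where
  "inv_psi_tilde \<kappa> n z x =
     (if cmod (psi_hat n z x) > \<kappa> * real n powr (-1/2) then 1 / psi_hat n z x else 0)"

definition a_hat :: "real \<Rightarrow> real \<Rightarrow> nat \<Rightarrow> (nat \<Rightarrow> real) \<Rightarrow> nat \<Rightarrow> int \<Rightarrow> complex" where
  "a_hat \<Delta> \<kappa> n z m j =
     1 / (2 * of_real pi * of_real \<Delta>) *
     (CLINT x|lborel. theta_hat n z x * phi_star m j (- x) * inv_psi_tilde \<kappa> n z x)"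

definition g_hat :: "real \<Rightarrow> real \<Rightarrow> nat \<Rightarrow> (nat \<Rightarrow> real) \<Rightarrow> nat \<Rightarrow> real \<Rightarrow> complex" where
  "g_hat \<Delta> \<kappa> n z m = L2_series (\<lambda>j x. a_hat \<Delta> \<kappa> n z m j * of_real (phi m j x))"

end

theory Submission
  imports Defs "HOL-Analysis.Equivalence_Measurable_On_Borel"
begin

text \<open>By Plancherel, and because \<open>theta(u) = E[Z exp(iuZ)] = \<Delta> psi(u) g\<^sup>*(u)\<close>, the risk is
  \<open>\<parallel>g - g\<^sub>m\<parallel>\<^sup>2\<close> plus \<open>1/(2\<pi>\<Delta>\<^sup>2)\<close> times the integral over \<open>\<bar>u\<bar> \<le> \<pi>m\<close> of
  \<open>E \<bar>theta_hat/psi_tilde - theta/psi\<bar>\<^sup>2\<close>. With \<open>e = \<bar>theta_hat - theta\<bar>\<close> and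
  \<open>d = \<bar>psi_hat - psi\<bar>\<close>, the truncation of \<open>psi_hat\<close> at \<open>\<kappa>/\<surd>n\<close> bounds the integrand
  pointwise in terms of \<open>e\<^sup>2\<close>, \<open>n e\<^sup>2 d\<^sup>2\<close>, \<open>d\<^sup>2\<close> and \<open>n d\<^sup>4\<close>, and since \<open>exp(iuZ)\<close> is bounded
  the expectation of each is \<open>O(1/n)\<close>, with only second moments of \<open>Z\<close> involved.
  That \<open>E[Z\<^sup>4]\<close> is finite is read off the cubic expansion of \<open>psi\<close> at \<open>0\<close>.\<close>

section \<open>Square integrable functions\<close>

text \<open>The estimator, the projection and the L2 transform are determined only up to null sets:
  \<open>g_hat\<close> and \<open>L2_orth_proj\<close> select representatives by
  \<open>SOME\<close>, and \<open>has_L2_fourier\<close> is a relation defined by a limit. The work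
  is therefore moved to the frequency side, where functions supported in a bounded band are
  integrable and their transforms are pointwise integrals. Plancherel is proved there only, from the
  completeness of the exponentials on an interval.

  Where theta multiplies the error of the inverse, the pointwise bound carries
  \<open>|theta|^2 / |psi|^4\<close>. It still costs a single factor \<open>1 / |psi|^2\<close>,
  because \<open>theta / psi\<close> is \<open>\<Delta> * ft g\<close> and hence bounded by
  \<open>\<Delta>\<close> times the L1 norm of g. That term comes with no moment of Z, so the factor
  \<open>E^(1/2)[Z^4]\<close> of the claim is produced by dividing by it: the constant depends on
  the law, and a vanishing fourth moment is a separate case. Finiteness of the fourth moment matters
  because the integral of a non-integrable function is 0 by convention.\<close>

lemma L2_spaceI:
  assumes "h \<in> borel_measurable borel" "integrable lborel (\<lambda>x. (cmod (h x))\<^sup>2)"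
  shows "h \<in> L2_space"
  using assms by (simp add: L2_space_def)

lemma L2_space_measurable [measurable_dest]: "h \<in> L2_space \<Longrightarrow> h \<in> borel_measurable borel"
  by (simp add: L2_space_def)

lemma L2_space_integrable: "h \<in> L2_space \<Longrightarrow> integrable lborel (\<lambda>x. (cmod (h x))\<^sup>2)"
  by (simp add: L2_space_def)

lemma borel_measurable_cnj [measurable (raw)]:
  "f \<in> borel_measurable M \<Longrightarrow> (\<lambda>x. cnj (f x)) \<in> borel_measurable M"
  by (rule measurable_compose) (auto intro: borel_measurable_continuous_onI continuous_intros)

lemma indicator_Icc_L2: "(\<lambda>x. complex_of_real (indicator {a..b} x)) \<in> L2_space"
proof (rule L2_spaceI)
  have "(\<lambda>x. (cmod (complex_of_real (indicator {a..b} x)))\<^sup>2) = indicator {a..b}"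
    by (auto simp: fun_eq_iff indicator_def)
  then show "integrable lborel (\<lambda>x. (cmod (complex_of_real (indicator {a..b} x)))\<^sup>2)"
    by (simp only:) (intro integrable_real_indicator; simp add: emeasure_lborel_Icc_eq)
qed simp

lemma cmod_add_sq_le: "(cmod (a + b))\<^sup>2 \<le> 2 * (cmod a)\<^sup>2 + 2 * (cmod b)\<^sup>2"
proof -
  have "(cmod (a + b))\<^sup>2 \<le> (cmod a + cmod b)\<^sup>2"
    by (intro power_mono norm_triangle_ineq) auto
  also have "\<dots> \<le> 2 * (cmod a)\<^sup>2 + 2 * (cmod b)\<^sup>2"
    using zero_le_power2[of "cmod a - cmod b"] by (simp add: power2_eq_square algebra_simps)
  finally show ?thesis .
qed

lemma cmod_diff_sq_le: "(cmod (a - b))\<^sup>2 \<le> 2 * (cmod a)\<^sup>2 + 2 * (cmod b)\<^sup>2"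
  using cmod_add_sq_le[of a "-b"] by simp

lemma L2_space_add:
  assumes "f \<in> L2_space" "g \<in> L2_space"
  shows "(\<lambda>x. f x + g x) \<in> L2_space"
proof (rule L2_spaceI)
  have [measurable]: "f \<in> borel_measurable borel" "g \<in> borel_measurable borel"
    using assms by (auto dest: L2_space_measurable)
  show "(\<lambda>x. f x + g x) \<in> borel_measurable borel" by measurable
  have "integrable lborel (\<lambda>x. 2 * (cmod (f x))\<^sup>2 + 2 * (cmod (g x))\<^sup>2)"
    using assms by (intro Bochner_Integration.integrable_add integrable_mult_right L2_space_integrable)
  then show "integrable lborel (\<lambda>x. (cmod (f x + g x))\<^sup>2)"
    by (rule Bochner_Integration.integrable_bound) (auto intro!: AE_I2 order.trans[OF cmod_add_sq_le])
qed

lemma L2_space_cmult: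
  assumes "f \<in> L2_space"
  shows "(\<lambda>x. c * f x) \<in> L2_space"
  using assms by (intro L2_spaceI) (auto simp: norm_mult power_mult_distrib L2_space_integrable)

lemma L2_space_diff:
  assumes "f \<in> L2_space" "g \<in> L2_space"
  shows "(\<lambda>x. f x - g x) \<in> L2_space"
  using L2_space_add[OF assms(1) L2_space_cmult[OF assms(2), of "-1"]] by simp

lemma L2_space_zero: "(\<lambda>x. 0) \<in> L2_space"
  by (rule L2_spaceI) auto

lemma L2_space_sum:
  assumes "\<And>j. j \<in> J \<Longrightarrow> f j \<in> L2_space"
  shows "(\<lambda>x. \<Sum>j\<in>J. f j x) \<in> L2_space"
  using assms by (induction J rule: infinite_finite_induct) (auto intro: L2_space_zero L2_space_add)

lemma L2_space_bound:
  assumes "f \<in> L2_space" "h \<in> borel_measurable borel" "\<And>x. cmod (h x) \<le> cmod (f x)"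
  shows "h \<in> L2_space"
proof (rule L2_spaceI)
  show "integrable lborel (\<lambda>x. (cmod (h x))\<^sup>2)"
    by (rule Bochner_Integration.integrable_bound[OF L2_space_integrable[OF assms(1)]])
       (use assms in \<open>auto intro!: AE_I2 power_mono\<close>)
qed fact

lemma L2_space_indicator:
  assumes "f \<in> L2_space" "A \<in> sets borel"
  shows "(\<lambda>x. indicator A x * f x) \<in> L2_space"
  by (rule L2_space_bound[OF assms(1)])
     (use assms L2_space_measurable[OF assms(1)] in \<open>auto simp: indicator_def norm_mult\<close>)

lemma L2_norm_sq_eq:
  "h \<in> L2_space \<Longrightarrow> L2_norm_sq h = ennreal (\<integral>x. (cmod (h x))\<^sup>2 \<partial>lborel)"
  unfolding L2_norm_sq_def by (intro nn_integral_eq_integral L2_space_integrable) auto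

lemma L2_space_iff_norm:
  "h \<in> L2_space \<longleftrightarrow> h \<in> borel_measurable borel \<and> L2_norm_sq h < \<infinity>"
  by (auto simp: L2_space_def L2_norm_sq_def integrable_iff_bounded)

lemma L2_norm_sq_add_le:
  assumes [measurable]: "f \<in> borel_measurable borel" "g \<in> borel_measurable borel"
  shows "L2_norm_sq (\<lambda>x. f x + g x) \<le> 2 * L2_norm_sq f + 2 * L2_norm_sq g"
proof -
  have "L2_norm_sq (\<lambda>x. f x + g x) \<le> (\<integral>\<^sup>+x. 2 * ennreal ((cmod (f x))\<^sup>2) + 2 * ennreal ((cmod (g x))\<^sup>2) \<partial>lborel)"
    unfolding L2_norm_sq_def
  proof (rule nn_integral_mono)
    fix x
    have "ennreal ((cmod (f x + g x))\<^sup>2) \<le> ennreal (2 * (cmod (f x))\<^sup>2 + 2 * (cmod (g x))\<^sup>2)"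
      by (rule ennreal_leI[OF cmod_add_sq_le])
    then show "ennreal ((cmod (f x + g x))\<^sup>2) \<le> 2 * ennreal ((cmod (f x))\<^sup>2) + 2 * ennreal ((cmod (g x))\<^sup>2)"
      by (simp add: ennreal_plus ennreal_mult)
  qed
  also have "\<dots> = 2 * L2_norm_sq f + 2 * L2_norm_sq g"
    unfolding L2_norm_sq_def by (subst nn_integral_add) (auto simp: nn_integral_cmult)
  finally show ?thesis .
qed

lemma L2_norm_sq_cmult:
  assumes [measurable]: "f \<in> borel_measurable borel"
  shows "L2_norm_sq (\<lambda>x. c * f x) = ennreal ((cmod c)\<^sup>2) * L2_norm_sq f"
  unfolding L2_norm_sq_def by (simp add: norm_mult power_mult_distrib ennreal_mult nn_integral_cmult)

lemma L2_norm_sq_minus: "L2_norm_sq (\<lambda>x. f x - g x) = L2_norm_sq (\<lambda>x. g x - f x)"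
  unfolding L2_norm_sq_def by (simp add: norm_minus_commute)

lemma L2_norm_sq_triangle:
  assumes [measurable]: "f \<in> borel_measurable borel" "g \<in> borel_measurable borel" "h \<in> borel_measurable borel"
  shows "L2_norm_sq (\<lambda>x. f x - h x) \<le> 2 * L2_norm_sq (\<lambda>x. f x - g x) + 2 * L2_norm_sq (\<lambda>x. g x - h x)"
  using L2_norm_sq_add_le[of "\<lambda>x. f x - g x" "\<lambda>x. g x - h x"] by simp

lemma L2_norm_sq_cong_AE:
  "AE x in lborel. f x = g x \<Longrightarrow> L2_norm_sq f = L2_norm_sq g"
  unfolding L2_norm_sq_def by (intro nn_integral_cong_AE) auto

lemma L2_norm_sq_eq_0:
  assumes [measurable]: "f \<in> borel_measurable borel" "g \<in> borel_measurable borel"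
    and "L2_norm_sq (\<lambda>x. f x - g x) = 0"
  shows "AE x in lborel. f x = g x"
  using assms(3) unfolding L2_norm_sq_def by (subst (asm) nn_integral_0_iff_AE) auto

section \<open>Inner products and functions of bounded support\<close>

lemma integrable_mult_cnj:
  assumes "f \<in> L2_space" "g \<in> L2_space"
  shows "integrable lborel (\<lambda>x. f x * cnj (g x))"
proof -
  have [measurable]: "f \<in> borel_measurable borel" "g \<in> borel_measurable borel"
    using assms by (auto dest: L2_space_measurable)
  have "integrable lborel (\<lambda>x. (cmod (f x))\<^sup>2 + (cmod (g x))\<^sup>2)"
    using assms by (auto intro: L2_space_integrable)
  then show ?thesis
  proof (rule Bochner_Integration.integrable_bound)
    have "cmod a * cmod b \<le> (cmod a)\<^sup>2 + (cmod b)\<^sup>2" for a b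
    proof -
      have "2 * (cmod a * cmod b) \<le> (cmod a)\<^sup>2 + (cmod b)\<^sup>2"
        using zero_le_power2[of "cmod a - cmod b"] by (simp add: power2_eq_square algebra_simps)
      moreover have "0 \<le> cmod a * cmod b" by simp
      ultimately show ?thesis by linarith
    qed
    then show "AE x in lborel. norm (f x * cnj (g x)) \<le> norm ((cmod (f x))\<^sup>2 + (cmod (g x))\<^sup>2)"
      by (auto simp: norm_mult)
  qed measurable
qed

text \<open>Pairing F with the indicator of the band, itself square integrable, puts F in L1. This
  is what makes \<open>ft\<close> and \<open>ift\<close> pointwise integrals on the frequency
  side.\<close>

lemma L2_integrable_compact:
  assumes "F \<in> L2_space" and supp: "\<And>y. y \<notin> {-B..B} \<Longrightarrow> F y = 0"
  shows "integrable lborel F"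
proof -
  have "(\<lambda>x. F x * cnj (complex_of_real (indicator {-B..B} x))) = F"
    using supp by (auto simp: indicator_def fun_eq_iff)
  then show ?thesis
    using integrable_mult_cnj[OF assms(1) indicator_Icc_L2[of "-B" B]] by simp
qed

lemma bounded_compact_L2:
  assumes "F \<in> borel_measurable borel" and supp: "\<And>y. y \<notin> {-B..B} \<Longrightarrow> F y = 0"
    and bd: "\<And>y. cmod (F y) \<le> C"
  shows "F \<in> L2_space"
proof (rule L2_space_bound[OF _ assms(1)])
  show "(\<lambda>x. complex_of_real (C * indicator {-B..B} x)) \<in> L2_space"
    using L2_space_cmult[OF indicator_Icc_L2[of "-B" B], of "of_real C"] by simp
  show "cmod (F x) \<le> cmod (complex_of_real (C * indicator {-B..B} x))" for x
    using supp[of x] bd[of x] norm_ge_zero[of "F x"] by (auto simp: indicator_def simp del: norm_ge_zero)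
qed

lemma integral_cmod_diff_sq:
  assumes "f \<in> L2_space" "g \<in> L2_space"
  shows "(\<integral>x. (cmod (f x - g x))\<^sup>2 \<partial>lborel) =
    (\<integral>x. (cmod (f x))\<^sup>2 \<partial>lborel) - 2 * Re (\<integral>x. f x * cnj (g x) \<partial>lborel)
      + (\<integral>x. (cmod (g x))\<^sup>2 \<partial>lborel)"
proof -
  have "(\<integral>x. (cmod (f x - g x))\<^sup>2 \<partial>lborel) =
    (\<integral>x. (cmod (f x))\<^sup>2 - 2 * Re (f x * cnj (g x)) + (cmod (g x))\<^sup>2 \<partial>lborel)"
    by (intro Bochner_Integration.integral_cong refl)
       (simp add: cmod_power2, simp add: power2_eq_square algebra_simps)
  also have "\<dots> = (\<integral>x. (cmod (f x))\<^sup>2 \<partial>lborel) - (\<integral>x. 2 * Re (f x * cnj (g x)) \<partial>lborel)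
      + (\<integral>x. (cmod (g x))\<^sup>2 \<partial>lborel)"
    by (simp only: Bochner_Integration.integral_add Bochner_Integration.integral_diff
        Bochner_Integration.integrable_diff integrable_mult_right integrable_Re L2_space_integrable
         integrable_mult_cnj assms)
  also have "(\<integral>x. 2 * Re (f x * cnj (g x)) \<partial>lborel) = 2 * Re (\<integral>x. f x * cnj (g x) \<partial>lborel)"
    using integrable_mult_cnj[OF assms] by (simp only: integral_mult_right_zero integral_Re)
  finally show ?thesis .
qed

lemma integral_mult_cnj_self:
  assumes "f \<in> L2_space"
  shows "(\<integral>x. f x * cnj (f x) \<partial>lborel) = complex_of_real (\<integral>x. (cmod (f x))\<^sup>2 \<partial>lborel)"
  by (simp add: complex_norm_square[symmetric] del: of_real_power flip: integral_complex_of_real)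

subsection \<open>Density of trigonometric polynomials\<close>

text \<open>Generated by monomials and sums, so that closure under products is a double induction;
  explicit coefficients are recovered only at the end, by \<open>trig_poly_expand\<close>.\<close>

inductive trig_poly :: "(real \<Rightarrow> complex) \<Rightarrow> bool" where
  trig_monom: "trig_poly (\<lambda>t. c * iexp (of_int j * t))"
| trig_add: "trig_poly p \<Longrightarrow> trig_poly q \<Longrightarrow> trig_poly (\<lambda>t. p t + q t)"

lemma trig_poly_mult:
  assumes "trig_poly p" "trig_poly q"
  shows "trig_poly (\<lambda>t. p t * q t)"
  using assms
proof (induction arbitrary: q)
  case (trig_monom c j)
  from trig_monom.prems show ?case
  proof induction
    case (trig_monom d k)
    have "(\<lambda>t. c * iexp (of_int j * t) * (d * iexp (of_int k * t))) =
        (\<lambda>t. (c * d) * iexp (of_int (j + k) * t))"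
      by (simp add: fun_eq_iff algebra_simps exp_add[symmetric])
    then show ?case by (metis trig_poly.trig_monom)
  next
    case (trig_add p q)
    then show ?case by (simp add: distrib_left trig_poly.trig_add)
  qed
next
  case (trig_add p q r)
  then show ?case by (simp add: distrib_right trig_poly.trig_add)
qed

lemma trig_poly_const: "trig_poly (\<lambda>t. c)"
  using trig_monom[of c 0] by simp

lemma trig_poly_expand:
  assumes "trig_poly p"
  shows "\<exists>J b. finite J \<and> (\<forall>t. p t = (\<Sum>j\<in>J. b j * iexp (of_int j * t)))"
  using assms
proof induction
  case (trig_monom c j)
  show ?case by (intro exI[of _ "{j}"] exI[of _ "\<lambda>_. c"]) auto
next
  case (trig_add p q)
  from trig_add.IH(1) obtain J b where
    p: "finite J" "\<And>t. p t = (\<Sum>j\<in>J. b j * iexp (of_int j * t))" by blast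
  from trig_add.IH(2) obtain K d where
    q: "finite K" "\<And>t. q t = (\<Sum>j\<in>K. d j * iexp (of_int j * t))" by blast
  have "p t + q t = (\<Sum>j\<in>J\<union>K. ((if j \<in> J then b j else 0) + (if j \<in> K then d j else 0)) * iexp (of_int j * t))" for t
  proof -
    have "p t = (\<Sum>j\<in>J\<union>K. (if j \<in> J then b j else 0) * iexp (of_int j * t))"
      unfolding p using p(1) q(1) by (intro sum.mono_neutral_cong_left) auto
    moreover have "q t = (\<Sum>j\<in>J\<union>K. (if j \<in> K then d j else 0) * iexp (of_int j * t))"
      unfolding q using p(1) q(1) by (intro sum.mono_neutral_cong_left) auto
    ultimately show ?thesis by (simp only: distrib_right sum.distrib)
  qed
  then show ?case using p(1) q(1) by (intro exI[of _ "J \<union> K"]) auto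
qed

text \<open>Real polynomial functions on the plane are generated by linear functionals. Such a
  functional is determined by its values at 1 and \<open>\<i>\<close>, so on the circle it is a
  combination of cos and sin, and Euler's formulas apply.\<close>

lemma trig_poly_real_polynomial:
  fixes p :: "complex \<Rightarrow> real"
  assumes "real_polynomial_function p"
  shows "trig_poly (\<lambda>t. of_real (p (cis t)))"
  using assms
proof induction
  case (linear f)
  then interpret bounded_linear f .
  have "f z = Re z * f 1 + Im z * f \<i>" for z
  proof -
    have "z = Re z *\<^sub>R 1 + Im z *\<^sub>R \<i>" by (simp add: complex_eq_iff)
    then have "f z = f (Re z *\<^sub>R 1 + Im z *\<^sub>R \<i>)" by (rule arg_cong)
    then show ?thesis by (simp only: add scaleR real_scaleR_def)
  qed
  then have "f (cis t) = cos t * f 1 + sin t * f \<i>" for t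
    by (metis cis.sel)
  moreover have "of_real (cos t * a + sin t * b) =
      ((a - \<i> * b) / 2) * iexp (of_int 1 * t) + ((a + \<i> * b) / 2) * iexp (of_int (-1) * t)" for t a b :: real
    by (simp add: complex_eq_iff Re_exp Im_exp algebra_simps add_divide_distrib[symmetric])
  ultimately have "of_real (f (cis t)) =
      ((f 1 - \<i> * f \<i>) / 2) * iexp (of_int 1 * t) + ((f 1 + \<i> * f \<i>) / 2) * iexp (of_int (-1) * t)" for t
    by presburger
  then show ?case by (simp only: trig_add trig_monom)
next
  case (mult f g)
  then show ?case using trig_poly_mult[OF mult.IH] by simp
qed (auto intro: trig_poly_const trig_add)

lemma trig_poly_polynomial:
  fixes p :: "complex \<Rightarrow> complex"
  assumes "polynomial_function p"
  shows "trig_poly (\<lambda>t. p (cis t))"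
proof -
  have "real_polynomial_function (Re \<circ> p)" "real_polynomial_function (Im \<circ> p)"
    using assms bounded_linear_Re bounded_linear_Im by (auto simp: polynomial_function_def)
  then have "trig_poly (\<lambda>t. of_real ((Re \<circ> p) (cis t)) + \<i> * of_real ((Im \<circ> p) (cis t)))"
    by (intro trig_add trig_poly_mult[OF trig_poly_const] trig_poly_real_polynomial)
  then show ?thesis by (simp flip: complex_eq)
qed

text \<open>A measurable F is an a.e. limit of continuous functions. These are forced into the ball
  of radius C, transplanted to the circle away from the cut of \<open>Arg\<close>, extended by
  Tietze without increasing the bound, and replaced by polynomials through Stone-Weierstrass. The
  uniform bound \<open>C + 1\<close> is kept for a later dominated convergence.\<close>

lemma trig_poly_approx_bounded:
  fixes F :: "real \<Rightarrow> complex"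
  assumes F[measurable]: "F \<in> borel_measurable borel" and bd: "\<And>x. cmod (F x) \<le> C" and r: "r > 0"
  shows "\<exists>p. (\<forall>n. trig_poly (p n)) \<and> (\<forall>n t. cmod (p n t) \<le> C + 1) \<and>
     (AE x in lborel. \<bar>x\<bar> < pi * r \<longrightarrow> (\<lambda>n. p n (x / r)) \<longlonglongrightarrow> F x)"
proof -
  have C: "0 \<le> C" using order.trans[OF norm_ge_zero bd] .
  have "F measurable_on UNIV"
    using measurable_on_iff_borel_measurable[of UNIV F] F
    by (simp add: lebesgue_on_UNIV_eq measurable_completion)
  then obtain N g where N: "negligible N" and g: "\<And>n. continuous_on UNIV (g n)"
    and lim: "\<And>x. x \<notin> N \<Longrightarrow> (\<lambda>n. g n x) \<longlonglongrightarrow> F x"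
    unfolding measurable_on_def by auto
  \<comment> \<open>Nearest-point projection onto the ball is continuous and fixes every value of F,
    so clamping the approximants does not disturb their limit.\<close>
  define cl where "cl = closest_point (cball (0::complex) C)"
  have cl_cont: "continuous_on UNIV cl"
    unfolding cl_def using C by (intro continuous_on_closest_point) auto
  have cl_bd: "cmod (cl z) \<le> C" for z
    using closest_point_in_set[of "cball (0::complex) C" z] C by (auto simp: cl_def)
  have cl_id: "cl (F x) = F x" for x
    unfolding cl_def using bd by (intro closest_point_self) auto
  \<comment> \<open>The arcs \<open>[-a n, a n]\<close> avoid the point -1, where \<open>Arg\<close>
    jumps, and exhaust \<open>(-pi, pi)\<close>; hence convergence is claimed only strictly inside
    the period.\<close>
  define a where "a n = pi - 1 / real (Suc n)" for n
  have a: "0 \<le> a n" "a n < pi" for n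
  proof -
    have "1 / real (Suc n) \<le> 1" by simp
    then show "0 \<le> a n" "a n < pi" using pi_gt3 unfolding a_def by (linarith, simp)
  qed
  have "\<exists>G. continuous_on UNIV G \<and> (\<forall>t\<in>{-a n..a n}. G (cis t) = cl (g n (r * t))) \<and> (\<forall>z. cmod (G z) \<le> C)" for n
  proof -
    let ?K = "cis ` {-a n..a n}"
    have cpt: "compact ?K"
      by (intro compact_continuous_image continuous_on_cis continuous_intros) auto
    have Arg: "Arg (cis t) = t" if "t \<in> {-a n..a n}" for t
      using that a[of n] by (intro Arg_cis) auto
    have cont: "continuous_on ?K (\<lambda>z. cl (g n (r * Arg z)))"
    proof -
      have "continuous_on ?K Arg"
      proof (intro continuous_at_imp_continuous_on ballI continuous_at_Arg notI)
        fix z assume "z \<in> ?K"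
        then obtain t where t: "z = cis t" "t \<in> {-a n..a n}" by auto
        assume "z \<in> \<real>\<^sub>\<le>\<^sub>0"
        then have "cmod z = - Re z" 
          by (auto simp: complex_nonpos_Reals_iff cmod_eq_Re)
        then have "cos t = -1" using t by simp
        moreover have "cos \<bar>t\<bar> > cos pi"
          using t(2) a[of n] by (intro cos_monotone_0_pi) auto
        ultimately show False by (simp add: abs_if split: if_splits)
      qed
      then have "continuous_on ?K (\<lambda>z. r * Arg z)"
        by (intro continuous_on_mult continuous_on_const)
      from continuous_on_compose2[OF g this] continuous_on_compose2[OF cl_cont]
      show ?thesis by blast
    qed
    obtain G where "continuous_on UNIV G" "\<And>z. z \<in> ?K \<Longrightarrow> G z = cl (g n (r * Arg z))" "\<And>z. z \<in> UNIV \<Longrightarrow> norm (G z) \<le> C"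
    proof (rule Tietze[OF cont _ C, of UNIV])
      show "closedin (top_of_set UNIV) ?K"
        using compact_imp_closed[OF cpt] by simp
    qed (use cl_bd in auto)
    then show ?thesis using Arg by (intro exI[of _ G]) auto
  qed
  then obtain G where G: "\<And>n. continuous_on UNIV (G n)"
    "\<And>n t. t \<in> {-a n..a n} \<Longrightarrow> G n (cis t) = cl (g n (r * t))" "\<And>n z. cmod (G n z) \<le> C" by metis
  have "\<exists>q. polynomial_function q \<and> (\<forall>z\<in>sphere 0 1. cmod (G n z - q z) < 1 / real (Suc n))" for n
    by (rule Stone_Weierstrass_polynomial_function) (auto intro: continuous_on_subset[OF G(1)])
  then obtain q where q: "\<And>n. polynomial_function (q n)"
    "\<And>n z. z \<in> sphere 0 1 \<Longrightarrow> cmod (G n z - q n z) < 1 / real (Suc n)" by metis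
  have qd: "cmod (G n (cis t) - q n (cis t)) < 1 / real (Suc n)" for n t
    by (rule q(2)) auto
  show ?thesis
  proof (intro exI[of _ "\<lambda>n t. q n (cis t)"] conjI allI)
    show "trig_poly (\<lambda>t. q n (cis t))" for n by (rule trig_poly_polynomial[OF q(1)])
    show "cmod (q n (cis t)) \<le> C + 1" for n t
    proof -
      have "cmod (q n (cis t)) \<le> cmod (G n (cis t)) + cmod (G n (cis t) - q n (cis t))"
        by (metis norm_minus_commute norm_triangle_sub)
      moreover have "1 / real (Suc n) \<le> 1" by simp
      ultimately show ?thesis using qd[of n t] G(3)[of n "cis t"] by linarith
    qed
    have "AE x in lebesgue. x \<notin> N" using N
      by (simp add: negligible_iff_null_sets AE_not_in)
    then have "AE x in lborel. x \<notin> N"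
      by (simp add: AE_completion_iff)
    then show "AE x in lborel. \<bar>x\<bar> < pi * r \<longrightarrow> (\<lambda>n. q n (cis (x / r))) \<longlonglongrightarrow> F x"
    proof eventually_elim
      case (elim x)
      show ?case
      proof
        assume x: "\<bar>x\<bar> < pi * r"
        then have xr: "\<bar>x / r\<bar> < pi" using r by (simp add: field_simps)
        have alim: "a \<longlonglongrightarrow> pi - 0" unfolding a_def
          by (intro tendsto_diff tendsto_const LIMSEQ_Suc lim_1_over_n)
        have "eventually (\<lambda>n. \<bar>x / r\<bar> < a n) sequentially"
          using order_tendstoD(1)[OF alim] xr by simp
        then have ev: "eventually (\<lambda>n. G n (cis (x / r)) = cl (g n x)) sequentially"
        proof eventually_elim
          case (elim n)
          then have "x / r \<in> {-a n..a n}" by (simp only: abs_le_iff atLeastAtMost_iff) linarith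
          then show ?case using r by (simp add: G(2))
        qed
        have "(\<lambda>n. cl (g n x)) \<longlonglongrightarrow> cl (F x)"
          by (rule continuous_on_tendsto_compose[OF cl_cont lim[OF elim]]) auto
        then have "(\<lambda>n. G n (cis (x / r))) \<longlonglongrightarrow> F x"
          using ev by (simp add: cl_id tendsto_cong)
        moreover have "(\<lambda>n. G n (cis (x/r)) - q n (cis (x/r))) \<longlonglongrightarrow> 0"
          by (rule Lim_null_comparison[OF _ LIMSEQ_Suc[OF lim_1_over_n]])
             (use less_imp_le[OF qd] in \<open>auto intro!: always_eventually simp del: of_nat_Suc\<close>)
        ultimately have "(\<lambda>n. G n (cis (x / r)) - (G n (cis (x/r)) - q n (cis (x/r)))) \<longlonglongrightarrow> F x - 0"
          by (rule tendsto_diff)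
        then show "(\<lambda>n. q n (cis (x / r))) \<longlonglongrightarrow> F x" by simp
      qed
    qed
  qed
qed

section \<open>Fourier series on an interval\<close>

lemma iexp_integral_Icc:
  assumes "B \<ge> 0"
  shows "(CLINT y|lborel. indicator {-B..B} y *\<^sub>R iexp (a * y)) = of_real (2 * B * sinc (a * B))"
proof (cases "a = 0")
  case True
  then show ?thesis using assms by (simp add: scaleR_conv_of_real)
next
  case False
  have "(CLINT y|lborel. indicator {-B..B} y *\<^sub>R iexp (a * y)) =
      iexp (a * B) / (\<i> * a) - iexp (a * (-B)) / (\<i> * a)"
  proof (rule integral_FTC_Icc)
    show "((\<lambda>y. iexp (a * y) / (\<i> * a)) has_vector_derivative iexp (a * x)) (at x within {-B..B})" for x
    proof -
      have "((\<lambda>z. exp (\<i> * a * z) / (\<i> * a)) has_field_derivative exp (\<i> * a * of_real x)) (at (of_real x))"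
        using False by (auto intro!: derivative_eq_intros)
      from has_vector_derivative_real_field[OF this]
      show ?thesis by (simp add: mult.assoc)
    qed
  qed (use assms in \<open>auto intro!: continuous_intros\<close>)
  also have "\<dots> = of_real (2 * B * sinc (a * B))"
    using False assms by (cases "B = 0")
      (auto simp: complex_eq_iff Re_exp Im_exp Re_divide Im_divide power2_eq_square)
  finally show ?thesis .
qed

section \<open>The orthogonal system \<open>phi_star\<close> and Fourier series on its band\<close>

lemma phi_star_measurable [measurable]: "phi_star m j \<in> borel_measurable borel"
  unfolding phi_star_def by measurable

lemma phi_star_eq_0: "y \<notin> {-pi * real m..pi * real m} \<Longrightarrow> phi_star m j y = 0"
  by (simp add: phi_star_def)

lemma phi_star_L2: "phi_star m j \<in> L2_space"
proof (rule bounded_compact_L2)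
  show "phi_star m j y = 0" if "y \<notin> {- (pi * real m)..pi * real m}" for y
    using that by (intro phi_star_eq_0) auto
  show "cmod (phi_star m j y) \<le> \<bar>real m powr (-1/2)\<bar>" for y
    by (auto simp: phi_star_def norm_mult indicator_def)
qed measurable

lemma phi_star_shift:
  assumes "m \<ge> 1"
  shows "phi_star m j y * cnj (phi_star m k y) =
    of_real (1 / m) * (indicator {-(pi * m)..pi * m} y *\<^sub>R iexp (of_int (j - k) / m * y))"
proof -
  have "real m powr (-1/2) * real m powr (-1/2) = 1 / m"
    using assms by (simp flip: powr_add add: powr_minus field_simps)
  then have "of_real (real m powr (-1/2)) * (of_real (real m powr (-1/2)) :: complex) = of_real (1 / m)"
    by (metis of_real_mult)
  moreover have "phi_star m j y * cnj (phi_star m k y) =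
     (of_real (real m powr (-1/2)) * of_real (real m powr (-1/2))) *
       (indicator {-(pi * m)..pi * m} y * (iexp (y * of_int j / m) * cnj (iexp (y * of_int k / m))))"
    unfolding phi_star_def by (simp add: indicator_def)
  ultimately have "phi_star m j y * cnj (phi_star m k y) =
     of_real (1 / m) * (indicator {-(pi * m)..pi * m} y * (iexp (y * of_int j / m) * cnj (iexp (y * of_int k / m))))"
    by (simp only:)
  also have "iexp (y * of_int j / m) * cnj (iexp (y * of_int k / m)) = iexp (of_int (j - k) / m * y)"
    by (simp add: exp_cnj exp_add[symmetric] algebra_simps diff_divide_distrib)
  finally show ?thesis by (simp add: indicator_def)
qed

text \<open>The squared length is \<open>2 * pi\<close> and not 1: \<open>phi_star m j\<close> is
  the transform, without normalising factor, of the unit vector \<open>phi m j\<close>, and in this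
  convention Plancherel carries \<open>2 * pi\<close>.\<close>

lemma phi_star_orthogonal:
  assumes "m \<ge> 1"
  shows "(CLINT y|lborel. phi_star m j y * cnj (phi_star m k y)) = (if j = k then 2 * of_real pi else 0)"
proof -
  have "(CLINT y|lborel. phi_star m j y * cnj (phi_star m k y)) =
     of_real (1 / m) * of_real (2 * (pi * m) * sinc (of_int (j - k) / m * (pi * m)))"
    by (simp only: phi_star_shift[OF assms] integral_mult_right_zero)
       (subst iexp_integral_Icc, auto)
  also have "of_int (j - k) / m * (pi * m) = pi * of_int (j - k)"
    using assms by simp
  also have "sinc (pi * of_int (j - k)) = (if j = k then 1 else 0)"
    by (simp add: sin_zero_iff_int2 del: of_int_diff)
  finally show ?thesis using assms by auto
qed

text \<open>Left unnormalised: because of the length of the basis vectors, the coefficient of F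
  along \<open>phi_star m j\<close> is \<open>fcoeff m F j / (2 * pi)\<close>. It is in this
  quotient form that \<open>a_hat\<close> reappears.\<close>

definition fcoeff :: "nat \<Rightarrow> (real \<Rightarrow> complex) \<Rightarrow> int \<Rightarrow> complex" where
  "fcoeff m F j = (CLINT y|lborel. F y * cnj (phi_star m j y))"

text \<open>The square is completed coefficient by coefficient. The last sum isolates the distance
  of b from the Fourier coefficients, so the formula yields best approximation, Bessel's inequality
  and monotonicity in J at once.\<close>

lemma trig_sum_error:
  assumes F: "F \<in> L2_space" and m: "m \<ge> 1"
  shows "(\<integral>y. (cmod (F y - (\<Sum>j\<in>J. b j * phi_star m j y)))\<^sup>2 \<partial>lborel) =
    (\<integral>y. (cmod (F y))\<^sup>2 \<partial>lborel) - (\<Sum>j\<in>J. (cmod (fcoeff m F j))\<^sup>2) / (2 * pi)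
      + 2 * pi * (\<Sum>j\<in>J. (cmod (b j - fcoeff m F j / (2 * pi)))\<^sup>2)"
\<comment> \<open>For infinite J every sum is 0 by convention and both sides are the squared norm of
  F; admitting all J keeps finiteness out of later rewriting.\<close>
proof (cases "finite J")
  case J: True
  let ?G = "\<lambda>y. \<Sum>j\<in>J. b j * phi_star m j y"
  have G: "?G \<in> L2_space"
    by (intro L2_space_sum L2_space_cmult phi_star_L2)
  have FG: "(CLINT y|lborel. F y * cnj (?G y)) = (\<Sum>j\<in>J. cnj (b j) * fcoeff m F j)"
  proof -
    have "(CLINT y|lborel. F y * cnj (?G y)) =
        (CLINT y|lborel. (\<Sum>j\<in>J. cnj (b j) * (F y * cnj (phi_star m j y))))"
      by (simp add: sum_distrib_left ac_simps)
    also have "\<dots> = (\<Sum>j\<in>J. cnj (b j) * fcoeff m F j)"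
      unfolding fcoeff_def
      by (subst Bochner_Integration.integral_sum)
         (auto intro!: integrable_mult_right integrable_mult_cnj F phi_star_L2)
    finally show ?thesis .
  qed
  have "(CLINT y|lborel. ?G y * cnj (?G y)) = (\<Sum>j\<in>J. cnj (b j) * fcoeff m ?G j)"
  proof -
    have "(CLINT y|lborel. ?G y * cnj (?G y)) =
        (CLINT y|lborel. (\<Sum>j\<in>J. cnj (b j) * (?G y * cnj (phi_star m j y))))"
      by (simp add: sum_distrib_left ac_simps)
    also have "\<dots> = (\<Sum>j\<in>J. cnj (b j) * fcoeff m ?G j)"
      unfolding fcoeff_def
      by (subst Bochner_Integration.integral_sum)
         (auto intro!: integrable_mult_right integrable_mult_cnj[OF G] phi_star_L2)
    finally show ?thesis .
  qed
  also have "\<dots> = (\<Sum>j\<in>J. cnj (b j) * (2 * of_real pi * b j))"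
  proof (intro sum.cong refl arg_cong2[where f="(*)"])
    fix j assume j: "j \<in> J"
    have "fcoeff m ?G j = (CLINT y|lborel. (\<Sum>i\<in>J. b i * (phi_star m i y * cnj (phi_star m j y))))"
      unfolding fcoeff_def by (simp add: sum_distrib_left sum_distrib_right ac_simps)
    also have "\<dots> = (\<Sum>i\<in>J. b i * (if i = j then 2 * of_real pi else 0))"
      by (subst Bochner_Integration.integral_sum)
         (auto intro!: integrable_mult_right integrable_mult_cnj phi_star_L2 simp: phi_star_orthogonal[OF m])
    also have "\<dots> = 2 * of_real pi * b j"
      using J j by (simp add: if_distrib cong: if_cong)
    finally show "fcoeff m ?G j = 2 * of_real pi * b j" .
  qed
  also have "\<dots> = of_real (2 * pi * (\<Sum>j\<in>J. (cmod (b j))\<^sup>2))"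
    unfolding of_real_mult of_real_sum sum_distrib_left complex_norm_square
    by (simp add: ac_simps)
  finally have GG: "(\<integral>y. (cmod (?G y))\<^sup>2 \<partial>lborel) = 2 * pi * (\<Sum>j\<in>J. (cmod (b j))\<^sup>2)"
    unfolding integral_mult_cnj_self[OF G] of_real_eq_iff .
  have eq: "2 * pi * (cmod (b j))\<^sup>2 - 2 * Re (cnj (b j) * c) =
      2 * pi * (cmod (b j - c / (2 * pi)))\<^sup>2 - (cmod c)\<^sup>2 / (2 * pi)" for j c
    by (simp add: cmod_power2) (simp add: field_simps power2_eq_square)
  have "(\<integral>y. (cmod (F y - ?G y))\<^sup>2 \<partial>lborel) = (\<integral>y. (cmod (F y))\<^sup>2 \<partial>lborel) +
      (\<Sum>j\<in>J. 2 * pi * (cmod (b j))\<^sup>2 - 2 * Re (cnj (b j) * fcoeff m F j))"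
    unfolding integral_cmod_diff_sq[OF F G] FG GG
    by (simp only: sum_subtractf Re_sum sum_distrib_left)
  also have "(\<Sum>j\<in>J. 2 * pi * (cmod (b j))\<^sup>2 - 2 * Re (cnj (b j) * fcoeff m F j)) =
      2 * pi * (\<Sum>j\<in>J. (cmod (b j - fcoeff m F j / (2 * pi)))\<^sup>2) - (\<Sum>j\<in>J. (cmod (fcoeff m F j))\<^sup>2) / (2 * pi)"
    unfolding eq by (simp only: sum_subtractf sum_distrib_left sum_divide_distrib)
  finally show ?thesis by simp
qed simp

text \<open>Rescaling by \<open>t = y / m\<close> turns trigonometric polynomials into combinations
  of \<open>phi_star m j\<close>; a.e. convergence under a uniform bound then becomes L2 convergence
  on the band.\<close>

lemma trig_dense_bounded:
  assumes F[measurable]: "F \<in> borel_measurable borel" and bd: "\<And>x. cmod (F x) \<le> C"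
    and supp: "\<And>y. y \<notin> {-pi * real m..pi * real m} \<Longrightarrow> F y = 0" and m: "m \<ge> 1" and e: "e > 0"
  shows "\<exists>J b. finite J \<and> L2_norm_sq (\<lambda>y. F y - (\<Sum>j\<in>J. b j * phi_star m j y)) < ennreal e"
proof -
  have m0: "real m > 0" using m by simp
  obtain p where p: "\<And>n. trig_poly (p n)" "\<And>n t. cmod (p n t) \<le> C + 1"
    "AE x in lborel. \<bar>x\<bar> < pi * m \<longrightarrow> (\<lambda>n. p n (x / m)) \<longlonglongrightarrow> F x"
    using trig_poly_approx_bounded[OF F bd m0] by blast
  let ?I = "{-pi * real m..pi * real m}"
  have "\<exists>J b. finite J \<and> (\<forall>y. indicator ?I y * p n (y / m) = (\<Sum>j\<in>J. b j * phi_star m j y))" for n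
  proof -
    obtain J b where Jb: "finite J" "\<And>t. p n t = (\<Sum>j\<in>J. b j * iexp (of_int j * t))"
      using trig_poly_expand[OF p(1)] by blast
    have "of_real (sqrt m) * of_real (real m powr (-1/2)) = (1 :: complex)"
      using m by (simp add: powr_half_sqrt[symmetric] flip: of_real_mult powr_add)
    then have "phi_star m j y * of_real (sqrt m) = indicator ?I y * iexp (of_int j * (y / m))" for j y
      unfolding phi_star_def by (simp add: ac_simps)
    then have "indicator ?I y * p n (y / m) = (\<Sum>j\<in>J. b j * of_real (sqrt m) * phi_star m j y)" for y
      unfolding Jb sum_distrib_left by (intro sum.cong) (auto simp: ac_simps)
    then show ?thesis using Jb(1) by (intro exI[of _ J] exI[of _ "\<lambda>j. b j * of_real (sqrt m)"]) auto
  qed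
  then obtain J b where Jb: "\<And>n. finite (J n)"
    "\<And>n y. indicator ?I y * p n (y / m) = (\<Sum>j\<in>J n. b n j * phi_star m j y)" by metis
  let ?D = "\<lambda>n y. (cmod (F y - indicator ?I y * p n (y / m)))\<^sup>2"
  have [measurable]: "(\<lambda>y. indicator ?I y * p n (y / m)) \<in> borel_measurable borel" for n
    unfolding Jb by measurable
  have "(\<lambda>n. \<integral>y. ?D n y \<partial>lborel) \<longlonglongrightarrow> (\<integral>y. 0 \<partial>(lborel :: real measure))"
  proof (rule integral_dominated_convergence)
    \<comment> \<open>The majorant adds the bound C of F to the bound \<open>C + 1\<close> of the
      polynomials.\<close>
    show "integrable lborel (\<lambda>y. (2 * C + 1)\<^sup>2 * indicator ?I y)"
      by (intro integrable_mult_right integrable_real_indicator) (auto simp: emeasure_lborel_Icc_eq)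
    show "AE y in lborel. norm (?D n y) \<le> (2 * C + 1)\<^sup>2 * indicator ?I y" for n
    proof (rule AE_I2)
      fix y
      have "cmod (F y - p n (y / m)) \<le> 2 * C + 1"
        using norm_triangle_ineq4[of "F y" "p n (y / m)"] bd[of y] p(2)[of n "y / m"] by linarith
      then show "norm (?D n y) \<le> (2 * C + 1)\<^sup>2 * indicator ?I y"
        using supp[of y] by (cases "y \<in> ?I") (auto intro!: power_mono)
    qed
    \<comment> \<open>The ends of the band, where the polynomials need not converge to F, form a
      null set.\<close>
    have "AE y in lborel. y \<noteq> - pi * real m" "AE y in lborel. y \<noteq> pi * real m"
      by (rule AE_lborel_singleton)+
    with p(3) show "AE y in lborel. (\<lambda>n. ?D n y) \<longlonglongrightarrow> 0"
    proof eventually_elim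
      case (elim y)
      show ?case
      proof (cases "y \<in> ?I")
        case True
        then have "\<bar>y\<bar> < pi * m" using elim by auto
        then have "(\<lambda>n. (cmod (F y - p n (y / m)))\<^sup>2) \<longlonglongrightarrow> (cmod (F y - F y))\<^sup>2"
          using elim by (intro tendsto_intros) auto
        then show ?thesis using True by simp
      qed (simp add: supp)
    qed
  qed measurable
  then have "eventually (\<lambda>n. (\<integral>y. ?D n y \<partial>lborel) < e) sequentially"
    by (rule order_tendstoD(2)) (use e in simp)
  then obtain n where n: "(\<integral>y. ?D n y \<partial>lborel) < e"
    by (auto simp: eventually_sequentially)
  have "F \<in> L2_space"
    using bounded_compact_L2[OF F _ bd, of "pi * m"] supp by auto
  then have "L2_norm_sq (\<lambda>y. F y - (\<Sum>j\<in>J n. b n j * phi_star m j y)) = ennreal (\<integral>y. ?D n y \<partial>lborel)"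
    unfolding Jb(2) by (intro L2_norm_sq_eq L2_space_diff L2_space_sum L2_space_cmult phi_star_L2)
  then show ?thesis
    using n e Jb(1) by (intro exI[of _ "J n"] exI[of _ "b n"]) (auto intro: ennreal_lessI)
qed

lemma trig_dense:
  assumes F: "F \<in> L2_space"
    and supp: "\<And>y. y \<notin> {-pi * real m..pi * real m} \<Longrightarrow> F y = 0" and m: "m \<ge> 1" and e: "e > 0"
  shows "\<exists>J b. finite J \<and> L2_norm_sq (\<lambda>y. F y - (\<Sum>j\<in>J. b j * phi_star m j y)) < ennreal e"
proof -
  have [measurable]: "F \<in> borel_measurable borel" by (rule L2_space_measurable[OF F])
  \<comment> \<open>Cutting off large values keeps the support and reduces the claim to bounded
    functions.\<close>
  define T where "T n y = (if cmod (F y) \<le> real n then F y else 0)" for n y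
  have T_meas[measurable]: "T n \<in> borel_measurable borel" for n unfolding T_def by measurable
  have T: "T n \<in> L2_space" for n
    by (rule L2_space_bound[OF F]) (auto simp: T_def)
  have "(\<lambda>n. \<integral>y. (cmod (F y - T n y))\<^sup>2 \<partial>lborel) \<longlonglongrightarrow> (\<integral>y. 0 \<partial>(lborel :: real measure))"
  proof (rule integral_dominated_convergence)
    show "integrable lborel (\<lambda>y. (cmod (F y))\<^sup>2)" by (rule L2_space_integrable[OF F])
    show "AE y in lborel. (\<lambda>n. (cmod (F y - T n y))\<^sup>2) \<longlonglongrightarrow> 0"
    proof (rule AE_I2)
      fix y
      obtain N where "cmod (F y) \<le> real N" using real_arch_simple by blast
      then have "eventually (\<lambda>n. (cmod (F y - T n y))\<^sup>2 = 0) sequentially"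
        unfolding eventually_sequentially T_def by (intro exI[of _ N]) auto
      then show "(\<lambda>n. (cmod (F y - T n y))\<^sup>2) \<longlonglongrightarrow> 0" by (rule tendsto_eventually)
    qed
  qed (auto simp: T_def)
  \<comment> \<open>Two errors below \<open>e / 4\<close> suffice, since the triangle inequality for
    squared norms doubles each of them.\<close>
  then have "eventually (\<lambda>n. (\<integral>y. (cmod (F y - T n y))\<^sup>2 \<partial>lborel) < e / 4) sequentially"
    by (rule order_tendstoD(2)) (use e in simp)
  then obtain n where n: "(\<integral>y. (cmod (F y - T n y))\<^sup>2 \<partial>lborel) < e / 4"
    by (auto simp: eventually_sequentially)
  have "\<exists>J b. finite J \<and> L2_norm_sq (\<lambda>y. T n y - (\<Sum>j\<in>J. b j * phi_star m j y)) < ennreal (e / 4)"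
    by (rule trig_dense_bounded[where C="real n"]) (use supp m e in \<open>auto simp: T_def\<close>)
  then obtain J b where Jb: "finite J" "L2_norm_sq (\<lambda>y. T n y - (\<Sum>j\<in>J. b j * phi_star m j y)) < ennreal (e / 4)"
    by blast
  have "L2_norm_sq (\<lambda>y. F y - (\<Sum>j\<in>J. b j * phi_star m j y)) \<le>
      2 * L2_norm_sq (\<lambda>y. F y - T n y) + 2 * L2_norm_sq (\<lambda>y. T n y - (\<Sum>j\<in>J. b j * phi_star m j y))"
    by (rule L2_norm_sq_triangle) measurable
  also have "\<dots> < 2 * ennreal (e / 4) + 2 * ennreal (e / 4)"
  proof (rule add_strict_mono)
    show "2 * L2_norm_sq (\<lambda>y. F y - T n y) < 2 * ennreal (e / 4)"
      unfolding L2_norm_sq_eq[OF L2_space_diff[OF F T]] using n e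
      by (intro ennreal_mult_strict_left_mono) (auto intro!: ennreal_lessI)
    show "2 * L2_norm_sq (\<lambda>y. T n y - (\<Sum>j\<in>J. b j * phi_star m j y)) < 2 * ennreal (e / 4)"
      using Jb(2) by (intro ennreal_mult_strict_left_mono) auto
  qed
  also have "2 * ennreal (e / 4) + 2 * ennreal (e / 4) = ennreal e"
    using e by (simp flip: ennreal_plus ennreal_numeral ennreal_mult)
  finally show ?thesis using Jb(1) by blast
qed

text \<open>Density plus best approximation: once K contains the index set of a good trigonometric
  sum, the Fourier sum over K is at least as close to F. The limit is along the net of finite sets,
  the mode of convergence used in \<open>L2_series\<close>.\<close>

lemma fourier_series_converges:
  assumes F: "F \<in> L2_space"
    and supp: "\<And>y. y \<notin> {-pi * real m..pi * real m} \<Longrightarrow> F y = 0" and m: "m \<ge> 1"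
  shows "((\<lambda>J. L2_norm_sq (\<lambda>y. F y - (\<Sum>j\<in>J. fcoeff m F j / (2 * pi) * phi_star m j y))) \<longlongrightarrow> 0)
    (finite_subsets_at_top UNIV)"
proof (rule order_tendstoI)
  fix e :: ennreal assume "0 < e"
  then obtain e' where e': "0 < e'" "ennreal e' \<le> e"
    by (cases e) (auto intro: that[of 1])
  obtain J b where J: "finite J" "L2_norm_sq (\<lambda>y. F y - (\<Sum>j\<in>J. b j * phi_star m j y)) < ennreal e'"
    using trig_dense[OF F supp m e'(1)] by blast
  have "eventually (\<lambda>K. finite K \<and> J \<subseteq> K) (finite_subsets_at_top UNIV)"
    using J(1) by (auto simp: eventually_finite_subsets_at_top)
  then show "eventually (\<lambda>K. L2_norm_sq (\<lambda>y. F y - (\<Sum>j\<in>K. fcoeff m F j / (2 * pi) * phi_star m j y)) < e)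
      (finite_subsets_at_top UNIV)"
  proof eventually_elim
    case (elim K)
    have "(\<integral>y. (cmod (F y - (\<Sum>j\<in>K. fcoeff m F j / (2 * pi) * phi_star m j y)))\<^sup>2 \<partial>lborel) =
        (\<integral>y. (cmod (F y))\<^sup>2 \<partial>lborel) - (\<Sum>j\<in>K. (cmod (fcoeff m F j))\<^sup>2) / (2 * pi)"
      unfolding trig_sum_error[OF F m] by simp
    also have "\<dots> \<le> (\<integral>y. (cmod (F y))\<^sup>2 \<partial>lborel) - (\<Sum>j\<in>J. (cmod (fcoeff m F j))\<^sup>2) / (2 * pi)"
      using elim by (intro diff_left_mono divide_right_mono sum_mono2) auto
    also have "\<dots> \<le> (\<integral>y. (cmod (F y - (\<Sum>j\<in>J. b j * phi_star m j y)))\<^sup>2 \<partial>lborel)"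
      unfolding trig_sum_error[OF F m] by (simp add: sum_nonneg)
    finally have "L2_norm_sq (\<lambda>y. F y - (\<Sum>j\<in>K. fcoeff m F j / (2 * pi) * phi_star m j y))
        \<le> L2_norm_sq (\<lambda>y. F y - (\<Sum>j\<in>J. b j * phi_star m j y))"
      by (subst (1 2) L2_norm_sq_eq; intro L2_space_diff F L2_space_sum L2_space_cmult phi_star_L2 ennreal_leI)
    then show ?case using J(2) e'(2) by (meson order.strict_trans1 order.strict_trans2)
  qed
qed simp

text \<open>At the Fourier coefficients the last term of \<open>trig_sum_error\<close> vanishes, so
  the error tending to 0 is the same as the partial sums of squared coefficients tending to their
  full value.\<close>

lemma fourier_parseval:
  assumes F: "F \<in> L2_space"
    and supp: "\<And>y. y \<notin> {-pi * real m..pi * real m} \<Longrightarrow> F y = 0" and m: "m \<ge> 1"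
  shows "((\<lambda>j. (cmod (fcoeff m F j))\<^sup>2) has_sum (2 * pi * (\<integral>y. (cmod (F y))\<^sup>2 \<partial>lborel))) UNIV"
proof -
  let ?D = "\<lambda>J. \<integral>y. (cmod (F y - (\<Sum>j\<in>J. fcoeff m F j / (2 * pi) * phi_star m j y)))\<^sup>2 \<partial>lborel"
  have "L2_norm_sq (\<lambda>y. F y - (\<Sum>j\<in>J. fcoeff m F j / (2 * pi) * phi_star m j y)) = ennreal (?D J)" for J
    by (intro L2_norm_sq_eq L2_space_diff F L2_space_sum L2_space_cmult phi_star_L2)
  moreover have "((\<lambda>J. L2_norm_sq (\<lambda>y. F y - (\<Sum>j\<in>J. fcoeff m F j / (2 * pi) * phi_star m j y))) \<longlongrightarrow> 0)
      (finite_subsets_at_top UNIV)"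
    by (rule fourier_series_converges[OF F supp m])
  ultimately have "((\<lambda>J. ennreal (?D J)) \<longlongrightarrow> ennreal 0) (finite_subsets_at_top UNIV)"
    by (simp only: ennreal_0)
  then have "(?D \<longlongrightarrow> 0) (finite_subsets_at_top UNIV)"
    by (subst (asm) tendsto_ennreal_iff) auto
  then have "((\<lambda>J. 2 * pi * ((\<integral>y. (cmod (F y))\<^sup>2 \<partial>lborel) - ?D J)) \<longlongrightarrow>
      2 * pi * ((\<integral>y. (cmod (F y))\<^sup>2 \<partial>lborel) - 0)) (finite_subsets_at_top UNIV)"
    by (intro tendsto_intros)
  also have "(\<lambda>J. 2 * pi * ((\<integral>y. (cmod (F y))\<^sup>2 \<partial>lborel) - ?D J)) = sum (\<lambda>j. (cmod (fcoeff m F j))\<^sup>2)"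
    unfolding trig_sum_error[OF F m] by (simp add: fun_eq_iff)
  finally show ?thesis by (simp add: has_sum_def)
qed

section \<open>The Fourier transform\<close>

definition ft :: "(real \<Rightarrow> complex) \<Rightarrow> real \<Rightarrow> complex" where
  "ft F x = (CLINT y|lborel. iexp (x * y) * F y)"

definition ift :: "(real \<Rightarrow> complex) \<Rightarrow> real \<Rightarrow> complex" where
  "ift F x = ft F (- x) / (2 * pi)"

lemma ft_measurable [measurable]:
  assumes [measurable]: "F \<in> borel_measurable borel"
  shows "ft F \<in> borel_measurable borel"
  unfolding ft_def by measurable

lemma ift_measurable [measurable]:
  assumes [measurable]: "F \<in> borel_measurable borel"
  shows "ift F \<in> borel_measurable borel"
  unfolding ift_def by measurable

lemma integrable_iexp_mult:
  assumes "integrable lborel F"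
  shows "integrable lborel (\<lambda>y. iexp (x * y) * F y)"
  by (rule Bochner_Integration.integrable_bound[OF assms])
     (use borel_measurable_integrable[OF assms] in \<open>auto simp: norm_mult\<close>)

lemma ft_diff:
  "integrable lborel F \<Longrightarrow> integrable lborel G \<Longrightarrow> ft (\<lambda>y. F y - G y) x = ft F x - ft G x"
  unfolding ft_def right_diff_distrib by (intro Bochner_Integration.integral_diff integrable_iexp_mult)

lemma ft_cmult: "ft (\<lambda>y. c * F y) x = c * ft F x"
  unfolding ft_def by (simp add: mult.left_commute)

lemma ft_sum:
  assumes "finite J" "\<And>j. j \<in> J \<Longrightarrow> integrable lborel (F j)"
  shows "ft (\<lambda>y. \<Sum>j\<in>J. F j y) x = (\<Sum>j\<in>J. ft (F j) x)"
  unfolding ft_def sum_distrib_left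
  by (intro Bochner_Integration.integral_sum integrable_iexp_mult assms)

lemma ft_cong_AE:
  assumes "AE y in lborel. F y = G y" "F \<in> borel_measurable borel" "G \<in> borel_measurable borel"
  shows "ft F x = ft G x"
  unfolding ft_def using assms by (intro integral_cong_AE) auto

lemma cmod_ft_le:
  shows "cmod (ft F x) \<le> (\<integral>y. cmod (F y) \<partial>lborel)"
  unfolding ft_def using integral_norm_bound[of lborel "\<lambda>y. iexp (x * y) * F y"]
  by (simp add: norm_mult)

lemma ift_diff:
  "integrable lborel F \<Longrightarrow> integrable lborel G \<Longrightarrow> ift (\<lambda>y. F y - G y) x = ift F x - ift G x"
  by (simp add: ift_def ft_diff diff_divide_distrib)

text \<open>The frequency side. The support condition is pointwise and not almost everywhere, so
  that indicators of the band can be inserted or dropped by rewriting.\<close>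

definition L2_on :: "real \<Rightarrow> (real \<Rightarrow> complex) set" where
  "L2_on B = {F \<in> L2_space. \<forall>y. y \<notin> {-B..B} \<longrightarrow> F y = 0}"

lemma L2_onD:
  assumes "F \<in> L2_on B"
  shows "F \<in> L2_space" "y \<notin> {-B..B} \<Longrightarrow> F y = 0" "integrable lborel F" "F \<in> borel_measurable borel"
  using assms L2_integrable_compact[of F B] L2_space_measurable[of F] by (auto simp: L2_on_def)

lemma L2_on_mono: "F \<in> L2_on B \<Longrightarrow> B \<le> C \<Longrightarrow> F \<in> L2_on C"
  by (auto simp: L2_on_def)

lemma L2_on_diff: "F \<in> L2_on B \<Longrightarrow> G \<in> L2_on B \<Longrightarrow> (\<lambda>y. F y - G y) \<in> L2_on B"
  by (auto simp: L2_on_def L2_space_diff)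

lemma L2_on_cmult: "F \<in> L2_on B \<Longrightarrow> (\<lambda>y. c * F y) \<in> L2_on B"
  by (auto simp: L2_on_def L2_space_cmult)

lemma L2_on_sum: "(\<And>j. j \<in> J \<Longrightarrow> F j \<in> L2_on B) \<Longrightarrow> (\<lambda>y. \<Sum>j\<in>J. F j y) \<in> L2_on B"
  by (auto simp: L2_on_def L2_space_sum)

lemma L2_on_indicator: "F \<in> L2_space \<Longrightarrow> (\<lambda>y. indicator {-B..B} y * F y) \<in> L2_on B"
  by (simp add: L2_on_def L2_space_indicator)

lemma L2_on_bounded:
  assumes [measurable]: "F \<in> borel_measurable borel" and "\<And>y. cmod (F y) \<le> C"
  shows "(\<lambda>y. indicator {-B..B} y * F y) \<in> L2_on B"
proof -
  have "C \<ge> 0" using order.trans[OF norm_ge_zero assms(2)] .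
  then have "(\<lambda>y. indicator {-B..B} y * F y) \<in> L2_space"
    by (intro bounded_compact_L2[where B=B and C=C]) (auto simp: indicator_def assms(2))
  then show ?thesis by (simp add: L2_on_def)
qed

subsection \<open>Plancherel\<close>

text \<open>Modulation by t shifts the sampling grid: for F supported in the band, the coefficients
  of the modulated function are, up to \<open>m^(-1/2)\<close>, the values of \<open>ft F\<close> at
  the points \<open>t - j / m\<close>.\<close>

lemma fcoeff_modulated:
  assumes "m \<ge> 1"
  shows "fcoeff m (\<lambda>y. iexp (t * y) * F y) j = of_real (real m powr (-1/2)) *
    (CLINT y|lborel. iexp ((t - of_int j / m) * y) * (indicator {-pi * m..pi * m} y * F y))"
proof -
  have "iexp (t * y) * F y * cnj (phi_star m j y) =
    of_real (real m powr (-1/2)) * (iexp ((t - of_int j / m) * y) * (indicator {-pi * m..pi * m} y * F y))" for y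
  proof -
    have "iexp ((t - of_int j / m) * y) = iexp (t * y) * cnj (iexp (y * of_int j / m))"
      by (simp add: exp_cnj exp_add[symmetric] algebra_simps)
    then show ?thesis unfolding phi_star_def by (simp add: indicator_def)
  qed
  then show ?thesis unfolding fcoeff_def by (simp only: integral_mult_right_zero)
qed

text \<open>Parseval's identity for the Fourier series of the modulated function
  \<open>exp(ity) F(y)\<close>, integrated over the period \<open>0 \<le> t < 1/m\<close>, is Plancherel's identity for \<open>F\<close>.\<close>

lemma plancherel_aux:
  assumes F: "F \<in> L2_on (pi * real m)" and m: "m \<ge> 1"
  shows "L2_norm_sq (ft F) = ennreal (2 * pi) * L2_norm_sq F"
proof -
  have [measurable]: "F \<in> borel_measurable borel" by (rule L2_onD(4)[OF F])
  define N where "N = (\<integral>y. (cmod (F y))\<^sup>2 \<partial>lborel)"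
  have N0: "N \<ge> 0" by (simp add: N_def)
  define h where "h x = (cmod (ft F x))\<^sup>2" for x
  have [measurable]: "h \<in> borel_measurable borel" unfolding h_def by measurable
  \<comment> \<open>The factor m undoes the \<open>m^(-1/2)\<close> in the coefficients. The value
    of the sum does not depend on t, because modulation preserves the norm.\<close>
  have hs: "((\<lambda>j. h (t - of_int j / m)) has_sum (2 * pi * m * N)) UNIV" for t :: real
  proof -
    let ?G = "\<lambda>y. iexp (t * y) * F y"
    have G: "?G \<in> L2_space"
      by (rule L2_space_bound[OF L2_onD(1)[OF F]]) (auto simp: norm_mult)
    have ind: "indicator {-pi * m..pi * m} y * F y = F y" for y
      using L2_onD(2)[OF F, of y] by (auto simp: indicator_def)
    have pm: "(real m powr (-1/2))\<^sup>2 = 1 / m"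
      using m by (simp add: power2_eq_square powr_minus field_simps flip: powr_add)
    have "((\<lambda>j. (cmod (fcoeff m ?G j))\<^sup>2) has_sum (2 * pi * (\<integral>y. (cmod (?G y))\<^sup>2 \<partial>lborel))) UNIV"
      by (rule fourier_parseval[OF G _ m]) (use L2_onD(2)[OF F] in auto)
    also have "(\<integral>y. (cmod (?G y))\<^sup>2 \<partial>lborel) = N" by (simp add: N_def norm_mult)
    also have "(\<lambda>j. (cmod (fcoeff m ?G j))\<^sup>2) = (\<lambda>j. 1 / m * h (t - of_int j / m))"
      unfolding fcoeff_modulated[OF m] ind ft_def[symmetric]
      by (simp only: norm_mult power_mult_distrib h_def norm_of_real power2_abs pm)
    finally have "((\<lambda>j. m * (1 / m * h (t - of_int j / m))) has_sum (m * (2 * pi * N))) UNIV"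
      by (rule has_sum_cmult_right)
    then show ?thesis using m by (simp add: ac_simps)
  qed
  \<comment> \<open>The translates \<open>[-j / m, (1 - j) / m)\<close> of one period tile the line;
    \<open>int_decode\<close> enumerates them so that the decomposition of the integral is a series
    over the naturals.\<close>
  define A where "A n = {- of_int (int_decode n) / m ..< (1 - of_int (int_decode n)) / real m}" for n
  have memA: "x \<in> A n \<longleftrightarrow> int_decode n = - \<lfloor>m * x\<rfloor>" for x :: real and n
  proof -
    have "x \<in> A n \<longleftrightarrow> of_int (- int_decode n) \<le> m * x \<and> m * x < of_int (- int_decode n) + 1"
      using m by (auto simp: A_def field_simps)
    also have "\<dots> \<longleftrightarrow> \<lfloor>m * x\<rfloor> = - int_decode n" by (simp add: floor_eq_iff)
    finally show ?thesis by auto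
  qed
  have disj: "disjoint_family A"
    by (auto simp: disjoint_family_on_def memA) (metis int_decode_eq)
  have "L2_norm_sq (ft F) = (\<integral>\<^sup>+x. ennreal (h x) \<partial>lborel)"
    by (simp add: L2_norm_sq_def h_def)
  also have "\<dots> = (\<integral>\<^sup>+x. (\<Sum>n. ennreal (h x) * indicator (A n) x) \<partial>lborel)"
  proof (intro nn_integral_cong)
    fix x :: real
    have "x \<in> A (int_encode (- \<lfloor>m * x\<rfloor>))" by (simp add: memA)
    from suminf_cmult_indicator[OF disj this, of "\<lambda>_. ennreal (h x)"]
    show "ennreal (h x) = (\<Sum>n. ennreal (h x) * indicator (A n) x)" by simp
  qed
  also have "\<dots> = (\<Sum>n. \<integral>\<^sup>+x. ennreal (h x) * indicator (A n) x \<partial>lborel)"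
    by (rule nn_integral_suminf) (simp add: A_def)
  also have "\<dots> = (\<Sum>n. \<integral>\<^sup>+t. ennreal (h (t - of_int (int_decode n) / m)) * indicator {0..<1/m} t \<partial>lborel)"
  proof (intro suminf_cong)
    fix n
    have "(\<integral>\<^sup>+x. ennreal (h x) * indicator (A n) x \<partial>lborel) =
        (\<integral>\<^sup>+t. ennreal (h (- (of_int (int_decode n) / m) + 1 * t)) * indicator (A n) (- (of_int (int_decode n) / m) + 1 * t) \<partial>lborel)"
      by (subst nn_integral_real_affine[where c=1 and t="- (of_int (int_decode n) / m)"]) (auto simp: A_def)
    also have "\<dots> = (\<integral>\<^sup>+t. ennreal (h (t - of_int (int_decode n) / m)) * indicator {0..<1/m} t \<partial>lborel)"
      by (intro nn_integral_cong) (auto simp: A_def indicator_def diff_divide_distrib)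
    finally show "(\<integral>\<^sup>+x. ennreal (h x) * indicator (A n) x \<partial>lborel) =
      (\<integral>\<^sup>+t. ennreal (h (t - of_int (int_decode n) / m)) * indicator {0..<1/m} t \<partial>lborel)" .
  qed
  also have "\<dots> = (\<integral>\<^sup>+t. (\<Sum>n. ennreal (h (t - of_int (int_decode n) / m)) * indicator {0..<1/m} t) \<partial>lborel)"
    by (rule nn_integral_suminf[symmetric]) measurable
  also have "\<dots> = (\<integral>\<^sup>+t. ennreal (2 * pi * m * N) * indicator {0..<1/real m} t \<partial>lborel)"
  proof (intro nn_integral_cong)
    fix t :: real
    have "((\<lambda>n. h (t - of_int (int_decode n) / m)) has_sum (2 * pi * m * N)) UNIV"
      using hs[of t] has_sum_reindex_bij_betw[OF bij_int_decode, of "\<lambda>j. h (t - of_int j / m)"] by blast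
    then have "(\<Sum>n. ennreal (h (t - of_int (int_decode n) / m))) = ennreal (2 * pi * m * N)"
      by (intro suminf_ennreal_eq has_sum_imp_sums) (auto simp: h_def)
    then show "(\<Sum>n. ennreal (h (t - of_int (int_decode n) / m)) * indicator {0..<1/m} t) =
        ennreal (2 * pi * m * N) * indicator {0..<1/real m} t"
      by simp
  qed
  also have "\<dots> = ennreal (2 * pi * m * N) * ennreal (1 / m)"
    by (subst nn_integral_cmult_indicator) (auto simp: emeasure_lborel_Ico)
  also have "\<dots> = ennreal (2 * pi) * ennreal N"
    using m N0 by (simp flip: ennreal_mult)
  also have "ennreal N = L2_norm_sq F"
    unfolding N_def by (rule L2_norm_sq_eq[OF L2_onD(1)[OF F], symmetric])
  finally show ?thesis .
qed

lemma L2_on_nat: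
  assumes "F \<in> L2_on B"
  obtains m where "m \<ge> 1" "F \<in> L2_on (pi * real m)"
proof -
  obtain n where n: "B \<le> real n" using real_arch_simple by blast
  have "real n \<le> 1 * real (Suc n)" by simp
  also have "\<dots> \<le> pi * real (Suc n)" using pi_gt3 by (intro mult_right_mono) auto
  finally have "real n \<le> pi * real (Suc n)" .
  with n L2_on_mono[OF assms] show ?thesis by (intro that[of "Suc n"]) auto
qed

lemma plancherel:
  assumes F: "F \<in> L2_on B"
  shows "L2_norm_sq (ft F) = ennreal (2 * pi) * L2_norm_sq F"
  using plancherel_aux L2_on_nat[OF F] by metis

lemma L2_norm_sq_reflect:
  assumes [measurable]: "f \<in> borel_measurable borel"
  shows "L2_norm_sq (\<lambda>x. f (- x)) = L2_norm_sq f"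
  unfolding L2_norm_sq_def
  by (subst (2) nn_integral_real_affine[where c="-1" and t=0]) auto

lemma plancherel_ift:
  assumes F: "F \<in> L2_on B"
  shows "L2_norm_sq (ift F) = ennreal (1 / (2 * pi)) * L2_norm_sq F"
proof -
  have [measurable]: "F \<in> borel_measurable borel" by (rule L2_onD(4)[OF F])
  have "L2_norm_sq (ift F) = L2_norm_sq (\<lambda>x. of_real (1 / (2 * pi)) * ft F (- x))"
    by (intro arg_cong[where f=L2_norm_sq]) (auto simp: ift_def fun_eq_iff)
  also have "\<dots> = ennreal ((1 / (2 * pi))\<^sup>2) * (ennreal (2 * pi) * L2_norm_sq F)"
    by (subst L2_norm_sq_cmult)
       (auto simp: L2_norm_sq_reflect[of "ft F"] plancherel[OF F] norm_divide norm_mult)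
  also have "\<dots> = ennreal ((1 / (2 * pi))\<^sup>2 * (2 * pi)) * L2_norm_sq F"
    by (subst ennreal_mult) (auto simp: mult.assoc)
  also have "(1 / (2 * pi))\<^sup>2 * (2 * pi) = 1 / (2 * pi)"
    by (simp add: power2_eq_square)
  finally show ?thesis .
qed

lemma ft_L2:
  assumes F: "F \<in> L2_on B"
  shows "ft F \<in> L2_space"
  using L2_onD(1,4)[OF F] plancherel[OF F] unfolding L2_space_iff_norm
  by (auto simp: ennreal_mult_less_top)

lemma ift_L2:
  assumes F: "F \<in> L2_on B"
  shows "ift F \<in> L2_space"
  using L2_onD(1,4)[OF F] plancherel_ift[OF F] unfolding L2_space_iff_norm
  by (auto simp: ennreal_mult_less_top)

lemma plancherel_ift_real:
  assumes F: "F \<in> L2_on B"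
  shows "(\<integral>x. (cmod (ift F x))\<^sup>2 \<partial>lborel) = (\<integral>y. (cmod (F y))\<^sup>2 \<partial>lborel) / (2 * pi)"
proof -
  have "ennreal (\<integral>x. (cmod (ift F x))\<^sup>2 \<partial>lborel) = ennreal ((\<integral>y. (cmod (F y))\<^sup>2 \<partial>lborel) / (2 * pi))"
    using plancherel_ift[OF F] ift_L2[OF F] L2_onD(1)[OF F]
    by (simp add: L2_norm_sq_eq flip: ennreal_mult)
  then show ?thesis by simp
qed

lemma plancherel_real:
  assumes F: "F \<in> L2_on B"
  shows "(\<integral>x. (cmod (ft F x))\<^sup>2 \<partial>lborel) = 2 * pi * (\<integral>y. (cmod (F y))\<^sup>2 \<partial>lborel)"
proof -
  have "ennreal (\<integral>x. (cmod (ft F x))\<^sup>2 \<partial>lborel) = ennreal (2 * pi * (\<integral>y. (cmod (F y))\<^sup>2 \<partial>lborel))"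
    using plancherel[OF F] ft_L2[OF F] L2_onD(1)[OF F]
    by (simp add: L2_norm_sq_eq flip: ennreal_mult)
  then show ?thesis by simp
qed

section \<open>Polarisation, duality and L2 inversion\<close>

lemma integral_mult_cnj_swap:
  "(CLINT x|lborel. g x * cnj (f x)) = cnj (CLINT x|lborel. f x * cnj (g x))"
  unfolding Bochner_Integration.integral_cnj[symmetric] by (simp add: mult.commute)

text \<open>Polarisation. Norms of differences give the real part of the inner product; replacing G
  by \<open>\<i> * G\<close> turns the imaginary part into a real part.\<close>

lemma plancherel_inner:
  assumes F: "F \<in> L2_on B" and G: "G \<in> L2_on B"
  shows "(CLINT x|lborel. ift F x * cnj (ift G x)) = (CLINT y|lborel. F y * cnj (G y)) / (2 * pi)"
proof -
  have re: "Re (CLINT x|lborel. ift F x * cnj (ift G x)) = Re (CLINT y|lborel. F y * cnj (G y)) / (2 * pi)"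
    if F: "F \<in> L2_on B" and G: "G \<in> L2_on B" for F G
  proof -
    have "(\<integral>x. (cmod (ift F x - ift G x))\<^sup>2 \<partial>lborel) = (\<integral>y. (cmod (F y - G y))\<^sup>2 \<partial>lborel) / (2 * pi)"
      using plancherel_ift_real[OF L2_on_diff[OF F G]] by (simp add: ift_diff L2_onD(3)[OF F] L2_onD(3)[OF G])
    then show ?thesis
      unfolding integral_cmod_diff_sq[OF ift_L2[OF F] ift_L2[OF G]]
        integral_cmod_diff_sq[OF L2_onD(1)[OF F] L2_onD(1)[OF G]]
        plancherel_ift_real[OF F] plancherel_ift_real[OF G]
      by (simp add: field_simps)
  qed
  have "ift (\<lambda>y. \<i> * G y) x = \<i> * ift G x" for x
    by (simp add: ift_def ft_cmult)
  then have eq: "(CLINT x|lborel. ift F x * cnj (ift (\<lambda>y. \<i> * G y) x)) = - \<i> * (CLINT x|lborel. ift F x * cnj (ift G x))"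
    "(CLINT y|lborel. F y * cnj (\<i> * G y)) = - \<i> * (CLINT y|lborel. F y * cnj (G y))"
    by (simp_all add: mult.left_commute[of _ \<i>])
  from re[OF F L2_on_cmult[OF G, of \<i>]] re[OF F G] show ?thesis
    unfolding eq by (simp add: complex_eq_iff Re_divide Im_divide power2_eq_square)
qed

text \<open>Fubini for the kernel \<open>exp(-ixy)\<close>, legitimate because both functions are
  integrable. It evaluates inner products with a transform before any L2 inversion is at
  hand.\<close>

lemma ft_adjoint:
  assumes F: "integrable lborel F" and h: "integrable lborel h"
  shows "(CLINT y|lborel. F y * cnj (ft h y)) = 2 * pi * (CLINT x|lborel. ift F x * cnj (h x))"
proof -
  have [measurable]: "F \<in> borel_measurable borel" "h \<in> borel_measurable borel"
    using borel_measurable_integrable[OF F] borel_measurable_integrable[OF h] by auto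
  let ?f = "\<lambda>x y. iexp (- x * y) * F y * cnj (h x)"
  have int: "integrable (lborel \<Otimes>\<^sub>M lborel) (case_prod ?f)"
  proof (rule lborel_pair.Fubini_integrable)
    have "(\<lambda>x. \<integral>y. norm (case_prod ?f (x, y)) \<partial>lborel) = (\<lambda>x. (\<integral>y. cmod (F y) \<partial>lborel) * cmod (h x))"
      by (simp add: norm_mult)
    then show "integrable lborel (\<lambda>x. \<integral>y. norm (case_prod ?f (x, y)) \<partial>lborel)"
      using h by simp
    show "AE x in lborel. integrable lborel (\<lambda>y. case_prod ?f (x, y))"
      using integrable_iexp_mult[OF F] by (intro AE_I2) (simp only: prod.case, intro integrable_mult_left)
  qed measurable
  have "cnj (ft h y) = (CLINT x|lborel. iexp (- x * y) * cnj (h x))" for y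
    unfolding ft_def Bochner_Integration.integral_cnj[symmetric] by (simp add: exp_cnj ac_simps)
  then have "(CLINT y|lborel. F y * cnj (ft h y)) = (CLINT y|lborel. (CLINT x|lborel. ?f x y))"
    by (simp add: ac_simps flip: integral_mult_right_zero)
  also have "\<dots> = (CLINT x|lborel. (CLINT y|lborel. ?f x y))"
    by (rule lborel_pair.Fubini_integral[OF int])
  also have "\<dots> = (CLINT x|lborel. 2 * pi * (ift F x * cnj (h x)))"
    by (simp add: ift_def ft_def)
  finally show ?thesis by simp
qed

lemma set_integral_eq_ft:
  "(CLINT x:{-R..R}|lborel. iexp (y * x) * h x) = ft (\<lambda>x. indicator {-R..R} x * h x) y"
  unfolding set_lebesgue_integral_def ft_def
  by (intro Bochner_Integration.integral_cong) (auto simp: indicator_def)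

lemma indicator_L2_limit:
  assumes h: "h \<in> L2_space"
  shows "((\<lambda>R. \<integral>x. (cmod (indicator {-R..R} x * h x))\<^sup>2 \<partial>lborel) \<longlongrightarrow> (\<integral>x. (cmod (h x))\<^sup>2 \<partial>lborel)) at_top"
proof (rule integral_dominated_convergence_at_top)
  have [measurable]: "h \<in> borel_measurable borel" by (rule L2_space_measurable[OF h])
  show "integrable lborel (\<lambda>x. (cmod (h x))\<^sup>2)" by (rule L2_space_integrable[OF h])
  show "\<forall>\<^sub>F R in at_top. AE x in lborel. norm ((cmod (indicator {-R..R} x * h x))\<^sup>2) \<le> (cmod (h x))\<^sup>2"
    by (auto intro!: always_eventually AE_I2 simp: indicator_def)
  show "AE x in lborel. ((\<lambda>R. (cmod (indicator {-R..R} x * h x))\<^sup>2) \<longlongrightarrow> (cmod (h x))\<^sup>2) at_top"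
  proof (rule AE_I2)
    fix x :: real
    have "\<forall>\<^sub>F R in at_top. (cmod (indicator {-R..R} x * h x))\<^sup>2 = (cmod (h x))\<^sup>2"
      using eventually_ge_at_top[of "\<bar>x\<bar>"] by eventually_elim (auto simp: indicator_def)
    then show "((\<lambda>R. (cmod (indicator {-R..R} x * h x))\<^sup>2) \<longlongrightarrow> (cmod (h x))\<^sup>2) at_top"
      by (rule tendsto_eventually)
  qed
qed (use L2_space_measurable[OF h] in measurable)

lemma indicator_L2_diff_limit:
  assumes h: "h \<in> L2_space"
  shows "((\<lambda>R. L2_norm_sq (\<lambda>x. h x - indicator {-R..R} x * h x)) \<longlongrightarrow> 0) at_top"
proof -
  have iL2: "(\<lambda>x. indicator {-R..R} x * h x) \<in> L2_space" for R :: real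
    using h by (rule L2_space_indicator) simp
  have "(\<integral>x. (cmod (h x - indicator {-R..R} x * h x))\<^sup>2 \<partial>lborel) =
      (\<integral>x. (cmod (h x))\<^sup>2 \<partial>lborel) - (\<integral>x. (cmod (indicator {-R..R} x * h x))\<^sup>2 \<partial>lborel)" for R :: real
    by (subst Bochner_Integration.integral_diff[symmetric],
        rule L2_space_integrable[OF h], rule L2_space_integrable[OF iL2])
       (auto intro!: Bochner_Integration.integral_cong simp: indicator_def)
  then have "((\<lambda>R. (\<integral>x. (cmod (h x - indicator {-R..R} x * h x))\<^sup>2 \<partial>lborel)) \<longlongrightarrow> 0) at_top"
    using tendsto_diff[OF tendsto_const indicator_L2_limit[OF h], of "\<integral>x. (cmod (h x))\<^sup>2 \<partial>lborel"] by simp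
  then have "((\<lambda>R. ennreal (\<integral>x. (cmod (h x - indicator {-R..R} x * h x))\<^sup>2 \<partial>lborel)) \<longlongrightarrow> ennreal 0) at_top"
    by (rule tendsto_ennrealI)
  then show ?thesis
    by (simp only: L2_norm_sq_eq[OF L2_space_diff[OF h iL2]] ennreal_0)
qed

text \<open>By \<open>ft_adjoint\<close>, the inner product of F with the transform of the
  truncation is \<open>2 * pi\<close> times the squared norm of the truncation, and by Plancherel so
  is the squared norm of that transform. The error is therefore a norm deficit, which tends to 0 by
  Plancherel for \<open>ift\<close>.\<close>

lemma ift_truncated_limit:
  assumes F: "F \<in> L2_on B"
  shows "((\<lambda>R. L2_norm_sq (\<lambda>y. F y - ft (\<lambda>x. indicator {-R..R} x * ift F x) y)) \<longlongrightarrow> 0) at_top"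
proof -
  define N where "N = (\<integral>y. (cmod (F y))\<^sup>2 \<partial>lborel)"
  define H where "H R x = indicator {-R..R} x * ift F x" for R x
  have H: "H R \<in> L2_on R" for R unfolding H_def by (rule L2_on_indicator[OF ift_L2[OF F]])
  have eq: "(\<integral>y. (cmod (F y - ft (H R) y))\<^sup>2 \<partial>lborel) = N - 2 * pi * (\<integral>x. (cmod (H R x))\<^sup>2 \<partial>lborel)" for R
  proof -
    have "(CLINT x|lborel. ift F x * cnj (H R x)) = (CLINT x|lborel. H R x * cnj (H R x))"
      by (intro Bochner_Integration.integral_cong) (auto simp: H_def indicator_def)
    then have "(CLINT y|lborel. F y * cnj (ft (H R) y)) = 2 * pi * of_real (\<integral>x. (cmod (H R x))\<^sup>2 \<partial>lborel)"
      using ft_adjoint[OF L2_onD(3)[OF F] L2_onD(3)[OF H]] integral_mult_cnj_self[OF L2_onD(1)[OF H]] by simp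
    then show ?thesis
      unfolding integral_cmod_diff_sq[OF L2_onD(1)[OF F] ft_L2[OF H]] plancherel_real[OF H]
      by (simp add: N_def)
  qed
  have "((\<lambda>R. N - 2 * pi * (\<integral>x. (cmod (H R x))\<^sup>2 \<partial>lborel)) \<longlongrightarrow> N - 2 * pi * (N / (2 * pi))) at_top"
    using indicator_L2_limit[OF ift_L2[OF F]] unfolding plancherel_ift_real[OF F] N_def[symmetric] H_def[symmetric]
    by (intro tendsto_intros)
  then have "((\<lambda>R. ennreal (\<integral>y. (cmod (F y - ft (H R) y))\<^sup>2 \<partial>lborel)) \<longlongrightarrow> ennreal 0) at_top"
    by (intro tendsto_ennrealI) (simp add: eq)
  then show ?thesis
    unfolding H_def[symmetric, abs_def]
    by (simp only: L2_norm_sq_eq[OF L2_space_diff[OF L2_onD(1)[OF F] ft_L2[OF H]]] ennreal_0)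
qed

lemma has_L2_fourier_ift:
  assumes F: "F \<in> L2_on B" and h: "h \<in> L2_space" and eq: "AE x in lborel. h x = ift F x"
  shows "has_L2_fourier h F"
proof -
  have [measurable]: "h \<in> borel_measurable borel" "F \<in> borel_measurable borel"
    using L2_space_measurable[OF h] L2_onD(4)[OF F] by auto
  have "ft (\<lambda>x. indicator {-R..R} x * h x) = ft (\<lambda>x. indicator {-R..R} x * ift F x)" for R :: real
    by (intro ext ft_cong_AE) (use eq in auto)
  then show ?thesis
    unfolding has_L2_fourier_def set_integral_eq_ft using ift_truncated_limit[OF F] h L2_onD(1)[OF F] by simp
qed

text \<open>Reflection exchanges the roles of the two transforms, so that
  \<open>ift_truncated_limit\<close> also recovers a function from its truncated forward
  transform.\<close>

lemma ift_indicator_ft: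
  "ift (\<lambda>y. indicator {-T..T} y * ft F y) = ft (\<lambda>x. indicator {-T..T} x * ift F x)"
proof
  fix x
  have "ft (\<lambda>y. indicator {-T..T} y * ift F y) x =
      (CLINT y|lborel. iexp (x * (0 + (-1) * y)) * (indicator {-T..T} (0 + (-1) * y) * ift F (0 + (-1) * y)))"
    unfolding ft_def by (subst lborel_integral_real_affine[where c="-1" and t=0]) auto
  also have "\<dots> = (CLINT y|lborel. iexp (- x * y) * (indicator {-T..T} y * ft F y) / (2 * pi))"
    by (intro Bochner_Integration.integral_cong) (auto simp: ift_def indicator_def)
  also have "\<dots> = ift (\<lambda>y. indicator {-T..T} y * ft F y) x"
    by (simp add: ift_def ft_def)
  finally show "ift (\<lambda>y. indicator {-T..T} y * ft F y) x = ft (\<lambda>x. indicator {-T..T} x * ift F x) x" ..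
qed

lemma L2_norm_sq_indicator_le: "L2_norm_sq (\<lambda>y. indicator A y * F y) \<le> L2_norm_sq F"
  unfolding L2_norm_sq_def by (intro nn_integral_mono) (auto simp: indicator_def)

text \<open>Here h need not be integrable, and u is known only as an L2 limit. Each truncation
  \<open>H R\<close> is compared with \<open>ift U\<close> through the \<open>ift\<close> of the
  cut-off transform of \<open>H R\<close>, a place where Plancherel applies; the cut-off T goes to
  infinity first, then R.\<close>

lemma L2_fourier_inversion:
  assumes hu: "has_L2_fourier h u" and U: "U \<in> L2_on B" and uU: "AE y in lborel. u y = U y"
  shows "AE x in lborel. h x = ift U x"
proof -
  have h: "h \<in> L2_space" and u: "u \<in> L2_space"
    and lim: "((\<lambda>R. L2_norm_sq (\<lambda>y. u y - ft (\<lambda>x. indicator {-R..R} x * h x) y)) \<longlongrightarrow> 0) at_top"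
    using hu unfolding has_L2_fourier_def set_integral_eq_ft by auto
  have [measurable]: "h \<in> borel_measurable borel" "u \<in> borel_measurable borel" "U \<in> borel_measurable borel"
    using L2_space_measurable[OF h] L2_space_measurable[OF u] L2_onD(4)[OF U] by auto
  define H where "H R x = indicator {-R..R} x * h x" for R x
  have H: "H R \<in> L2_on R" for R unfolding H_def by (rule L2_on_indicator[OF h])
  have [measurable]: "H R \<in> borel_measurable borel" for R by (rule L2_onD(4)[OF H])
  have step: "L2_norm_sq (\<lambda>x. H R x - ift U x) \<le> 2 * ennreal (1 / (2 * pi)) * L2_norm_sq (\<lambda>y. u y - ft (H R) y)" for R
  proof -
    define V where "V T = (\<lambda>y. indicator {-T..T} y * ft (H R) y)" for T
    have V: "V T \<in> L2_on T" for T unfolding V_def by (rule L2_on_indicator[OF ft_L2[OF H]])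
    have [measurable]: "V T \<in> borel_measurable borel" for T by (rule L2_onD(4)[OF V])
    have "((\<lambda>T. 2 * L2_norm_sq (\<lambda>x. H R x - ift (V T) x) + 2 * ennreal (1 / (2 * pi)) * L2_norm_sq (\<lambda>y. u y - ft (H R) y)) \<longlongrightarrow>
        2 * 0 + 2 * ennreal (1 / (2 * pi)) * L2_norm_sq (\<lambda>y. u y - ft (H R) y)) at_top"
      using ift_truncated_limit[OF H, of R] unfolding V_def ift_indicator_ft
      by (intro tendsto_add tendsto_const ennreal_tendsto_cmult) auto
    moreover have "\<forall>\<^sub>F T in at_top. L2_norm_sq (\<lambda>x. H R x - ift U x) \<le>
        2 * L2_norm_sq (\<lambda>x. H R x - ift (V T) x) + 2 * ennreal (1 / (2 * pi)) * L2_norm_sq (\<lambda>y. u y - ft (H R) y)"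
      \<comment> \<open>Once T exceeds B, the function U lies in the same band as
        \<open>V T\<close>, and the difference of the two is covered by
        \<open>plancherel_ift\<close>.\<close>
      using eventually_ge_at_top[of B]
    proof eventually_elim
      case (elim T)
      have UT: "U \<in> L2_on T" by (rule L2_on_mono[OF U elim])
      have "L2_norm_sq (\<lambda>x. ift (V T) x - ift U x) = L2_norm_sq (ift (\<lambda>y. V T y - U y))"
        by (simp only: ift_diff[OF L2_onD(3)[OF V] L2_onD(3)[OF U], abs_def])
      also have "\<dots> = ennreal (1 / (2 * pi)) * L2_norm_sq (\<lambda>y. V T y - U y)"
        by (rule plancherel_ift[OF L2_on_diff[OF V UT]])
      also have "L2_norm_sq (\<lambda>y. V T y - U y) = L2_norm_sq (\<lambda>y. indicator {-T..T} y * (u y - ft (H R) y))"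
        unfolding L2_norm_sq_minus[of "V T"]
      proof (rule L2_norm_sq_cong_AE)
        show "AE y in lborel. U y - V T y = indicator {-T..T} y * (u y - ft (H R) y)"
          using uU by eventually_elim (use L2_onD(2)[OF UT] in \<open>auto simp: V_def indicator_def\<close>)
      qed
      also have "\<dots> \<le> L2_norm_sq (\<lambda>y. u y - ft (H R) y)" by (rule L2_norm_sq_indicator_le)
      finally have "L2_norm_sq (\<lambda>x. ift (V T) x - ift U x) \<le> ennreal (1 / (2 * pi)) * L2_norm_sq (\<lambda>y. u y - ft (H R) y)"
        by (simp add: mult_left_mono)
      then have "2 * L2_norm_sq (\<lambda>x. ift (V T) x - ift U x) \<le> 2 * ennreal (1 / (2 * pi)) * L2_norm_sq (\<lambda>y. u y - ft (H R) y)"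
        unfolding mult.assoc by (rule mult_left_mono) simp
      moreover have "L2_norm_sq (\<lambda>x. H R x - ift U x) \<le>
          2 * L2_norm_sq (\<lambda>x. H R x - ift (V T) x) + 2 * L2_norm_sq (\<lambda>x. ift (V T) x - ift U x)"
        by (rule L2_norm_sq_triangle) measurable
      ultimately show ?case by (meson add_left_mono order.trans)
    qed
    ultimately show ?thesis
      by (intro tendsto_lowerbound[where F=at_top]) auto
  qed
  have "((\<lambda>R. 2 * L2_norm_sq (\<lambda>x. h x - H R x) + 2 * (2 * ennreal (1 / (2 * pi)) * L2_norm_sq (\<lambda>y. u y - ft (H R) y)))
      \<longlongrightarrow> 2 * 0 + 2 * (2 * ennreal (1 / (2 * pi)) * 0)) at_top"
    using indicator_L2_diff_limit[OF h] lim unfolding H_def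
    by (intro tendsto_add ennreal_tendsto_cmult) (auto simp: ennreal_mult_less_top)
  moreover have "L2_norm_sq (\<lambda>x. h x - ift U x) \<le>
      2 * L2_norm_sq (\<lambda>x. h x - H R x) + 2 * (2 * ennreal (1 / (2 * pi)) * L2_norm_sq (\<lambda>y. u y - ft (H R) y))" for R
  proof -
    have "L2_norm_sq (\<lambda>x. h x - ift U x) \<le> 2 * L2_norm_sq (\<lambda>x. h x - H R x) + 2 * L2_norm_sq (\<lambda>x. H R x - ift U x)"
      by (rule L2_norm_sq_triangle) measurable
    also have "\<dots> \<le> 2 * L2_norm_sq (\<lambda>x. h x - H R x) + 2 * (2 * ennreal (1 / (2 * pi)) * L2_norm_sq (\<lambda>y. u y - ft (H R) y))"
      by (intro add_left_mono mult_left_mono step) simp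
    finally show ?thesis .
  qed
  ultimately have "L2_norm_sq (\<lambda>x. h x - ift U x) \<le> 0"
    by (intro tendsto_lowerbound[where F=at_top]) (auto intro!: always_eventually)
  then show ?thesis by (intro L2_norm_sq_eq_0) auto
qed

subsection \<open>The projection on the space of band-limited functions\<close>

text \<open>The relational definition is traded for an explicit preimage under \<open>ift\<close>.
  All later arguments about the space go through this form.\<close>

lemma S_space_iff:
  "h \<in> S_space m \<longleftrightarrow> h \<in> L2_space \<and> (\<exists>U\<in>L2_on (pi * real m). AE x in lborel. h x = ift U x)"
proof
  assume "h \<in> S_space m"
  then obtain u where h: "h \<in> L2_space" and hu: "has_L2_fourier h u"
    and u0: "AE y in lborel. y \<notin> {- pi * real m..pi * real m} \<longrightarrow> u y = 0"
    by (auto simp: S_space_def)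
  have u: "u \<in> L2_space" using hu by (simp add: has_L2_fourier_def)
  let ?U = "\<lambda>y. indicator {-(pi * m)..pi * m} y * u y"
  have "AE x in lborel. h x = ift ?U x"
  proof (rule L2_fourier_inversion[OF hu L2_on_indicator[OF u]])
    show "AE y in lborel. u y = ?U y" using u0 by eventually_elim (auto simp: indicator_def)
  qed
  with h L2_on_indicator[OF u] show "h \<in> L2_space \<and> (\<exists>U\<in>L2_on (pi * real m). AE x in lborel. h x = ift U x)"
    by blast
next
  assume "h \<in> L2_space \<and> (\<exists>U\<in>L2_on (pi * real m). AE x in lborel. h x = ift U x)"
  then obtain U where h: "h \<in> L2_space" and U: "U \<in> L2_on (pi * real m)" and "AE x in lborel. h x = ift U x"
    by auto
  then have "has_L2_fourier h U" by (intro has_L2_fourier_ift)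
  moreover have "AE y in lborel. y \<notin> {- pi * real m..pi * real m} \<longrightarrow> U y = 0"
    using L2_onD(2)[OF U] by auto
  ultimately show "h \<in> S_space m" using h by (auto simp: S_space_def)
qed

lemma S_space_diff:
  assumes "h \<in> S_space m" "k \<in> S_space m"
  shows "(\<lambda>x. h x - k x) \<in> S_space m"
proof -
  obtain U where U: "h \<in> L2_space" "U \<in> L2_on (pi * real m)" "AE x in lborel. h x = ift U x"
    using assms(1) by (auto simp: S_space_iff)
  obtain V where V: "k \<in> L2_space" "V \<in> L2_on (pi * real m)" "AE x in lborel. k x = ift V x"
    using assms(2) by (auto simp: S_space_iff)
  have "AE x in lborel. h x - k x = ift (\<lambda>y. U y - V y) x"
    using U(3) V(3) by eventually_elim (simp add: ift_diff[OF L2_onD(3)[OF U(2)] L2_onD(3)[OF V(2)]])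
  then show ?thesis
    using L2_space_diff[OF U(1) V(1)] L2_on_diff[OF U(2) V(2)] by (auto simp: S_space_iff)
qed

text \<open>Testing g against band-limited functions sees only the part of \<open>ft g\<close>
  inside the band; this is what identifies the projection.\<close>

lemma inner_ift:
  assumes g: "integrable lborel g" and U: "U \<in> L2_on B"
  shows "(CLINT x|lborel. g x * cnj (ift U x)) =
    (CLINT y|lborel. indicator {-B..B} y * ft g y * cnj (U y)) / (2 * pi)"
proof -
  have "(CLINT x|lborel. g x * cnj (ift U x)) = cnj (CLINT x|lborel. ift U x * cnj (g x))"
    by (rule integral_mult_cnj_swap)
  also have "\<dots> = cnj ((CLINT y|lborel. U y * cnj (ft g y)) / (2 * pi))"
    by (simp add: ft_adjoint[OF L2_onD(3)[OF U] g])
  also have "\<dots> = (CLINT y|lborel. ft g y * cnj (U y)) / (2 * pi)"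
    by (simp add: integral_mult_cnj_swap[of "ft g"])
  also have "(CLINT y|lborel. ft g y * cnj (U y)) = (CLINT y|lborel. indicator {-B..B} y * ft g y * cnj (U y))"
    using L2_onD(2)[OF U] by (intro Bochner_Integration.integral_cong) (auto simp: indicator_def)
  finally show ?thesis .
qed

text \<open>The \<open>ift\<close> of the cut-off transform has the defining property, so
  \<open>SOME\<close> picks something that has it. The difference of the two lies in the space and
  is orthogonal to the space, hence to itself, and vanishes a.e.\<close>

lemma L2_orth_proj_S_space:
  fixes m :: nat
  assumes g: "g \<in> L2_space" and gi: "integrable lborel g"
  defines "p \<equiv> L2_orth_proj (S_space m) g"
  shows "p \<in> S_space m"
    and "\<And>h. h \<in> S_space m \<Longrightarrow> (CLINT x|lborel. (g x - p x) * cnj (h x)) = 0"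
    and "AE x in lborel. p x = ift (\<lambda>y. indicator {-(pi * real m)..pi * real m} y * ft g y) x"
proof -
  let ?G = "\<lambda>y. indicator {-(pi * real m)..pi * real m} y * ft g y"
  have G: "?G \<in> L2_on (pi * real m)"
    using borel_measurable_integrable[OF gi] by (intro L2_on_bounded[OF _ cmod_ft_le] ft_measurable) simp
  have q: "ift ?G \<in> S_space m"
    using ift_L2[OF G] G by (auto simp: S_space_iff)
  have orth: "(CLINT x|lborel. (g x - ift ?G x) * cnj (h x)) = 0" if "h \<in> S_space m" for h
  proof -
    obtain U where U: "h \<in> L2_space" "U \<in> L2_on (pi * real m)" "AE x in lborel. h x = ift U x"
      using \<open>h \<in> S_space m\<close> by (auto simp: S_space_iff)
    have "(CLINT x|lborel. (g x - ift ?G x) * cnj (h x)) = (CLINT x|lborel. (g x - ift ?G x) * cnj (ift U x))"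
      using L2_space_measurable[OF g] L2_space_measurable[OF U(1)] L2_onD(4)[OF U(2)] L2_onD(4)[OF G]
      by (intro integral_cong_AE) (use U(3) in auto)
    also have "\<dots> = (CLINT x|lborel. g x * cnj (ift U x)) - (CLINT x|lborel. ift ?G x * cnj (ift U x))"
      unfolding left_diff_distrib
      by (intro Bochner_Integration.integral_diff integrable_mult_cnj g ift_L2[OF G] ift_L2[OF U(2)])
    also have "\<dots> = 0"
      unfolding inner_ift[OF gi U(2)] plancherel_inner[OF G U(2)] by simp
    finally show ?thesis .
  qed
  have ex: "\<exists>p. p \<in> S_space m \<and> (\<forall>h\<in>S_space m. (CLINT x|lborel. (g x - p x) * cnj (h x)) = 0)"
    using q orth by blast
  have p: "p \<in> S_space m \<and> (\<forall>h\<in>S_space m. (CLINT x|lborel. (g x - p x) * cnj (h x)) = 0)"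
    unfolding p_def L2_orth_proj_def by (rule someI_ex[OF ex])
  then show pS: "p \<in> S_space m" and porth: "\<And>h. h \<in> S_space m \<Longrightarrow> (CLINT x|lborel. (g x - p x) * cnj (h x)) = 0"
    by auto
  have pL: "p \<in> L2_space" using pS by (simp add: S_space_iff)
  let ?d = "\<lambda>x. p x - ift ?G x"
  have d: "?d \<in> S_space m" by (rule S_space_diff[OF pS q])
  have dL: "?d \<in> L2_space" by (rule L2_space_diff[OF pL ift_L2[OF G]])
  have "(CLINT x|lborel. ?d x * cnj (?d x)) =
      (CLINT x|lborel. (g x - ift ?G x) * cnj (?d x) - (g x - p x) * cnj (?d x))"
    by (intro Bochner_Integration.integral_cong refl) (simp add: algebra_simps)
  also have "\<dots> = (CLINT x|lborel. (g x - ift ?G x) * cnj (?d x)) - (CLINT x|lborel. (g x - p x) * cnj (?d x))"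
    by (intro Bochner_Integration.integral_diff integrable_mult_cnj L2_space_diff g ift_L2[OF G] pL)
  also have "\<dots> = 0" using orth[OF d] porth[OF d] by simp
  finally have "(\<integral>x. (cmod (?d x))\<^sup>2 \<partial>lborel) = 0"
    unfolding integral_mult_cnj_self[OF dL] by simp
  then have "L2_norm_sq ?d = 0" by (simp add: L2_norm_sq_eq[OF dL])
  then show "AE x in lborel. p x = ift ?G x"
    using L2_space_measurable[OF pL] L2_onD(4)[OF G] by (intro L2_norm_sq_eq_0) auto
qed

section \<open>From the frequency basis back to the sinc basis\<close>

lemma ift_phi_star:
  assumes "m \<ge> 1"
  shows "ift (phi_star m j) x = of_real (phi m j x)"
proof -
  have pm: "real m powr (-1/2) * real m = sqrt m"
    using assms powr_add[of "real m" "-1/2" 1] by (simp add: powr_half_sqrt[symmetric])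
  have "ft (phi_star m j) (- x) = (CLINT y|lborel. of_real (real m powr (-1/2)) *
      (indicator {-(pi * m)..pi * m} y *\<^sub>R iexp ((of_int j / m - x) * y)))"
    unfolding ft_def
  proof (intro Bochner_Integration.integral_cong refl)
    fix y
    have "iexp (- x * y) * iexp (y * of_int j / m) = iexp ((of_int j / m - x) * y)"
      by (simp add: exp_add[symmetric] algebra_simps)
    then show "iexp (- x * y) * phi_star m j y = of_real (real m powr (-1/2)) *
      (indicator {-(pi * m)..pi * m} y *\<^sub>R iexp ((of_int j / m - x) * y))"
      unfolding phi_star_def by (simp add: indicator_def)
  qed
  also have "\<dots> = of_real (real m powr (-1/2)) * of_real (2 * (pi * m) * sinc ((of_int j / m - x) * (pi * m)))"
    by (subst integral_mult_right_zero, subst iexp_integral_Icc) auto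
  also have "(of_int j / m - x) * (pi * m) = - (pi * (real m * x - of_int j))"
    using assms by (simp add: field_simps)
  also have "sinc (- (pi * (real m * x - of_int j))) = sinc (pi * (real m * x - of_int j))"
    by (rule sinc_neg)
  finally have "ft (phi_star m j) (- x) = of_real (2 * pi * ((real m powr (-1/2) * real m) * sinc (pi * (real m * x - of_int j))))"
    by (simp only: of_real_mult ac_simps)
  then show ?thesis
    unfolding ift_def phi_def pm by simp
qed

text \<open>Plancherel carries the Fourier series of F over to the series in \<open>phi m j\<close>,
  so a limit exists and the \<open>SOME\<close> is meaningful; uniqueness of L2 limits identifies
  the chosen sum with \<open>ift F\<close> a.e.\<close>

lemma L2_series_fourier:
  assumes F: "F \<in> L2_on (pi * real m)" and m: "m \<ge> 1"
  defines "s \<equiv> L2_series (\<lambda>j x. fcoeff m F j / (2 * pi) * of_real (phi m j x))"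
  shows "s \<in> L2_space" "AE x in lborel. s x = ift F x"
proof -
  let ?a = "\<lambda>j. fcoeff m F j / (2 * pi)"
  let ?t = "\<lambda>J x. \<Sum>j\<in>J. ?a j * of_real (phi m j x)"
  have e: "phi_star m j \<in> L2_on (pi * real m)" for j
    using phi_star_L2 phi_star_eq_0[of _ m j] by (auto simp: L2_on_def)
  have S: "(\<lambda>y. \<Sum>j\<in>J. ?a j * phi_star m j y) \<in> L2_on (pi * real m)" for J
    by (intro L2_on_sum L2_on_cmult e)
  have iS: "ift (\<lambda>y. \<Sum>j\<in>J. ?a j * phi_star m j y) x = ?t J x" if "finite J" for J x
    unfolding ift_phi_star[OF m, symmetric] ift_def
      ft_sum[OF that L2_onD(3)[OF L2_on_cmult[OF e]]] ft_cmult by (simp add: sum_divide_distrib)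
  have norm: "L2_norm_sq (\<lambda>x. ift F x - ?t J x) =
      ennreal (1 / (2 * pi)) * L2_norm_sq (\<lambda>y. F y - (\<Sum>j\<in>J. ?a j * phi_star m j y))" if "finite J" for J
  proof -
    have "(\<lambda>x. ift F x - ?t J x) = ift (\<lambda>y. F y - (\<Sum>j\<in>J. ?a j * phi_star m j y))"
      by (rule ext) (simp only: iS[OF that] ift_diff[OF L2_onD(3)[OF F] L2_onD(3)[OF S]])
    then show ?thesis by (simp only: plancherel_ift[OF L2_on_diff[OF F S]])
  qed
  \<comment> \<open>The transform is exchanged with finite sums only, so the identity of norms is
    used eventually along the net of finite sets.\<close>
  have ev: "\<forall>\<^sub>F J in finite_subsets_at_top UNIV. finite (J :: int set)"
    by (rule eventually_finite_subsets_at_top_weakI)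
  have "((\<lambda>J. ennreal (1 / (2 * pi)) * L2_norm_sq (\<lambda>y. F y - (\<Sum>j\<in>J. ?a j * phi_star m j y))) \<longlongrightarrow>
      ennreal (1 / (2 * pi)) * 0) (finite_subsets_at_top UNIV)"
    by (intro ennreal_tendsto_cmult fourier_series_converges L2_onD(1)[OF F] m) (use L2_onD(2)[OF F] in auto)
  then have lim: "((\<lambda>J. L2_norm_sq (\<lambda>x. ift F x - ?t J x)) \<longlongrightarrow> 0) (finite_subsets_at_top UNIV)"
    unfolding mult_zero_right
    by (rule Lim_transform_eventually) (rule eventually_mono[OF ev], simp only: norm)
  have "\<exists>s. s \<in> L2_space \<and> ((\<lambda>J. L2_norm_sq (\<lambda>x. s x - ?t J x)) \<longlongrightarrow> 0) (finite_subsets_at_top UNIV)"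
    using ift_L2[OF F] lim by blast
  from someI_ex[OF this] have s: "s \<in> L2_space" "((\<lambda>J. L2_norm_sq (\<lambda>x. s x - ?t J x)) \<longlongrightarrow> 0) (finite_subsets_at_top UNIV)"
    unfolding s_def L2_series_def by auto
  show "s \<in> L2_space" by fact
  have [measurable]: "s \<in> borel_measurable borel" "F \<in> borel_measurable borel" "\<And>j. phi m j \<in> borel_measurable borel"
    using L2_space_measurable[OF s(1)] L2_onD(4)[OF F] unfolding phi_def by (auto intro!: borel_measurable_times borel_measurable_sinc[THEN measurable_compose[rotated]])
  have "((\<lambda>J. 2 * L2_norm_sq (\<lambda>x. s x - ?t J x) + 2 * L2_norm_sq (\<lambda>x. ift F x - ?t J x)) \<longlongrightarrow> 2 * 0 + 2 * 0)
      (finite_subsets_at_top UNIV)"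
    by (intro tendsto_add ennreal_tendsto_cmult s(2) lim) auto
  moreover have "L2_norm_sq (\<lambda>x. s x - ift F x) \<le> 2 * L2_norm_sq (\<lambda>x. s x - ?t J x) + 2 * L2_norm_sq (\<lambda>x. ift F x - ?t J x)" for J
    unfolding L2_norm_sq_minus[of "ift F"] by (rule L2_norm_sq_triangle) measurable
  ultimately have "L2_norm_sq (\<lambda>x. s x - ift F x) \<le> 0"
    by (intro tendsto_lowerbound[where F="finite_subsets_at_top UNIV"]) (auto intro!: always_eventually)
  then show "AE x in lborel. s x = ift F x" by (intro L2_norm_sq_eq_0) auto
qed

text \<open>The difference of s and the projection lies in the space, hence is orthogonal to the
  projection error. It alone depends on s, and it is measured on the frequency side.\<close>

lemma L2_norm_sq_pythagoras:
  assumes g: "g \<in> L2_space" and gi: "integrable lborel g"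
    and s: "s \<in> L2_space" and F: "F \<in> L2_on (pi * real m)" and sF: "AE x in lborel. s x = ift F x"
  shows "L2_norm_sq (\<lambda>x. g x - s x) = L2_norm_sq (\<lambda>x. g x - L2_orth_proj (S_space m) g x) +
    ennreal (1 / (2 * pi)) * L2_norm_sq (\<lambda>y. indicator {-(pi * real m)..pi * real m} y * ft g y - F y)"
proof -
  let ?p = "L2_orth_proj (S_space m) g"
  let ?G = "\<lambda>y. indicator {-(pi * real m)..pi * real m} y * ft g y"
  note P = L2_orth_proj_S_space[OF g gi, where m=m]
  have G: "?G \<in> L2_on (pi * real m)"
    using borel_measurable_integrable[OF gi] by (intro L2_on_bounded[OF _ cmod_ft_le] ft_measurable) simp
  have pL: "?p \<in> L2_space" using P(1) by (simp add: S_space_iff)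
  have sS: "s \<in> S_space m" using s F sF by (auto simp: S_space_iff)
  have sp: "(\<lambda>x. s x - ?p x) \<in> S_space m" by (rule S_space_diff[OF sS P(1)])
  have "(\<integral>x. (cmod (g x - s x))\<^sup>2 \<partial>lborel) = (\<integral>x. (cmod ((g x - ?p x) - (s x - ?p x)))\<^sup>2 \<partial>lborel)"
    by simp
  also have "\<dots> = (\<integral>x. (cmod (g x - ?p x))\<^sup>2 \<partial>lborel) + (\<integral>x. (cmod (s x - ?p x))\<^sup>2 \<partial>lborel)"
    by (simp only: integral_cmod_diff_sq[OF L2_space_diff[OF g pL] L2_space_diff[OF s pL]] P(2)[OF sp]) simp
  finally have "L2_norm_sq (\<lambda>x. g x - s x) = L2_norm_sq (\<lambda>x. g x - ?p x) + L2_norm_sq (\<lambda>x. s x - ?p x)"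
    by (simp add: L2_norm_sq_eq L2_space_diff g s pL ennreal_plus)
  also have "L2_norm_sq (\<lambda>x. s x - ?p x) = L2_norm_sq (\<lambda>x. ?p x - s x)" by (rule L2_norm_sq_minus)
  also have "\<dots> = L2_norm_sq (ift (\<lambda>y. ?G y - F y))"
    by (rule L2_norm_sq_cong_AE)
       (use P(3) sF in \<open>eventually_elim, simp add: ift_diff[OF L2_onD(3)[OF G] L2_onD(3)[OF F]]\<close>)
  also have "\<dots> = ennreal (1 / (2 * pi)) * L2_norm_sq (\<lambda>y. ?G y - F y)"
    by (rule plancherel_ift[OF L2_on_diff[OF G F]])
  finally show ?thesis .
qed

section \<open>Moments of sums of i.i.d. variables\<close>

text \<open>With u depending on two partial sums, every monomial of the expansion in
  \<open>iid_mixed\<close> splits into past and present by this one rule.\<close>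

lemma (in prob_space) indep_past_expectation:
  fixes Z :: "nat \<Rightarrow> 'a \<Rightarrow> real" and f g v :: "real \<Rightarrow> real" and u :: "real \<Rightarrow> real \<Rightarrow> real"
  assumes Z: "indep_vars (\<lambda>_. borel) Z {..<Suc n}"
    and [measurable]: "f \<in> borel_measurable borel" "g \<in> borel_measurable borel" "v \<in> borel_measurable borel"
      "case_prod u \<in> borel_measurable (borel \<Otimes>\<^sub>M borel)"
    and U: "integrable M (\<lambda>w. u (\<Sum>k<n. f (Z k w)) (\<Sum>k<n. g (Z k w)))"
    and V: "integrable M (\<lambda>w. v (Z n w))"
  shows "integrable M (\<lambda>w. u (\<Sum>k<n. f (Z k w)) (\<Sum>k<n. g (Z k w)) * v (Z n w))" (is ?int)
    and "expectation (\<lambda>w. u (\<Sum>k<n. f (Z k w)) (\<Sum>k<n. g (Z k w)) * v (Z n w)) =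
      expectation (\<lambda>w. u (\<Sum>k<n. f (Z k w)) (\<Sum>k<n. g (Z k w))) * expectation (\<lambda>w. v (Z n w))" (is ?eq)
proof -
  let ?u = "\<lambda>z. u (\<Sum>k<n. f (z k)) (\<Sum>k<n. g (z k))"
  have sub: "{..<n} \<inter> {n} = {}" "{..<n} \<subseteq> {..<Suc n}" "{n} \<subseteq> {..<Suc n}" by auto
  have "indep_var borel (?u \<circ> (\<lambda>w. restrict (\<lambda>i. Z i w) {..<n})) borel ((\<lambda>z. v (z n)) \<circ> (\<lambda>w. restrict (\<lambda>i. Z i w) {n}))"
    by (rule indep_var_compose[OF indep_var_restrict[OF Z sub]]) measurable
  moreover have "?u \<circ> (\<lambda>w. restrict (\<lambda>i. Z i w) {..<n}) = (\<lambda>w. u (\<Sum>k<n. f (Z k w)) (\<Sum>k<n. g (Z k w)))"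
    by (auto simp: fun_eq_iff)
  moreover have "(\<lambda>z. v (z n)) \<circ> (\<lambda>w. restrict (\<lambda>i. Z i w) {n}) = (\<lambda>w. v (Z n w))"
    by (auto simp: fun_eq_iff)
  ultimately have "indep_var borel (\<lambda>w. u (\<Sum>k<n. f (Z k w)) (\<Sum>k<n. g (Z k w))) borel (\<lambda>w. v (Z n w))"
    by simp
  from indep_var_integrable[OF this U V] indep_var_lebesgue_integral[OF this U V] show ?int ?eq by auto
qed

lemma (in prob_space) expectation_square_le:
  fixes f :: "'a \<Rightarrow> real"
  assumes [measurable]: "f \<in> borel_measurable M" and f2: "integrable M (\<lambda>w. (f w)\<^sup>2)"
  shows "(expectation f)\<^sup>2 \<le> expectation (\<lambda>w. (f w)\<^sup>2)"
  using variance_eq[OF square_integrable_imp_integrable[OF assms] f2] variance_positive[of f] by simp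

text \<open>A finite sample, because independence of the increments is stated for finite families.
  Indices start at 0, whereas the observations are numbered from 1.\<close>

locale iid = prob_space +
  fixes Z :: "nat \<Rightarrow> 'a \<Rightarrow> real" and \<mu> :: "real measure" and N :: nat
  assumes Z_indep: "indep_vars (\<lambda>_. borel) Z {..<N}"
    and Z_distr: "\<And>k. k < N \<Longrightarrow> distr M borel (Z k) = \<mu>"
begin

lemma Z_measurable: "k < N \<Longrightarrow> Z k \<in> borel_measurable M"
  using Z_indep by (auto simp: indep_vars_def)

lemma Z_integrable:
  fixes f :: "real \<Rightarrow> 'b::{banach, second_countable_topology}"
  assumes "k < N" "f \<in> borel_measurable borel"
  shows "integrable M (\<lambda>w. f (Z k w)) \<longleftrightarrow> integrable \<mu> f"
  using integrable_distr_eq[OF Z_measurable[OF assms(1)] assms(2)] Z_distr[OF assms(1)] by simp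

lemma Z_integral:
  fixes f :: "real \<Rightarrow> 'b::{banach, second_countable_topology}"
  assumes "k < N" "f \<in> borel_measurable borel"
  shows "expectation (\<lambda>w. f (Z k w)) = (\<integral>z. f z \<partial>\<mu>)"
  using integral_distr[OF Z_measurable[OF assms(1)] assms(2)] Z_distr[OF assms(1)] by simp

lemma iid_square:
  assumes [measurable]: "f \<in> borel_measurable borel" and f2: "integrable \<mu> (\<lambda>z. (f z)\<^sup>2)"
    and f0: "(\<integral>z. f z \<partial>\<mu>) = 0" and n: "n \<le> N"
  shows "integrable M (\<lambda>w. (\<Sum>k<n. f (Z k w))\<^sup>2)"
    and "expectation (\<lambda>w. (\<Sum>k<n. f (Z k w))\<^sup>2) = n * (\<integral>z. (f z)\<^sup>2 \<partial>\<mu>)"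
proof -
  have "integrable M (\<lambda>w. (\<Sum>k<n. f (Z k w))\<^sup>2) \<and>
      expectation (\<lambda>w. (\<Sum>k<n. f (Z k w))\<^sup>2) = n * (\<integral>z. (f z)\<^sup>2 \<partial>\<mu>)"
    using n
  proof (induction n)
    case 0
    then show ?case by simp
  next
    case (Suc n)
    then have nN: "n < N" by simp
    have ind: "indep_vars (\<lambda>_. borel) Z {..<Suc n}"
      by (rule indep_vars_subset[OF Z_indep]) (use Suc.prems in auto)
    have [measurable]: "Z k \<in> borel_measurable M" if "k < Suc n" for k
      using Z_measurable that Suc.prems by auto
    define S where "S w = (\<Sum>k<n. f (Z k w))" for w
    have S_meas[measurable]: "S \<in> borel_measurable M" unfolding S_def by measurable
    have S2: "integrable M (\<lambda>w. (S w)\<^sup>2)" "expectation (\<lambda>w. (S w)\<^sup>2) = n * (\<integral>z. (f z)\<^sup>2 \<partial>\<mu>)"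
      using Suc by (auto simp: S_def)
    have S1: "integrable M S" by (rule square_integrable_imp_integrable[OF S_meas S2(1)])
    have x2: "integrable M (\<lambda>w. (f (Z n w))\<^sup>2)" "expectation (\<lambda>w. (f (Z n w))\<^sup>2) = (\<integral>z. (f z)\<^sup>2 \<partial>\<mu>)"
      using Z_integrable[OF nN, of "\<lambda>z. (f z)\<^sup>2"] Z_integral[OF nN, of "\<lambda>z. (f z)\<^sup>2"] f2 by auto
    have x1: "integrable M (\<lambda>w. f (Z n w))"
      by (rule square_integrable_imp_integrable[OF _ x2(1)]) measurable
    have "expectation (\<lambda>w. f (Z n w)) = 0" using Z_integral[OF nN, of f] f0 by simp
    moreover have "(\<lambda>(s, t :: real). s :: real) \<in> borel_measurable (borel \<Otimes>\<^sub>M borel)" by measurable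
    note ip = indep_past_expectation[OF ind assms(1) assms(1) assms(1) this, folded S_def, OF S1 x1]
    ultimately have Sx: "integrable M (\<lambda>w. S w * f (Z n w))" "expectation (\<lambda>w. S w * f (Z n w)) = 0"
      using ip by simp_all
    have eq: "(\<lambda>w. (\<Sum>k<Suc n. f (Z k w))\<^sup>2) = (\<lambda>w. (S w)\<^sup>2 + 2 * (S w * f (Z n w)) + (f (Z n w))\<^sup>2)"
      by (auto simp: fun_eq_iff S_def power2_eq_square algebra_simps)
    show ?case unfolding eq using S2 x2 Sx by (simp add: distrib_right)
  qed
  then show "integrable M (\<lambda>w. (\<Sum>k<n. f (Z k w))\<^sup>2)"
    "expectation (\<lambda>w. (\<Sum>k<n. f (Z k w))\<^sup>2) = n * (\<integral>z. (f z)\<^sup>2 \<partial>\<mu>)" by auto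
qed

text \<open>The bound c on g takes the place of a fourth moment of f. In the induction a pair (x, y)
  is added to the sums (S, T): products with a lone centred factor vanish in mean, and what survives
  adds at most \<open>(6 n + 1) c^2 s\<close>.\<close>

lemma iid_mixed:
  assumes f[measurable]: "f \<in> borel_measurable borel" and f2: "integrable \<mu> (\<lambda>z. (f z)\<^sup>2)"
    and f0: "(\<integral>z. f z \<partial>\<mu>) = 0" and g[measurable]: "g \<in> borel_measurable borel"
    and gc: "\<And>z. \<bar>g z\<bar> \<le> c" and g0: "(\<integral>z. g z \<partial>\<mu>) = 0" and n: "n \<le> N"
  shows "integrable M (\<lambda>w. (\<Sum>k<n. f (Z k w))\<^sup>2 * (\<Sum>k<n. g (Z k w))\<^sup>2)"
    and "expectation (\<lambda>w. (\<Sum>k<n. f (Z k w))\<^sup>2 * (\<Sum>k<n. g (Z k w))\<^sup>2) \<le> 3 * (real n)\<^sup>2 * c\<^sup>2 * (\<integral>z. (f z)\<^sup>2 \<partial>\<mu>)"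
proof -
  define s where "s = (\<integral>z. (f z)\<^sup>2 \<partial>\<mu>)"
  have c0: "0 \<le> c" using order.trans[OF abs_ge_zero gc] .
  have s0: "0 \<le> s" by (simp add: s_def)
  have "integrable M (\<lambda>w. (\<Sum>k<n. f (Z k w))\<^sup>2 * (\<Sum>k<n. g (Z k w))\<^sup>2) \<and>
      expectation (\<lambda>w. (\<Sum>k<n. f (Z k w))\<^sup>2 * (\<Sum>k<n. g (Z k w))\<^sup>2) \<le> 3 * (real n)\<^sup>2 * c\<^sup>2 * s"
    using n
  proof (induction n)
    case 0
    then show ?case by simp
  next
    case (Suc n)
    then have nN: "n < N" and nN': "n \<le> N" by simp_all
    have ind: "indep_vars (\<lambda>_. borel) Z {..<Suc n}"
      by (rule indep_vars_subset[OF Z_indep]) (use Suc.prems in auto)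
    have Zm[measurable]: "Z k \<in> borel_measurable M" if "k < Suc n" for k
      using Z_measurable that Suc.prems by auto
    have \<mu>: "prob_space \<mu>" "sets \<mu> = sets borel"
      using prob_space_distr[OF Zm[of n]] Z_distr[OF nN] by auto
    interpret \<mu>: prob_space \<mu> by fact
    have [measurable_cong]: "sets \<mu> = sets borel" by fact
    define S where "S w = (\<Sum>k<n. f (Z k w))" for w
    define T where "T w = (\<Sum>k<n. g (Z k w))" for w
    define x where "x w = f (Z n w)" for w
    define y where "y w = g (Z n w)" for w
    have S_meas[measurable]: "S \<in> borel_measurable M" and T_meas[measurable]: "T \<in> borel_measurable M"
      and x_meas[measurable]: "x \<in> borel_measurable M" and y_meas[measurable]: "y \<in> borel_measurable M"
      unfolding S_def T_def x_def y_def by measurable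
    have yc: "\<bar>y w\<bar> \<le> c" for w using gc by (simp add: y_def)
    have Tc: "\<bar>T w\<bar> \<le> n * c" for w
      using sum_norm_bound[of "{..<n}" "\<lambda>k. g (Z k w)" c] gc by (simp add: T_def)
    have bmult: "integrable M (\<lambda>w. a w * b w)"
      if "integrable M a" "b \<in> borel_measurable M" "\<And>w. \<bar>b w\<bar> \<le> d" for a b :: "'a \<Rightarrow> real" and d
    proof (rule Bochner_Integration.integrable_bound[of M "\<lambda>w. a w * d"])
      have "0 \<le> d" using order.trans[OF abs_ge_zero that(3)] .
      then show "AE w in M. norm (a w * b w) \<le> norm (a w * d)"
        using that(3) by (simp add: abs_mult mult_left_mono)
    qed (use that in auto)
    have y2c: "\<bar>(y w)\<^sup>2\<bar> \<le> c\<^sup>2" for w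
      using power_mono[OF yc abs_ge_zero, where n=2] by simp
    have T2c: "\<bar>(T w)\<^sup>2\<bar> \<le> (n * c)\<^sup>2" for w
      using power_mono[OF Tc abs_ge_zero, where n=2] by simp
    have g2: "integrable \<mu> (\<lambda>z. (g z)\<^sup>2)"
      by (rule \<mu>.integrable_const_bound[of _ "c\<^sup>2"])
         (use power_mono[OF gc abs_ge_zero, where n=2] in auto)
    have fg: "integrable \<mu> (\<lambda>z. f z * g z)"
      using \<mu>.square_integrable_imp_integrable[OF _ f2]
      by (intro Bochner_Integration.integrable_bound[of \<mu> "\<lambda>z. f z * c" "\<lambda>z. f z * g z"])
         (auto simp: abs_mult c0 intro!: mult_left_mono gc)
    have S2: "integrable M (\<lambda>w. (S w)\<^sup>2)" "expectation (\<lambda>w. (S w)\<^sup>2) = n * s"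
      using iid_square[OF f f2 f0 nN'] by (auto simp: S_def s_def)
    have T2: "integrable M (\<lambda>w. (T w)\<^sup>2)" "expectation (\<lambda>w. (T w)\<^sup>2) = n * (\<integral>z. (g z)\<^sup>2 \<partial>\<mu>)"
      using iid_square[OF g g2 g0 nN'] by (auto simp: T_def)
    have S1: "integrable M S" by (rule square_integrable_imp_integrable[OF S_meas S2(1)])
    have T1: "integrable M T" by (rule square_integrable_imp_integrable[OF T_meas T2(1)])
    have g2c: "(\<integral>z. (g z)\<^sup>2 \<partial>\<mu>) \<le> c\<^sup>2"
      using g2 by (rule \<mu>.integral_le_const) (use power_mono[OF gc abs_ge_zero, where n=2] in auto)
    have x2: "integrable M (\<lambda>w. (x w)\<^sup>2)" "expectation (\<lambda>w. (x w)\<^sup>2) = s"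
      using Z_integrable[OF nN, of "\<lambda>z. (f z)\<^sup>2"] Z_integral[OF nN, of "\<lambda>z. (f z)\<^sup>2"] f2 by (auto simp: x_def s_def)
    have x1: "integrable M x" "expectation x = 0"
      using square_integrable_imp_integrable[OF x_meas x2(1)] Z_integral[OF nN, of f] f0 by (auto simp: x_def[abs_def])
    have y2: "integrable M (\<lambda>w. (y w)\<^sup>2)" "expectation (\<lambda>w. (y w)\<^sup>2) = (\<integral>z. (g z)\<^sup>2 \<partial>\<mu>)"
      using Z_integrable[OF nN, of "\<lambda>z. (g z)\<^sup>2"] Z_integral[OF nN, of "\<lambda>z. (g z)\<^sup>2"] g2 by (auto simp: y_def)
    have y1: "integrable M y" "expectation y = 0"
      using square_integrable_imp_integrable[OF y_meas y2(1)] Z_integral[OF nN, of g] g0 by (auto simp: y_def[abs_def])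
    have xy: "integrable M (\<lambda>w. x w * y w)" "expectation (\<lambda>w. x w * y w) = (\<integral>z. f z * g z \<partial>\<mu>)"
      using bmult[OF x1(1) y_meas yc] Z_integral[OF nN, of "\<lambda>z. f z * g z"] by (auto simp: x_def y_def)
    have x2y2: "integrable M (\<lambda>w. (x w)\<^sup>2 * (y w)\<^sup>2)" by (rule bmult[OF x2(1) _ y2c]) measurable
    have xy2: "integrable M (\<lambda>w. x w * (y w)\<^sup>2)" by (rule bmult[OF x1(1) _ y2c]) measurable
    have x2y: "integrable M (\<lambda>w. (x w)\<^sup>2 * y w)" by (rule bmult[OF x2(1) _ yc]) measurable
    have S2T2: "integrable M (\<lambda>w. (S w)\<^sup>2 * (T w)\<^sup>2)" by (rule bmult[OF S2(1) _ T2c]) measurable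
    have S2T: "integrable M (\<lambda>w. (S w)\<^sup>2 * T w)" by (rule bmult[OF S2(1) _ Tc]) measurable
    have ST2: "integrable M (\<lambda>w. S w * (T w)\<^sup>2)" by (rule bmult[OF S1 _ T2c]) measurable
    have ST: "integrable M (\<lambda>w. S w * T w)" by (rule bmult[OF S1 _ Tc]) measurable
    \<comment> \<open>Polarisation: \<open>iid_square\<close> for \<open>f + g\<close>, compared
      with its instances for f and for g, leaves the cross term.\<close>
    have EST: "expectation (\<lambda>w. S w * T w) = n * (\<integral>z. f z * g z \<partial>\<mu>)"
    proof -
      have fi: "integrable \<mu> f" "integrable \<mu> g"
        using \<mu>.square_integrable_imp_integrable[OF _ f2] \<mu>.square_integrable_imp_integrable[OF _ g2] by auto
      have fg2: "integrable \<mu> (\<lambda>z. (f z + g z)\<^sup>2)"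
        using f2 g2 fg by (simp add: power2_sum mult.assoc)
      have "expectation (\<lambda>w. (\<Sum>k<n. f (Z k w) + g (Z k w))\<^sup>2) = n * (\<integral>z. (f z + g z)\<^sup>2 \<partial>\<mu>)"
        by (rule iid_square(2)[OF _ fg2 _ nN']) (use fi f0 g0 in auto)
      moreover have "(\<lambda>w. (\<Sum>k<n. f (Z k w) + g (Z k w))\<^sup>2) = (\<lambda>w. (S w)\<^sup>2 + (T w)\<^sup>2 + 2 * (S w * T w))"
        by (simp add: S_def T_def sum.distrib power2_sum mult.assoc)
      ultimately have "expectation (\<lambda>w. (S w)\<^sup>2 + (T w)\<^sup>2 + 2 * (S w * T w)) =
          n * (\<integral>z. (f z)\<^sup>2 + (g z)\<^sup>2 + 2 * (f z * g z) \<partial>\<mu>)"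
        by (simp add: power2_sum mult.assoc)
      then show ?thesis using S2 T2 ST f2 g2 fg by (simp add: s_def distrib_left)
    qed
    have um: "(\<lambda>(a, b). a\<^sup>2 * b :: real) \<in> borel_measurable (borel \<Otimes>\<^sub>M borel)"
      "(\<lambda>(a, b). a\<^sup>2 :: real) \<in> borel_measurable (borel \<Otimes>\<^sub>M borel)"
      "(\<lambda>(a, b). a * b\<^sup>2 :: real) \<in> borel_measurable (borel \<Otimes>\<^sub>M borel)"
      "(\<lambda>(a, b). a * b :: real) \<in> borel_measurable (borel \<Otimes>\<^sub>M borel)"
      "(\<lambda>(a, b). a :: real) \<in> borel_measurable (borel \<Otimes>\<^sub>M borel)"
      "(\<lambda>(a, b). b\<^sup>2 :: real) \<in> borel_measurable (borel \<Otimes>\<^sub>M borel)"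
      "(\<lambda>(a, b). b :: real) \<in> borel_measurable (borel \<Otimes>\<^sub>M borel)"
      by measurable
    have vm: "(\<lambda>z. (g z)\<^sup>2) \<in> borel_measurable borel" "(\<lambda>z. f z * g z) \<in> borel_measurable borel"
      "(\<lambda>z. f z * (g z)\<^sup>2) \<in> borel_measurable borel" "(\<lambda>z. (f z)\<^sup>2) \<in> borel_measurable borel"
      "(\<lambda>z. (f z)\<^sup>2 * g z) \<in> borel_measurable borel"
      by measurable
    have xe: "x = (\<lambda>w. f (Z n w))" and ye: "y = (\<lambda>w. g (Z n w))"
      by (simp_all add: x_def[abs_def] y_def[abs_def])
    note ip = indep_past_expectation[OF ind f g, folded S_def T_def]
    have p1: "integrable M (\<lambda>w. (S w)\<^sup>2 * T w * y w)" "expectation (\<lambda>w. (S w)\<^sup>2 * T w * y w) = 0"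
      using ip[OF g um(1) S2T y1(1)[unfolded ye]] y1(2) unfolding ye by simp_all
    have p2: "integrable M (\<lambda>w. (S w)\<^sup>2 * (y w)\<^sup>2)" "expectation (\<lambda>w. (S w)\<^sup>2 * (y w)\<^sup>2) = n * s * (\<integral>z. (g z)\<^sup>2 \<partial>\<mu>)"
      using ip[OF vm(1) um(2) S2(1) y2(1)[unfolded ye]] S2(2) y2(2) unfolding ye by simp_all
    have p3: "integrable M (\<lambda>w. S w * (T w)\<^sup>2 * x w)" "expectation (\<lambda>w. S w * (T w)\<^sup>2 * x w) = 0"
      using ip[OF f um(3) ST2 x1(1)[unfolded xe]] x1(2) unfolding xe by simp_all
    have p4: "integrable M (\<lambda>w. S w * T w * (x w * y w))"
      "expectation (\<lambda>w. S w * T w * (x w * y w)) = n * (\<integral>z. f z * g z \<partial>\<mu>) * (\<integral>z. f z * g z \<partial>\<mu>)"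
      using ip[OF vm(2) um(4) ST xy(1)[unfolded xe ye]] EST xy(2) unfolding xe ye by simp_all
    have S0: "expectation S = 0" and T0: "expectation T = 0"
    proof -
      have "expectation S = (\<Sum>k<n. expectation (\<lambda>w. f (Z k w)))"
        unfolding S_def
        using \<mu>.square_integrable_imp_integrable[OF _ f2] Z_integrable[OF _ f] nN
        by (intro Bochner_Integration.integral_sum) auto
      then show "expectation S = 0" using Z_integral[OF _ f] f0 nN by simp
      have "expectation T = (\<Sum>k<n. expectation (\<lambda>w. g (Z k w)))"
        unfolding T_def
        using \<mu>.square_integrable_imp_integrable[OF _ g2] Z_integrable[OF _ g] nN
        by (intro Bochner_Integration.integral_sum) auto
      then show "expectation T = 0" using Z_integral[OF _ g] g0 nN by simp
    qed
    have p5: "integrable M (\<lambda>w. S w * (x w * (y w)\<^sup>2))" "expectation (\<lambda>w. S w * (x w * (y w)\<^sup>2)) = 0"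
      using ip[OF vm(3) um(5) S1 xy2[unfolded xe ye]] S0 unfolding xe ye by simp_all
    have p6: "integrable M (\<lambda>w. (T w)\<^sup>2 * (x w)\<^sup>2)" "expectation (\<lambda>w. (T w)\<^sup>2 * (x w)\<^sup>2) = n * (\<integral>z. (g z)\<^sup>2 \<partial>\<mu>) * s"
      using ip[OF vm(4) um(6) T2(1) x2(1)[unfolded xe]] T2(2) x2(2) unfolding xe by simp_all
    have p7: "integrable M (\<lambda>w. T w * ((x w)\<^sup>2 * y w))" "expectation (\<lambda>w. T w * ((x w)\<^sup>2 * y w)) = 0"
      using ip[OF vm(5) um(7) T1 x2y[unfolded xe ye]] T0 unfolding xe ye by simp_all
    have eq: "(\<lambda>w. (\<Sum>k<Suc n. f (Z k w))\<^sup>2 * (\<Sum>k<Suc n. g (Z k w))\<^sup>2) =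
      (\<lambda>w. (S w)\<^sup>2 * (T w)\<^sup>2 + 2 * ((S w)\<^sup>2 * T w * y w) + (S w)\<^sup>2 * (y w)\<^sup>2 + 2 * (S w * (T w)\<^sup>2 * x w)
        + 4 * (S w * T w * (x w * y w)) + 2 * (S w * (x w * (y w)\<^sup>2)) + (T w)\<^sup>2 * (x w)\<^sup>2
        + 2 * (T w * ((x w)\<^sup>2 * y w)) + (x w)\<^sup>2 * (y w)\<^sup>2)"
      by (simp add: fun_eq_iff S_def[symmetric] T_def[symmetric] x_def[symmetric] y_def[symmetric])
         (simp add: power2_eq_square algebra_simps)
    have int: "integrable M (\<lambda>w. (\<Sum>k<Suc n. f (Z k w))\<^sup>2 * (\<Sum>k<Suc n. g (Z k w))\<^sup>2)"
      unfolding eq using S2T2 p1(1) p2(1) p3(1) p4(1) p5(1) p6(1) p7(1) x2y2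
      by (intro Bochner_Integration.integrable_add integrable_mult_right)
    have "expectation (\<lambda>w. (\<Sum>k<Suc n. f (Z k w))\<^sup>2 * (\<Sum>k<Suc n. g (Z k w))\<^sup>2) =
        expectation (\<lambda>w. (S w)\<^sup>2 * (T w)\<^sup>2) + n * s * (\<integral>z. (g z)\<^sup>2 \<partial>\<mu>)
        + 4 * (n * (\<integral>z. f z * g z \<partial>\<mu>)\<^sup>2) + n * (\<integral>z. (g z)\<^sup>2 \<partial>\<mu>) * s + expectation (\<lambda>w. (x w)\<^sup>2 * (y w)\<^sup>2)"
      unfolding eq using S2T2 p1(1) p2(1) p3(1) p4(1) p5(1) p6(1) p7(1) x2y2
      by (simp only: Bochner_Integration.integral_add Bochner_Integration.integrable_add integrable_mult_right
          integral_mult_right_zero p1(2) p2(2) p3(2) p4(2) p5(2) p6(2) p7(2))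
         (simp add: power2_eq_square)
    also have "\<dots> \<le> 3 * (real n)\<^sup>2 * c\<^sup>2 * s + n * s * c\<^sup>2 + 4 * (n * (c\<^sup>2 * s)) + n * c\<^sup>2 * s + c\<^sup>2 * s"
    proof (intro add_mono mult_left_mono mult_right_mono)
      show "expectation (\<lambda>w. (S w)\<^sup>2 * (T w)\<^sup>2) \<le> 3 * (real n)\<^sup>2 * c\<^sup>2 * s"
        using Suc by (simp add: S_def T_def)
      have le: "(f z * g z)\<^sup>2 \<le> c\<^sup>2 * (f z)\<^sup>2" for z
        using mult_right_mono[OF power_mono[OF gc[of z] abs_ge_zero, where n=2] zero_le_power2[of "f z"]]
        by (simp add: power_mult_distrib mult.commute)
      have i2: "integrable \<mu> (\<lambda>z. (f z * g z)\<^sup>2)"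
        by (rule Bochner_Integration.integrable_bound[of \<mu> "\<lambda>z. c\<^sup>2 * (f z)\<^sup>2"]) (use f2 le in auto)
      have le2: "(\<integral>z. (f z * g z)\<^sup>2 \<partial>\<mu>) \<le> c\<^sup>2 * s"
        using integral_mono[OF i2 integrable_mult_right[OF f2, of "c\<^sup>2"] le] by (simp add: s_def)
      then show "(\<integral>z. f z * g z \<partial>\<mu>)\<^sup>2 \<le> c\<^sup>2 * s"
        using \<mu>.expectation_square_le[OF _ i2] by simp
      have "expectation (\<lambda>w. (x w)\<^sup>2 * (y w)\<^sup>2) = (\<integral>z. (f z * g z)\<^sup>2 \<partial>\<mu>)"
        using Z_integral[OF nN, of "\<lambda>z. (f z * g z)\<^sup>2"] by (simp add: x_def y_def power_mult_distrib)
      with le2 show "expectation (\<lambda>w. (x w)\<^sup>2 * (y w)\<^sup>2) \<le> c\<^sup>2 * s" by simp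
    qed (use g2c s0 in auto)
    also have "\<dots> = (3 * (real n)\<^sup>2 + 6 * n + 1) * (c\<^sup>2 * s)" by (simp add: algebra_simps)
    \<comment> \<open>The constant 3 is made for this step:
      \<open>3 (n + 1)^2 = 3 n^2 + 6 n + 3\<close> absorbs the increment
      \<open>6 n + 1\<close>.\<close>
    also have "\<dots> \<le> (3 * (real (Suc n))\<^sup>2) * (c\<^sup>2 * s)"
    proof (rule mult_right_mono)
      show "3 * (real n)\<^sup>2 + 6 * n + 1 \<le> 3 * (real (Suc n))\<^sup>2"
        by (simp add: power2_eq_square algebra_simps)
    qed (use s0 in simp)
    finally show ?case using int by (simp add: ac_simps)
  qed
  then show "integrable M (\<lambda>w. (\<Sum>k<n. f (Z k w))\<^sup>2 * (\<Sum>k<n. g (Z k w))\<^sup>2)"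
    "expectation (\<lambda>w. (\<Sum>k<n. f (Z k w))\<^sup>2 * (\<Sum>k<n. g (Z k w))\<^sup>2) \<le> 3 * (real n)\<^sup>2 * c\<^sup>2 * (\<integral>z. (f z)\<^sup>2 \<partial>\<mu>)"
    by (auto simp: s_def)
qed

end

section \<open>Moments of an infinitely divisible law\<close>

lemma cmod_iexp_minus_1_le: "cmod (iexp t - 1) \<le> \<bar>t\<bar>"
  using iexp_approx1[of t 0] by simp

lemma iexp_taylor_3:
  "(\<Sum>k\<le>3. (\<i> * complex_of_real t) ^ k / fact k) =
     1 + \<i> * of_real t - (of_real t)\<^sup>2 / 2 - \<i> * of_real t ^ 3 / 6"
  by (simp add: numeral_3_eq_3 atMost_Suc power_mult_distrib fact_numeral)
     (simp add: eval_nat_numeral algebra_simps)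

lemma iexp_approx_3:
  "cmod (iexp t - (1 + \<i> * of_real t - (of_real t)\<^sup>2 / 2 - \<i> * of_real t ^ 3 / 6)) \<le> t ^ 4 / 24"
proof -
  have "\<bar>t\<bar> ^ Suc 3 / fact (Suc 3) = t ^ 4 / 24"
    by (simp add: fact_numeral power_even_abs eval_nat_numeral)
  then show ?thesis using iexp_approx1[of t 3] unfolding iexp_taylor_3 by (simp only:)
qed

text \<open>The derivative of exp at 0 along a sequence, with a coefficient B that itself only
  converges. It acts as a chain rule for exp of the Levy exponent, whose difference quotients play
  the role of B.\<close>

lemma tendsto_exp_quotient:
  fixes B :: "nat \<Rightarrow> complex" and h :: "nat \<Rightarrow> real"
  assumes B: "B \<longlonglongrightarrow> b" and h: "h \<longlonglongrightarrow> 0" and h0: "\<And>n. h n \<noteq> 0"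
  shows "(\<lambda>n. (exp (h n * B n) - 1) / h n) \<longlonglongrightarrow> b"
proof -
  have "(\<lambda>n. (exp (h n * B n) - 1) / h n - B n) \<longlonglongrightarrow> 0"
  proof (rule Lim_null_comparison)
    show "\<forall>\<^sub>F n in sequentially. norm ((exp (h n * B n) - 1) / h n - B n) \<le>
        exp (\<bar>h n\<bar> * cmod (B n)) * (\<bar>h n\<bar> * (cmod (B n))\<^sup>2)"
    proof (intro always_eventually allI)
      fix n
      have "(exp (h n * B n) - 1) / h n - B n = (exp (h n * B n) - (\<Sum>i\<le>1. (h n * B n) ^ i / fact i)) / h n"
        using h0[of n] by (simp add: field_simps)
      then have "norm ((exp (h n * B n) - 1) / h n - B n) \<le>
          exp (norm (h n * B n)) * (norm (h n * B n))\<^sup>2 / \<bar>h n\<bar>"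
        using Taylor_exp_field[of "h n * B n" 1] h0[of n]
        by (simp add: norm_divide divide_right_mono numeral_2_eq_2)
      also have "\<dots> = exp (\<bar>h n\<bar> * cmod (B n)) * (\<bar>h n\<bar> * (cmod (B n))\<^sup>2)"
        using h0[of n] by (simp add: norm_mult power_mult_distrib power2_eq_square)
      finally show "norm ((exp (h n * B n) - 1) / h n - B n) \<le> exp (\<bar>h n\<bar> * cmod (B n)) * (\<bar>h n\<bar> * (cmod (B n))\<^sup>2)" .
    qed
    have "(\<lambda>n. exp (\<bar>h n\<bar> * cmod (B n)) * (\<bar>h n\<bar> * (cmod (B n))\<^sup>2)) \<longlonglongrightarrow>
        exp (\<bar>0\<bar> * cmod b) * (\<bar>0\<bar> * (cmod b)\<^sup>2)"
      by (intro tendsto_intros B h)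
    then show "(\<lambda>n. exp (\<bar>h n\<bar> * cmod (B n)) * (\<bar>h n\<bar> * (cmod (B n))\<^sup>2)) \<longlonglongrightarrow> 0" by simp
  qed
  from tendsto_add[OF this B] show ?thesis by simp
qed

text \<open>Differentiation under the integral: \<open>cmod_iexp_minus_1_le\<close> supplies the
  majorant \<open>|x k(x)|\<close>. Measure and weight are left free, for use with the law of Z and
  \<open>k = 1\<close> as well as with Lebesgue measure and the Levy density.\<close>

lemma iexp_integral_quotient:
  fixes k :: "real \<Rightarrow> complex" and h :: "nat \<Rightarrow> real"
  assumes M[measurable_cong]: "sets M = sets borel" and [measurable]: "k \<in> borel_measurable borel"
    and int: "integrable M (\<lambda>x. x * k x)"
    and h: "h \<longlonglongrightarrow> 0" and h0: "\<And>n. h n \<noteq> 0"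
  shows "(\<lambda>n. CLINT x|M. (iexp ((u + h n) * x) - iexp (u * x)) / h n * k x) \<longlonglongrightarrow>
    (CLINT x|M. \<i> * (iexp (u * x) * (x * k x)))"
proof (rule integral_dominated_convergence)
  have eq: "iexp ((u + d) * x) - iexp (u * x) = iexp (u * x) * (iexp (d * x) - 1)" for d x :: real
    by (simp add: algebra_simps exp_add)
  show "integrable M (\<lambda>x. cmod (x * k x))" using int by simp
  show "AE x in M. norm ((iexp ((u + h n) * x) - iexp (u * x)) / h n * k x) \<le> cmod (x * k x)" for n
  proof (rule AE_I2)
    fix x
    have "norm ((iexp ((u + h n) * x) - iexp (u * x)) / h n * k x) = cmod (iexp (h n * x) - 1) / \<bar>h n\<bar> * cmod (k x)"
      unfolding eq by (simp add: norm_mult norm_divide)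
    also have "\<dots> \<le> \<bar>h n * x\<bar> / \<bar>h n\<bar> * cmod (k x)"
      by (intro mult_right_mono divide_right_mono cmod_iexp_minus_1_le) auto
    also have "\<dots> = cmod (x * k x)" using h0[of n] by (simp add: norm_mult abs_mult)
    finally show "norm ((iexp ((u + h n) * x) - iexp (u * x)) / h n * k x) \<le> cmod (x * k x)" .
  qed
  show "AE x in M. (\<lambda>n. (iexp ((u + h n) * x) - iexp (u * x)) / h n * k x) \<longlonglongrightarrow> \<i> * (iexp (u * x) * (x * k x))"
  proof (rule AE_I2)
    fix x
    have "(\<lambda>n. iexp (u * x) * ((exp (h n * (\<i> * x)) - 1) / h n) * k x) \<longlonglongrightarrow> iexp (u * x) * (\<i> * x) * k x"
      by (intro tendsto_intros tendsto_exp_quotient h h0)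
    then show "(\<lambda>n. (iexp ((u + h n) * x) - iexp (u * x)) / h n * k x) \<longlonglongrightarrow> \<i> * (iexp (u * x) * (x * k x))"
      unfolding eq by (simp add: ac_simps)
  qed
qed measurable

lemma integrable_iexp_minus_1:
  fixes l :: "real \<Rightarrow> real"
  assumes [measurable]: "l \<in> borel_measurable borel" and l: "\<And>x. 0 \<le> l x" and l1: "integrable lborel (\<lambda>x. \<bar>x\<bar> * l x)"
  shows "integrable lborel (\<lambda>x. (iexp (u * x) - 1) * complex_of_real (l x))"
proof (rule Bochner_Integration.integrable_bound[of _ "\<lambda>x. \<bar>u\<bar> * (\<bar>x\<bar> * l x)"])
  show "AE x in lborel. norm ((iexp (u * x) - 1) * complex_of_real (l x)) \<le> norm (\<bar>u\<bar> * (\<bar>x\<bar> * l x))"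
  proof (rule AE_I2)
    fix x
    have "norm ((iexp (u * x) - 1) * complex_of_real (l x)) \<le> \<bar>u * x\<bar> * l x"
      unfolding norm_mult using l[of x] by (intro mult_mono cmod_iexp_minus_1_le) auto
    then show "norm ((iexp (u * x) - 1) * complex_of_real (l x)) \<le> norm (\<bar>u\<bar> * (\<bar>x\<bar> * l x))"
      using l[of x] by (simp add: abs_mult mult.assoc)
  qed
qed (use l1 in auto)

text \<open>Differentiating \<open>exp (\<Delta> \<integral> (exp(iux) - 1) l(x) dx)\<close> at \<open>u\<close>.\<close>

lemma char_first_moment:
  fixes l :: "real \<Rightarrow> real"
  assumes \<mu>: "real_distribution \<mu>" and m1: "integrable \<mu> (\<lambda>z. z)"
    and lm[measurable]: "l \<in> borel_measurable borel" and l: "\<And>x. 0 \<le> l x" and l1: "integrable lborel (\<lambda>x. \<bar>x\<bar> * l x)"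
    and char: "\<And>u. char \<mu> u = exp (of_real \<Delta> * (CLINT x|lborel. (iexp (u * x) - 1) * of_real (l x)))"
  shows "(CLINT z|\<mu>. of_real z * iexp (u * z)) = \<Delta> * char \<mu> u * ft (\<lambda>x. of_real (x * l x)) u"
proof -
  interpret real_distribution \<mu> by fact
  define h where "h n = 1 / real (Suc n)" for n
  have h: "h \<longlonglongrightarrow> 0" unfolding h_def by (rule LIMSEQ_Suc[OF lim_1_over_n])
  have h0: "h n \<noteq> 0" for n by (simp add: h_def)
  define w where "w u = (CLINT x|lborel. (iexp (u * x) - 1) * complex_of_real (l x))" for u
  have gl: "integrable lborel (\<lambda>x. complex_of_real x * complex_of_real (l x))"
    by (rule Bochner_Integration.integrable_bound[OF l1]) (use l in \<open>auto simp: norm_mult\<close>)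
  have int: "integrable \<mu> (\<lambda>z. iexp (v * z))" for v
    by (rule integrable_const_bound[of _ 1]) auto
  have "(\<lambda>n. CLINT z|\<mu>. (iexp ((u + h n) * z) - iexp (u * z)) / h n * 1) \<longlonglongrightarrow>
      (CLINT z|\<mu>. \<i> * (iexp (u * z) * (of_real z * 1)))"
    by (rule iexp_integral_quotient[OF _ _ _ h h0]) (use m1 in auto)
  moreover have "(CLINT z|\<mu>. (iexp ((u + h n) * z) - iexp (u * z)) / h n * 1) = (char \<mu> (u + h n) - char \<mu> u) / h n" for n
    unfolding char_def by (simp add: int del: of_real_add of_real_mult)
  moreover have "(CLINT z|\<mu>. \<i> * (iexp (u * z) * (of_real z * 1))) = \<i> * (CLINT z|\<mu>. of_real z * iexp (u * z))"
    by (simp add: mult.commute)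
  ultimately have A: "(\<lambda>n. (char \<mu> (u + h n) - char \<mu> u) / h n) \<longlonglongrightarrow> \<i> * (CLINT z|\<mu>. of_real z * iexp (u * z))"
    by (simp only:)
  have "(\<lambda>n. CLINT x|lborel. (iexp ((u + h n) * x) - iexp (u * x)) / h n * of_real (l x)) \<longlonglongrightarrow>
      (CLINT x|lborel. \<i> * (iexp (u * x) * (of_real x * of_real (l x))))"
    by (rule iexp_integral_quotient[OF _ _ gl h h0]) auto
  moreover have "(CLINT x|lborel. (iexp ((u + h n) * x) - iexp (u * x)) / h n * of_real (l x)) = (w (u + h n) - w u) / h n" for n
  proof -
    have "w (u + h n) - w u = (CLINT x|lborel. (iexp ((u + h n) * x) - 1) * of_real (l x) - (iexp (u * x) - 1) * of_real (l x))"
      unfolding w_def by (intro Bochner_Integration.integral_diff[symmetric] integrable_iexp_minus_1 lm l l1)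
    also have "\<dots> = (CLINT x|lborel. h n * ((iexp ((u + h n) * x) - iexp (u * x)) / h n * of_real (l x)))"
      using h0[of n] by (intro Bochner_Integration.integral_cong refl) (simp add: left_diff_distrib)
    finally show ?thesis using h0[of n] by (simp del: of_real_add of_real_mult)
  qed
  moreover have "(CLINT x|lborel. \<i> * (iexp (u * x) * (of_real x * of_real (l x)))) = \<i> * ft (\<lambda>x. of_real (x * l x)) u"
    by (simp add: ft_def)
  ultimately have W: "(\<lambda>n. (w (u + h n) - w u) / h n) \<longlonglongrightarrow> \<i> * ft (\<lambda>x. of_real (x * l x)) u"
    by (simp only:)
  have "(\<lambda>n. char \<mu> u * ((exp (h n * (\<Delta> * ((w (u + h n) - w u) / h n))) - 1) / h n)) \<longlonglongrightarrow>
      char \<mu> u * (\<Delta> * (\<i> * ft (\<lambda>x. of_real (x * l x)) u))"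
    by (intro tendsto_mult tendsto_const tendsto_exp_quotient W h h0)
  moreover have "char \<mu> u * ((exp (h n * (\<Delta> * ((w (u + h n) - w u) / h n))) - 1) / h n) = (char \<mu> (u + h n) - char \<mu> u) / h n" for n
  proof -
    have "h n * (\<Delta> * ((w (u + h n) - w u) / h n)) = \<Delta> * w (u + h n) - \<Delta> * w u"
      using h0[of n] by (simp add: field_simps)
    then show ?thesis unfolding char w_def[symmetric] by (simp add: exp_diff right_diff_distrib)
  qed
  ultimately have "(\<lambda>n. (char \<mu> (u + h n) - char \<mu> u) / h n) \<longlonglongrightarrow> char \<mu> u * (\<Delta> * (\<i> * ft (\<lambda>x. of_real (x * l x)) u))"
    by (simp only:)
  \<comment> \<open>One difference quotient of \<open>char \<mu>\<close>, with its limit computed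
    twice: under the law, and through the exponent.\<close>
  from LIMSEQ_unique[OF A this] have "\<i> * (CLINT z|\<mu>. of_real z * iexp (u * z)) = \<i> * (\<Delta> * char \<mu> u * ft (\<lambda>x. of_real (x * l x)) u)"
    by (simp add: ac_simps)
  then show ?thesis by simp
qed

subsection \<open>Fourth moments\<close>

abbreviation cubic :: "complex \<Rightarrow> complex \<Rightarrow> complex \<Rightarrow> complex \<Rightarrow> real \<Rightarrow> complex" where
  "cubic c0 c1 c2 c3 h \<equiv> c0 + c1 * of_real h + c2 * (of_real h)\<^sup>2 + c3 * of_real h ^ 3"

text \<open>An expansion with explicit remainder on a fixed interval, in place of derivatives: it
  passes through sums, products and exp by elementary estimates, and a fourth difference asks for
  nothing more.\<close>

definition cubic_at_0 :: "(real \<Rightarrow> complex) \<Rightarrow> bool" where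
  "cubic_at_0 f \<longleftrightarrow> (\<exists>C c0 c1 c2 c3. \<forall>h. \<bar>h\<bar> \<le> 1 \<longrightarrow>
     cmod (f h - cubic c0 c1 c2 c3 h) \<le> C * h ^ 4)"

lemma cubic_at_0I:
  assumes "\<And>h. \<bar>h\<bar> \<le> 1 \<Longrightarrow> cmod (f h - cubic c0 c1 c2 c3 h) \<le> C * h ^ 4"
  shows "cubic_at_0 f"
  using assms unfolding cubic_at_0_def by blast

lemma cubic_at_0E:
  assumes "cubic_at_0 f"
  obtains C c0 c1 c2 c3 where "C \<ge> 0"
    "\<And>h. \<bar>h\<bar> \<le> 1 \<Longrightarrow> cmod (f h - cubic c0 c1 c2 c3 h) \<le> C * h ^ 4"
proof -
  obtain C c0 c1 c2 c3 where C: "\<And>h. \<bar>h\<bar> \<le> 1 \<Longrightarrow> cmod (f h - cubic c0 c1 c2 c3 h) \<le> C * h ^ 4"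
    using assms unfolding cubic_at_0_def by blast
  have "0 \<le> C" using order.trans[OF norm_ge_zero C[of 1]] by simp
  with C that show ?thesis by blast
qed

lemma cubic_at_0_const: "cubic_at_0 (\<lambda>h. c)"
  by (rule cubic_at_0I[of _ c 0 0 0 0]) simp

lemma cubic_at_0_perturb:
  assumes "cubic_at_0 f" "\<And>h. \<bar>h\<bar> \<le> 1 \<Longrightarrow> cmod (g h - f h) \<le> D * h ^ 4"
  shows "cubic_at_0 g"
proof -
  obtain C c0 c1 c2 c3 where C: "\<And>h. \<bar>h\<bar> \<le> 1 \<Longrightarrow> cmod (f h - cubic c0 c1 c2 c3 h) \<le> C * h ^ 4"
    using assms unfolding cubic_at_0_def by blast
  show ?thesis
  proof (rule cubic_at_0I)
    fix h :: real assume h: "\<bar>h\<bar> \<le> 1"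
    show "cmod (g h - cubic c0 c1 c2 c3 h) \<le> (D + C) * h ^ 4"
    proof -
      have "g h - cubic c0 c1 c2 c3 h = (g h - f h) + (f h - cubic c0 c1 c2 c3 h)" by simp
      then show ?thesis
        using norm_triangle_mono[OF assms(2)[OF h] C[OF h]] by (simp only: distrib_right)
    qed
  qed
qed

lemma cubic_at_0_add:
  assumes "cubic_at_0 f" "cubic_at_0 g"
  shows "cubic_at_0 (\<lambda>h. f h + g h)"
proof -
  obtain C c0 c1 c2 c3 where C: "\<And>h. \<bar>h\<bar> \<le> 1 \<Longrightarrow> cmod (f h - cubic c0 c1 c2 c3 h) \<le> C * h ^ 4"
    using assms(1) unfolding cubic_at_0_def by blast
  obtain D d0 d1 d2 d3 where D: "\<And>h. \<bar>h\<bar> \<le> 1 \<Longrightarrow> cmod (g h - cubic d0 d1 d2 d3 h) \<le> D * h ^ 4"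
    using assms(2) unfolding cubic_at_0_def by blast
  show ?thesis
  proof (rule cubic_at_0I)
    fix h :: real assume h: "\<bar>h\<bar> \<le> 1"
    show "cmod (f h + g h - cubic (c0 + d0) (c1 + d1) (c2 + d2) (c3 + d3) h) \<le> (C + D) * h ^ 4"
    proof -
      have "f h + g h - cubic (c0 + d0) (c1 + d1) (c2 + d2) (c3 + d3) h =
          (f h - cubic c0 c1 c2 c3 h) + (g h - cubic d0 d1 d2 d3 h)" by (simp add: algebra_simps)
      then show ?thesis
        using norm_triangle_mono[OF C[OF h] D[OF h]] by (simp only: distrib_right)
    qed
  qed
qed

text \<open>Beyond degree three, the product of the two cubics is \<open>z^4\<close> times a
  quadratic that stays bounded for \<open>|h| \<le> 1\<close>. All other error terms contain a
  remainder factor of order \<open>h^4\<close>.\<close>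

lemma cubic_at_0_mult:
  assumes "cubic_at_0 f" "cubic_at_0 g"
  shows "cubic_at_0 (\<lambda>h. f h * g h)"
proof -
  obtain C c0 c1 c2 c3 where C0: "C \<ge> 0" and C: "\<And>h. \<bar>h\<bar> \<le> 1 \<Longrightarrow> cmod (f h - cubic c0 c1 c2 c3 h) \<le> C * h ^ 4"
    using cubic_at_0E[OF assms(1)] by blast
  obtain D d0 d1 d2 d3 where D0: "D \<ge> 0" and D: "\<And>h. \<bar>h\<bar> \<le> 1 \<Longrightarrow> cmod (g h - cubic d0 d1 d2 d3 h) \<le> D * h ^ 4"
    using cubic_at_0E[OF assms(2)] by blast
  have cub: "cmod (a0 + a1 * of_real h + a2 * of_real h ^ 2 + a3 * of_real h ^ 3) \<le> cmod a0 + cmod a1 + cmod a2 + cmod a3"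
    if "\<bar>h\<bar> \<le> 1" for a0 a1 a2 a3 and h :: real
  proof -
    have "cmod (a * of_real h ^ n) \<le> cmod a" for a n
      using that by (simp add: norm_mult norm_power mult_left_le power_le_one)
    from this[of a1 1] this[of a2 2] this[of a3 3] show ?thesis
      by (intro norm_triangle_mono) auto
  qed
  let ?P = "cmod c0 + cmod c1 + cmod c2 + cmod c3" and ?Q = "cmod d0 + cmod d1 + cmod d2 + cmod d3"
  \<comment> \<open>Bounds the quadratic cofactor of \<open>z^4\<close>; its void cubic coefficient
    \<open>0\<close> lets the bound \<open>cub\<close> for cubics apply as it is.\<close>
  let ?R = "cmod (c1 * d3 + c2 * d2 + c3 * d1) + cmod (c2 * d3 + c3 * d2) + cmod (c3 * d3) + cmod 0"
  show ?thesis
  proof (rule cubic_at_0I)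
    fix h :: real assume h: "\<bar>h\<bar> \<le> 1"
    define z where "z = complex_of_real h"
    define p where "p = c0 + c1 * z + c2 * z\<^sup>2 + c3 * z ^ 3"
    define q where "q = d0 + d1 * z + d2 * z\<^sup>2 + d3 * z ^ 3"
    have h4: "0 \<le> h ^ 4" "h ^ 4 \<le> 1"
      using h power_le_one[of "\<bar>h\<bar>" 4] by (auto simp: power_even_abs)
    have zn: "cmod (z ^ 4) = h ^ 4" by (simp add: z_def norm_power power_even_abs)
    have fp: "cmod (f h - p) \<le> C * h ^ 4" and gq: "cmod (g h - q) \<le> D * h ^ 4"
      using C[OF h] D[OF h] by (simp_all add: p_def q_def z_def)
    have pP: "cmod p \<le> ?P" and qQ: "cmod q \<le> ?Q"
      unfolding p_def q_def z_def using cub[OF h] by auto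
    have "f h * g h - (c0 * d0 + (c0 * d1 + c1 * d0) * z + (c0 * d2 + c1 * d1 + c2 * d0) * z\<^sup>2
        + (c0 * d3 + c1 * d2 + c2 * d1 + c3 * d0) * z ^ 3) =
      p * (g h - q) + (f h - p) * q + (f h - p) * (g h - q) +
      z ^ 4 * ((c1 * d3 + c2 * d2 + c3 * d1) + (c2 * d3 + c3 * d2) * z + (c3 * d3) * z\<^sup>2 + 0 * z ^ 3)"
      by (simp add: p_def q_def) (simp add: algebra_simps eval_nat_numeral)
    also have "cmod \<dots> \<le> ?P * (D * h ^ 4) + (C * h ^ 4) * ?Q + (C * h ^ 4) * (D * 1) + h ^ 4 * ?R"
    proof (intro norm_triangle_mono)
      show "cmod (p * (g h - q)) \<le> ?P * (D * h ^ 4)"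
        unfolding norm_mult by (intro mult_mono pP gq) auto
      show "cmod ((f h - p) * q) \<le> (C * h ^ 4) * ?Q"
        unfolding norm_mult using C0 h4 by (intro mult_mono fp qQ) auto
      show "cmod ((f h - p) * (g h - q)) \<le> (C * h ^ 4) * (D * 1)"
        unfolding norm_mult using C0 D0 h4
        by (intro mult_mono fp order.trans[OF gq] mult_left_mono) auto
      show "cmod (z ^ 4 * ((c1 * d3 + c2 * d2 + c3 * d1) + (c2 * d3 + c3 * d2) * z + (c3 * d3) * z\<^sup>2 + 0 * z ^ 3)) \<le> h ^ 4 * ?R"
        unfolding norm_mult[of "z ^ 4"] zn unfolding z_def using h4 by (intro mult_left_mono cub[OF h]) auto
    qed
    also have "\<dots> = (?P * D + C * ?Q + C * D + ?R) * h ^ 4" by (simp add: algebra_simps)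
    finally show "cmod (f h * g h - cubic (c0 * d0) (c0 * d1 + c1 * d0) (c0 * d2 + c1 * d1 + c2 * d0)
        (c0 * d3 + c1 * d2 + c2 * d1 + c3 * d0) h) \<le> (?P * D + C * ?Q + C * D + ?R) * h ^ 4"
      by (simp add: z_def)
  qed
qed

text \<open>Since w is of order h, the remainder of exp after the cubic term is of order
  \<open>h^4\<close>; the Taylor polynomial in w is covered by closure under sums and
  products.\<close>

lemma cubic_at_0_exp:
  assumes w: "cubic_at_0 w" and lin: "\<And>h. \<bar>h\<bar> \<le> 1 \<Longrightarrow> cmod (w h) \<le> G * \<bar>h\<bar>"
  shows "cubic_at_0 (\<lambda>h. exp (w h))"
proof (rule cubic_at_0_perturb)
  have ws: "cubic_at_0 (\<lambda>h. w h ^ n * c)" for n c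
    by (induction n) (simp_all add: cubic_at_0_const cubic_at_0_mult[OF w] mult.assoc)
  show "cubic_at_0 (\<lambda>h. w h ^ 0 * 1 + w h ^ 1 * 1 + w h ^ 2 * (1 / 2) + w h ^ 3 * (1 / 6))"
    by (intro cubic_at_0_add ws)
  fix h :: real assume h: "\<bar>h\<bar> \<le> 1"
  have G0: "0 \<le> G" using order.trans[OF norm_ge_zero lin[of 1]] by simp
  have "cmod (w h) \<le> G" using order.trans[OF lin[OF h] mult_left_le[OF h G0]] .
  moreover have "cmod (w h) ^ 4 \<le> G ^ 4 * h ^ 4"
    using power_mono[OF lin[OF h] norm_ge_zero, of 4] by (simp add: power_mult_distrib power_even_abs)
  ultimately have "exp (norm (w h)) * (norm (w h) ^ Suc 3) / fact 3 \<le> exp G * (G ^ 4 * h ^ 4) / fact 3"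
    by (intro divide_right_mono mult_mono) (auto simp: numeral_eq_Suc)
  moreover have "(\<Sum>i\<le>3. w h ^ i / fact i) = w h ^ 0 * 1 + w h ^ 1 * 1 + w h ^ 2 * (1 / 2) + w h ^ 3 * (1 / 6)"
    by (simp add: numeral_3_eq_3 fact_numeral atMost_Suc eval_nat_numeral)
  ultimately show "cmod (exp (w h) - (w h ^ 0 * 1 + w h ^ 1 * 1 + w h ^ 2 * (1 / 2) + w h ^ 3 * (1 / 6))) \<le> (exp G * G ^ 4 / fact 3) * h ^ 4"
    using Taylor_exp_field[of "w h" 3] by simp
qed

text \<open>The fourth central difference annihilates cubic polynomials, and that of \<open>char \<mu>\<close> at \<open>0\<close>
  is the integral of \<open>(2 - 2 cos (h z))\<^sup>2\<close>, which dominates \<open>h\<^sup>4 z\<^sup>4 / 4\<close> on \<open>\<bar>h z\<bar> \<le> 1\<close>.\<close>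

lemma integrable_fourth_moment:
  assumes \<mu>: "real_distribution \<mu>" and cub: "cubic_at_0 (char \<mu>)"
  shows "integrable \<mu> (\<lambda>z. z ^ 4)"
proof -
  interpret real_distribution \<mu> by fact
  obtain C c0 c1 c2 c3 where C0: "C \<ge> 0" and C: "\<And>h. \<bar>h\<bar> \<le> 1 \<Longrightarrow> cmod (char \<mu> h - cubic c0 c1 c2 c3 h) \<le> C * h ^ 4"
    using cubic_at_0E[OF cub] by blast
  have c0: "c0 = 1" using C[of 0] char_zero by simp
  have int: "integrable \<mu> (\<lambda>z. iexp (v * z))" for v
    by (rule integrable_const_bound[of _ 1]) auto
  \<comment> \<open>The remainders at \<open>h\<close>, \<open>-h\<close>, \<open>2 h\<close> and
    \<open>-2 h\<close> enter with the weights of the fourth difference, which gives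
    \<open>40 = 4 + 4 + 16 + 16\<close>. The restriction on h keeps \<open>2 h\<close> in the range
    of the expansion.\<close>
  have D: "(\<integral>z. (2 - 2 * cos (h * z))\<^sup>2 \<partial>\<mu>) \<le> 40 * C * h ^ 4" if h: "\<bar>h\<bar> \<le> 1 / 2" for h
  proof -
    define r where "r t = char \<mu> t - cubic c0 c1 c2 c3 t" for t :: real
    have rb: "cmod (r t) \<le> C * t ^ 4" if "\<bar>t\<bar> \<le> 1" for t
      using C[OF that] by (simp add: r_def)
    have eq: "complex_of_real ((2 - 2 * cos (h * z))\<^sup>2) =
        6 - 4 * iexp (h * z) - 4 * iexp (- h * z) + iexp (2 * h * z) + iexp (- (2 * h) * z)" for z
    proof -
      have "cos (2 * h * z) = 2 * (cos (h * z))\<^sup>2 - 1"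
        using cos_double_cos[of "h * z"] by (simp add: mult.assoc)
      then show ?thesis
        by (simp add: complex_eq_iff Re_exp Im_exp) (simp add: power2_eq_square algebra_simps)
    qed
    have "complex_of_real (\<integral>z. (2 - 2 * cos (h * z))\<^sup>2 \<partial>\<mu>) =
        (CLINT z|\<mu>. 6 - 4 * iexp (h * z) - 4 * iexp (- h * z) + iexp (2 * h * z) + iexp (- (2 * h) * z))"
      unfolding integral_complex_of_real[symmetric] eq ..
    also have "\<dots> = 6 - 4 * char \<mu> h - 4 * char \<mu> (- h) + char \<mu> (2 * h) + char \<mu> (- (2 * h))"
      unfolding char_def using int prob_space
      by (subst Bochner_Integration.integral_add Bochner_Integration.integral_diff,
        (intro Bochner_Integration.integrable_add Bochner_Integration.integrable_diff integrable_mult_right int integrable_const)+)+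
        simp
    also have "\<dots> = - 4 * r h - 4 * r (- h) + r (2 * h) + r (- (2 * h))"
      by (simp add: r_def c0 power_mult_distrib algebra_simps)
    also have "cmod \<dots> \<le> 4 * (C * h ^ 4) + 4 * (C * h ^ 4) + C * (2 * h) ^ 4 + C * (2 * h) ^ 4"
    proof (intro norm_triangle_mono norm_triangle_le_diff add_mono)
      show "cmod (- 4 * r h) \<le> 4 * (C * h ^ 4)" "cmod (4 * r (- h)) \<le> 4 * (C * h ^ 4)"
        "cmod (r (2 * h)) \<le> C * (2 * h) ^ 4" "cmod (r (- (2 * h))) \<le> C * (2 * h) ^ 4"
        using rb[of h] rb[of "-h"] rb[of "2 * h"] rb[of "-(2 * h)"] h by (simp_all add: norm_mult)
    qed
    also have "\<dots> = 40 * C * h ^ 4" by (simp add: power_mult_distrib)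
    finally show ?thesis by (simp add: norm_of_real)
  qed
  \<comment> \<open>The choice \<open>h = 1 / n\<close> makes \<open>|h z| \<le> 1\<close> on the
    truncation interval. The powers of h cancel, so the bound \<open>160 C\<close>, with
    \<open>160 = 4 * 40\<close>, is uniform in n.\<close>
  have trunc: "(\<integral>\<^sup>+z. ennreal (z ^ 4 * indicator {-real n..real n} z) \<partial>\<mu>) \<le> ennreal (160 * C)" if n: "n \<ge> 2" for n
  proof -
    define h where "h = 1 / real n"
    have h: "0 < h" "h \<le> 1 / 2" using n by (auto simp: h_def field_simps)
    have "z ^ 4 * indicator {-real n..real n} z \<le> 4 / h ^ 4 * (2 - 2 * cos (h * z))\<^sup>2" for z
    proof (cases "z \<in> {-real n..real n}")
      case True
      define t where "t = h * z"
      have t1: "\<bar>t\<bar> \<le> 1" using True n by (auto simp: t_def h_def abs_mult field_simps)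
      have "Re (iexp t - (1 + \<i> * of_real t - (of_real t)\<^sup>2 / 2 - \<i> * of_real t ^ 3 / 6)) = cos t - (1 - t\<^sup>2 / 2)"
        by (simp add: Re_exp del: of_real_power flip: of_real_power)
      then have "\<bar>cos t - (1 - t\<^sup>2 / 2)\<bar> \<le> t ^ 4 / 24"
        using order.trans[OF abs_Re_le_cmod iexp_approx_3[of t]] by (simp only:)
      moreover have "t ^ 4 \<le> t\<^sup>2"
        using power_decreasing[of 2 4 "\<bar>t\<bar>"] t1 by (simp add: power_even_abs)
      moreover have "0 \<le> t\<^sup>2" by simp
      \<comment> \<open>The expansion gives \<open>2 - 2 cos t \<ge> t^2 - t^4 / 12\<close>, and
        \<open>t^4 \<le> t^2\<close> leaves more than half of \<open>t^2\<close>.\<close>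
      ultimately have "t\<^sup>2 / 2 \<le> 2 - 2 * cos t" unfolding abs_le_iff by linarith
      then have "(t\<^sup>2 / 2)\<^sup>2 \<le> (2 - 2 * cos t)\<^sup>2" by (intro power_mono) auto
      then have "(h * z) ^ 4 \<le> 4 * (2 - 2 * cos (h * z))\<^sup>2"
        by (simp add: t_def power2_eq_square eval_nat_numeral)
      then show ?thesis using True h by (simp add: field_simps power_mult_distrib)
    qed simp
    then have "(\<integral>\<^sup>+z. ennreal (z ^ 4 * indicator {-real n..real n} z) \<partial>\<mu>) \<le>
        (\<integral>\<^sup>+z. ennreal (4 / h ^ 4 * (2 - 2 * cos (h * z))\<^sup>2) \<partial>\<mu>)"
      by (intro nn_integral_mono ennreal_leI)
    also have "\<dots> = ennreal (\<integral>z. 4 / h ^ 4 * (2 - 2 * cos (h * z))\<^sup>2 \<partial>\<mu>)"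
    proof (rule nn_integral_eq_integral)
      have "\<bar>2 - 2 * cos (h * z)\<bar> \<le> 4" for z
        using cos_ge_minus_one[of "h * z"] cos_le_one[of "h * z"] unfolding abs_le_iff by linarith
      then have "(2 - 2 * cos (h * z))\<^sup>2 \<le> 4\<^sup>2" for z
        using power_mono[of "\<bar>2 - 2 * cos (h * z)\<bar>" 4 2] by simp
      then have "integrable \<mu> (\<lambda>z. (2 - 2 * cos (h * z))\<^sup>2)"
        by (intro integrable_const_bound[of _ "4\<^sup>2"]) auto
      then show "integrable \<mu> (\<lambda>z. 4 / h ^ 4 * (2 - 2 * cos (h * z))\<^sup>2)" by (rule integrable_mult_right)
    qed simp
    also have "\<dots> \<le> ennreal (4 / h ^ 4 * (40 * C * h ^ 4))"
      unfolding integral_mult_right_zero using h D[of h] by (intro ennreal_leI mult_left_mono) auto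
    also have "4 / h ^ 4 * (40 * C * h ^ 4) = 160 * C" using h by simp
    finally show ?thesis .
  qed
  \<comment> \<open>Fatou's lemma passes from the truncated integrals to the full fourth
    moment.\<close>
  have "(\<integral>\<^sup>+z. ennreal (z ^ 4) \<partial>\<mu>) = (\<integral>\<^sup>+z. liminf (\<lambda>n. ennreal (z ^ 4 * indicator {-real n..real n} z)) \<partial>\<mu>)"
  proof (intro nn_integral_cong)
    fix z :: real
    obtain N where "\<bar>z\<bar> \<le> real N" using real_arch_simple by blast
    then have "\<forall>\<^sub>F n in sequentially. ennreal (z ^ 4 * indicator {-real n..real n} z) = ennreal (z ^ 4)"
      unfolding eventually_sequentially by (intro exI[of _ N]) (auto simp: indicator_def)
    then have "(\<lambda>n. ennreal (z ^ 4 * indicator {-real n..real n} z)) \<longlonglongrightarrow> ennreal (z ^ 4)"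
      by (rule tendsto_eventually)
    then show "ennreal (z ^ 4) = liminf (\<lambda>n. ennreal (z ^ 4 * indicator {-real n..real n} z))"
      by (intro lim_imp_Liminf[symmetric]) auto
  qed
  also have "\<dots> \<le> liminf (\<lambda>n. \<integral>\<^sup>+z. ennreal (z ^ 4 * indicator {-real n..real n} z) \<partial>\<mu>)"
    by (rule nn_integral_liminf) measurable
  also have "\<dots> \<le> limsup (\<lambda>n. \<integral>\<^sup>+z. ennreal (z ^ 4 * indicator {-real n..real n} z) \<partial>\<mu>)"
    by (rule Liminf_le_Limsup) simp
  also have "\<dots> \<le> ennreal (160 * C)"
    using trunc by (intro Limsup_bounded) (auto simp: eventually_sequentially)
  finally have fin: "(\<integral>\<^sup>+z. ennreal (z ^ 4) \<partial>\<mu>) < \<infinity>" by (simp add: le_less_trans)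
  show ?thesis
  proof (rule integrableI_bounded)
    have "(\<integral>\<^sup>+z. ennreal (norm (z ^ 4)) \<partial>\<mu>) = (\<integral>\<^sup>+z. ennreal (z ^ 4) \<partial>\<mu>)"
      by (intro nn_integral_cong) simp
    then show "(\<integral>\<^sup>+z. ennreal (norm (z ^ 4)) \<partial>\<mu>) < \<infinity>" using fin by simp
  qed simp
qed

text \<open>The Levy density may have infinite mass near 0; the \<open>- 1\<close> in the integrand
  removes the moment of order 0, and only the moments of order 1 to 4 enter. The first and the
  fourth dominate those in between.\<close>

lemma levy_cubic_at_0:
  fixes l :: "real \<Rightarrow> real"
  assumes lm[measurable]: "l \<in> borel_measurable borel" and l: "\<And>x. 0 \<le> l x" and l1: "integrable lborel (\<lambda>x. \<bar>x\<bar> * l x)"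
    and l4: "integrable lborel (\<lambda>x. x ^ 4 * l x)"
  shows "cubic_at_0 (\<lambda>h. exp (of_real \<Delta> * (CLINT x|lborel. (iexp (h * x) - 1) * of_real (l x))))"
proof (rule cubic_at_0_exp)
  let ?w = "\<lambda>h. CLINT x|lborel. (iexp (h * x) - 1) * complex_of_real (l x)"
  have lk: "integrable lborel (\<lambda>x. x ^ k * l x)" if "1 \<le> k" "k \<le> 4" for k
  proof (rule Bochner_Integration.integrable_bound[OF Bochner_Integration.integrable_add[OF l1 l4]])
    have "\<bar>x\<bar> ^ k \<le> \<bar>x\<bar> + x ^ 4" for x :: real
    proof (cases "\<bar>x\<bar> \<le> 1")
      case True
      then have "\<bar>x\<bar> ^ k \<le> \<bar>x\<bar> ^ 1" using that by (intro power_decreasing) auto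
      then show ?thesis by (simp add: add_increasing2)
    next
      case False
      then have "\<bar>x\<bar> ^ k \<le> \<bar>x\<bar> ^ 4" using that by (intro power_increasing) auto
      then show ?thesis by (simp add: power_even_abs add_increasing)
    qed
    then have "\<bar>x\<bar> ^ k * l x \<le> \<bar>x\<bar> * l x + x ^ 4 * l x" for x
      unfolding distrib_right[symmetric] by (intro mult_right_mono l)
    then show "AE x in lborel. norm (x ^ k * l x) \<le> norm (\<bar>x\<bar> * l x + x ^ 4 * l x)"
    proof (intro AE_I2)
      fix x
      have "norm (x ^ k * l x) = \<bar>x\<bar> ^ k * l x" using l[of x] by (simp add: abs_mult power_abs)
      also have "\<dots> \<le> \<bar>x\<bar> * l x + x ^ 4 * l x" by fact
      also have "\<dots> \<le> norm (\<bar>x\<bar> * l x + x ^ 4 * l x)" unfolding real_norm_def by (rule abs_ge_self)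
      finally show "norm (x ^ k * l x) \<le> norm (\<bar>x\<bar> * l x + x ^ 4 * l x)" .
    qed
  qed measurable
  have lkc: "integrable lborel (\<lambda>x. complex_of_real (x ^ k * l x))" if "1 \<le> k" "k \<le> 4" for k
    using lk[OF that] by (rule integrable_of_real)
  let ?m = "\<lambda>k. CLINT x|lborel. complex_of_real (x ^ k * l x)"
  have "cubic_at_0 ?w"
  proof (rule cubic_at_0I)
    fix h :: real
    let ?q = "\<lambda>x. (\<i> * of_real h) * of_real (x ^ 1 * l x) + (- (of_real h)\<^sup>2 / 2) * of_real (x\<^sup>2 * l x)
      + (- \<i> * of_real h ^ 3 / 6) * of_real (x ^ 3 * l x)"
    have qi: "integrable lborel ?q"
      by (intro Bochner_Integration.integrable_add integrable_mult_right lkc) auto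
    have q: "(CLINT x|lborel. ?q x) = cubic 0 (\<i> * ?m 1) (- ?m 2 / 2) (- \<i> * ?m 3 / 6) h"
    proof -
      have i: "integrable lborel (\<lambda>x. c * complex_of_real (x ^ 1 * l x))"
        "integrable lborel (\<lambda>x. c * complex_of_real (x\<^sup>2 * l x))"
        "integrable lborel (\<lambda>x. c * complex_of_real (x ^ 3 * l x))" for c
        by (intro integrable_mult_right lkc; simp)+
      show ?thesis
        unfolding Bochner_Integration.integral_add[OF Bochner_Integration.integrable_add[OF i(1) i(2)] i(3)]
          Bochner_Integration.integral_add[OF i(1) i(2)] integral_mult_right_zero
        by (simp add: ac_simps)
    qed
    have "?w h - (CLINT x|lborel. ?q x) = (CLINT x|lborel. (iexp (h * x) - 1) * complex_of_real (l x) - ?q x)"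
      by (intro Bochner_Integration.integral_diff[symmetric] qi integrable_iexp_minus_1 lm l l1)
    moreover have "cmod (CLINT x|lborel. (iexp (h * x) - 1) * complex_of_real (l x) - ?q x) \<le>
        (\<integral>x. h ^ 4 / 24 * (x ^ 4 * l x) \<partial>lborel)"
    proof (rule order.trans[OF integral_norm_bound], rule integral_mono)
      show "integrable lborel (\<lambda>x. cmod ((iexp (h * x) - 1) * complex_of_real (l x) - ?q x))"
        by (intro integrable_norm Bochner_Integration.integrable_diff qi integrable_iexp_minus_1 lm l l1)
      show "integrable lborel (\<lambda>x. h ^ 4 / 24 * (x ^ 4 * l x))" using l4 by (rule integrable_mult_right)
      fix x
      have "(iexp (h * x) - 1) * complex_of_real (l x) - ?q x =
        (iexp (h * x) - (1 + \<i> * of_real (h * x) - (of_real (h * x))\<^sup>2 / 2 - \<i> * of_real (h * x) ^ 3 / 6)) * complex_of_real (l x)"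
      proof -
        have "(e - 1) * k - ((\<i> * z) * (y ^ 1 * k) + (- z\<^sup>2 / 2) * (y\<^sup>2 * k) + (- \<i> * z ^ 3 / 6) * (y ^ 3 * k)) =
          (e - (1 + \<i> * (z * y) - (z * y)\<^sup>2 / 2 - \<i> * (z * y) ^ 3 / 6)) * k" for e k z y :: complex
          by (simp only: power_mult_distrib power_one_right) (simp add: field_simps)
        then show ?thesis
          by (simp only: of_real_mult of_real_power)
      qed
      also have "cmod \<dots> \<le> ((h * x) ^ 4 / 24) * l x"
        unfolding norm_mult norm_of_real abs_of_nonneg[OF l] by (intro mult_right_mono iexp_approx_3 l)
      also have "\<dots> = h ^ 4 / 24 * (x ^ 4 * l x)"
        by (simp add: power_mult_distrib)
      finally show "cmod ((iexp (h * x) - 1) * complex_of_real (l x) - ?q x) \<le> h ^ 4 / 24 * (x ^ 4 * l x)" .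
    qed
    moreover have "(\<integral>x. h ^ 4 / 24 * (x ^ 4 * l x) \<partial>lborel) = ((\<integral>x. x ^ 4 * l x \<partial>lborel) / 24) * h ^ 4"
      by (simp only: integral_mult_right_zero) simp
    ultimately show "cmod (?w h - cubic 0 (\<i> * ?m 1) (- ?m 2 / 2) (- \<i> * ?m 3 / 6) h) \<le> ((\<integral>x. x ^ 4 * l x \<partial>lborel) / 24) * h ^ 4"
      unfolding q by (simp only:)
  qed
  then show "cubic_at_0 (\<lambda>h. of_real \<Delta> * ?w h)"
    by (rule cubic_at_0_mult[OF cubic_at_0_const])
  fix h :: real
  have "cmod (?w h) \<le> (\<integral>x. \<bar>h\<bar> * (\<bar>x\<bar> * l x) \<partial>lborel)"
  proof (rule order.trans[OF integral_norm_bound], rule integral_mono)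
    show "integrable lborel (\<lambda>x. cmod ((iexp (h * x) - 1) * complex_of_real (l x)))"
      by (intro integrable_norm integrable_iexp_minus_1 lm l l1)
    show "integrable lborel (\<lambda>x. \<bar>h\<bar> * (\<bar>x\<bar> * l x))" using l1 by (rule integrable_mult_right)
    show "cmod ((iexp (h * x) - 1) * complex_of_real (l x)) \<le> \<bar>h\<bar> * (\<bar>x\<bar> * l x)" for x
      using mult_right_mono[OF cmod_iexp_minus_1_le[of "h * x"] l[of x]] l[of x]
      by (simp add: norm_mult abs_mult mult.assoc)
  qed
  then have "\<bar>\<Delta>\<bar> * cmod (?w h) \<le> \<bar>\<Delta>\<bar> * (\<integral>x. \<bar>h\<bar> * (\<bar>x\<bar> * l x) \<partial>lborel)"
    by (rule mult_left_mono) simp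
  then show "cmod (of_real \<Delta> * ?w h) \<le> (\<bar>\<Delta>\<bar> * (\<integral>x. \<bar>x\<bar> * l x \<partial>lborel)) * \<bar>h\<bar>"
    unfolding integral_mult_right_zero norm_mult norm_of_real by (simp only: ac_simps)
qed

section \<open>The pointwise risk of the truncated ratio\<close>

lemma cmod_add3_sq_le: "(cmod (a + b + c))\<^sup>2 \<le> 3 * ((cmod a)\<^sup>2 + (cmod b)\<^sup>2 + (cmod c)\<^sup>2)"
proof -
  have "(cmod (a + b + c))\<^sup>2 \<le> (cmod a + cmod b + cmod c)\<^sup>2"
    by (intro power_mono norm_triangle_mono) auto
  also have "\<dots> \<le> 3 * ((cmod a)\<^sup>2 + (cmod b)\<^sup>2 + (cmod c)\<^sup>2)"
    using sum_squares_ge_zero[of "cmod a - cmod b" "cmod b - cmod c"] zero_le_power2[of "cmod a - cmod c"]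
    by (simp add: power2_eq_square algebra_simps)
  finally show ?thesis .
qed

text \<open>If the truncation keeps \<open>\<psi>'\<close>, the error is
  \<open>d / (|\<psi>'| |\<psi>|)\<close> with \<open>|\<psi>'| > s\<close>; if it discards it, then
  \<open>|\<psi>|\<close> is at most \<open>s + d\<close>. The first bound is meant for a factor
  that is already small; the second pays \<open>1 / |\<psi>|^4\<close> in order to be small with s
  and d.\<close>

lemma truncated_inverse_error:
  fixes \<psi> \<psi>' :: complex and s :: real
  assumes \<psi>: "\<psi> \<noteq> 0" and s: "s > 0"
  defines "\<delta> \<equiv> (if cmod \<psi>' > s then 1 / \<psi>' else 0) - 1 / \<psi>" and "d \<equiv> cmod (\<psi>' - \<psi>)"
  shows "(cmod \<delta>)\<^sup>2 \<le> (1 + d\<^sup>2 / s\<^sup>2) / (cmod \<psi>)\<^sup>2"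
    and "(cmod \<delta>)\<^sup>2 \<le> (2 * s\<^sup>2 + 4 * d\<^sup>2 + 2 * (d\<^sup>2 * d\<^sup>2) / s\<^sup>2) / (cmod \<psi>) ^ 4"
proof -
  define p where "p = (cmod \<psi>)\<^sup>2"
  have p: "p > 0" using \<psi> by (simp add: p_def)
  have p4: "(cmod \<psi>) ^ 4 = p * p" by (simp add: p_def power2_eq_square eval_nat_numeral)
  have s2: "s\<^sup>2 > 0" using s by simp
  have d0: "0 \<le> d\<^sup>2" by simp
  have tri: "p \<le> 2 * d\<^sup>2 + 2 * (cmod \<psi>')\<^sup>2"
    using cmod_diff_sq_le[of \<psi>' "\<psi>' - \<psi>"] by (simp add: p_def d_def)
  have "(cmod \<delta>)\<^sup>2 \<le> (1 + d\<^sup>2 / s\<^sup>2) / p \<and> (cmod \<delta>)\<^sup>2 \<le> (2 * s\<^sup>2 + 4 * d\<^sup>2 + 2 * (d\<^sup>2 * d\<^sup>2) / s\<^sup>2) / (p * p)"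
  proof (cases "cmod \<psi>' > s")
    case True
    define q where "q = (cmod \<psi>')\<^sup>2"
    have q: "s\<^sup>2 \<le> q" using True s by (auto simp: q_def intro!: power_mono)
    have q0: "q > 0" using q s2 by linarith
    have "\<psi>' \<noteq> 0" using True s by auto
    then have "\<delta> = (\<psi> - \<psi>') / (\<psi>' * \<psi>)" using True \<psi> by (simp add: \<delta>_def field_simps)
    then have eq: "(cmod \<delta>)\<^sup>2 = d\<^sup>2 / (q * p)"
      by (simp add: d_def q_def p_def norm_divide norm_mult power_divide power_mult_distrib norm_minus_commute)
    have "d\<^sup>2 / (q * p) = d\<^sup>2 / q / p" by simp
    also have "\<dots> \<le> (1 + d\<^sup>2 / s\<^sup>2) / p"
    proof (rule divide_right_mono)
      have "d\<^sup>2 / q \<le> d\<^sup>2 / s\<^sup>2" by (intro divide_left_mono mult_pos_pos q q0 s2) auto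
      then show "d\<^sup>2 / q \<le> 1 + d\<^sup>2 / s\<^sup>2" by simp
    qed (use p in simp)
    finally have 1: "d\<^sup>2 / (q * p) \<le> (1 + d\<^sup>2 / s\<^sup>2) / p" .
    \<comment> \<open>After expansion by \<open>p / p\<close>, the inequality
      \<open>p \<le> 2 d^2 + 2 q\<close> cancels q in one term; in the other it is bounded below by
      \<open>s^2\<close>.\<close>
    have "d\<^sup>2 / (q * p) = d\<^sup>2 * p / q / (p * p)" using p q0 by (simp add: field_simps)
    also have "\<dots> \<le> (2 * s\<^sup>2 + 4 * d\<^sup>2 + 2 * (d\<^sup>2 * d\<^sup>2) / s\<^sup>2) / (p * p)"
    proof (rule divide_right_mono)
      have "d\<^sup>2 * p / q \<le> d\<^sup>2 * (2 * d\<^sup>2 + 2 * q) / q"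
        using tri q0 by (intro divide_right_mono mult_left_mono) (auto simp: q_def)
      also have "\<dots> = 2 * (d\<^sup>2 * d\<^sup>2) / q + 2 * d\<^sup>2" using q0 by (simp add: field_simps)
      also have "2 * (d\<^sup>2 * d\<^sup>2) / q \<le> 2 * (d\<^sup>2 * d\<^sup>2) / s\<^sup>2"
        by (intro divide_left_mono mult_pos_pos q q0 s2) auto
      finally show "d\<^sup>2 * p / q \<le> 2 * s\<^sup>2 + 4 * d\<^sup>2 + 2 * (d\<^sup>2 * d\<^sup>2) / s\<^sup>2" using d0 s2 by linarith
    qed simp
    finally show ?thesis using 1 unfolding eq by blast
  next
    case False
    then have eq: "(cmod \<delta>)\<^sup>2 = 1 / p" by (simp add: \<delta>_def p_def norm_divide power_divide)
    have 1: "1 / p \<le> (1 + d\<^sup>2 / s\<^sup>2) / p" using p by (intro divide_right_mono) auto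
    have "(cmod \<psi>')\<^sup>2 \<le> s\<^sup>2" using False by (intro power_mono) auto
    then have "p \<le> 2 * s\<^sup>2 + 4 * d\<^sup>2" using tri d0 by linarith
    moreover have "0 \<le> 2 * (d\<^sup>2 * d\<^sup>2) / s\<^sup>2" by simp
    ultimately have "p / (p * p) \<le> (2 * s\<^sup>2 + 4 * d\<^sup>2 + 2 * (d\<^sup>2 * d\<^sup>2) / s\<^sup>2) / (p * p)"
      by (intro divide_right_mono order.trans[OF \<open>p \<le> 2 * s\<^sup>2 + 4 * d\<^sup>2\<close>]) (use d0 in auto)
    then show ?thesis using 1 p unfolding eq by simp
  qed
  then show "(cmod \<delta>)\<^sup>2 \<le> (1 + d\<^sup>2 / s\<^sup>2) / (cmod \<psi>)\<^sup>2"
    "(cmod \<delta>)\<^sup>2 \<le> (2 * s\<^sup>2 + 4 * d\<^sup>2 + 2 * (d\<^sup>2 * d\<^sup>2) / s\<^sup>2) / (cmod \<psi>) ^ 4"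
    unfolding p4 by (auto simp: p_def)
qed

lemma ratio_error:
  fixes \<psi> \<psi>' \<theta> \<theta>' :: complex and s :: real
  assumes \<psi>: "\<psi> \<noteq> 0" and s: "s > 0"
  defines "d \<equiv> (cmod (\<psi>' - \<psi>))\<^sup>2" and "e \<equiv> (cmod (\<theta>' - \<theta>))\<^sup>2" and "p \<equiv> (cmod \<psi>)\<^sup>2"
  shows "(cmod (\<theta>' * (if cmod \<psi>' > s then 1 / \<psi>' else 0) - \<theta> / \<psi>))\<^sup>2 \<le>
    3 * (2 * e / p + e * d / (s\<^sup>2 * p) + (cmod \<theta>)\<^sup>2 / p\<^sup>2 * (2 * s\<^sup>2 + 4 * d + 2 / s\<^sup>2 * (d * d)))"
proof -
  define \<delta> where "\<delta> = (if cmod \<psi>' > s then 1 / \<psi>' else 0) - 1 / \<psi>"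
  have b1: "(cmod \<delta>)\<^sup>2 \<le> (1 + d / s\<^sup>2) / p"
    using truncated_inverse_error(1)[OF \<psi> s, of \<psi>'] by (simp add: \<delta>_def d_def p_def)
  have b2: "(cmod \<delta>)\<^sup>2 \<le> (2 * s\<^sup>2 + 4 * d + 2 * (d * d) / s\<^sup>2) / p\<^sup>2"
    using truncated_inverse_error(2)[OF \<psi> s, of \<psi>'] by (simp add: \<delta>_def d_def p_def flip: power_mult)
  \<comment> \<open>Each summand gets its own estimate: the first bound on \<open>\<delta>\<close>
    goes with \<open>\<theta>' - \<theta>\<close>, the second with \<open>\<theta>\<close>, and the
    last summand contains no \<open>\<delta>\<close>.\<close>
  have "\<theta>' * (if cmod \<psi>' > s then 1 / \<psi>' else 0) - \<theta> / \<psi> = (\<theta>' - \<theta>) * \<delta> + \<theta> * \<delta> + (\<theta>' - \<theta>) / \<psi>"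
    by (simp add: \<delta>_def algebra_simps diff_divide_distrib)
  then have "(cmod (\<theta>' * (if cmod \<psi>' > s then 1 / \<psi>' else 0) - \<theta> / \<psi>))\<^sup>2 \<le>
      3 * (e * (cmod \<delta>)\<^sup>2 + (cmod \<theta>)\<^sup>2 * (cmod \<delta>)\<^sup>2 + e / p)"
    using cmod_add3_sq_le[of "(\<theta>' - \<theta>) * \<delta>" "\<theta> * \<delta>" "(\<theta>' - \<theta>) / \<psi>"]
    by (simp only: norm_mult norm_divide power_mult_distrib power_divide e_def p_def)
  also have "\<dots> \<le> 3 * (e * ((1 + d / s\<^sup>2) / p) + (cmod \<theta>)\<^sup>2 * ((2 * s\<^sup>2 + 4 * d + 2 * (d * d) / s\<^sup>2) / p\<^sup>2) + e / p)"
    by (intro mult_left_mono add_mono b1 b2 order.refl) (auto simp: e_def)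
  also have "\<dots> = 3 * (2 * e / p + e * d / (s\<^sup>2 * p) + (cmod \<theta>)\<^sup>2 / p\<^sup>2 * (2 * s\<^sup>2 + 4 * d + 2 / s\<^sup>2 * (d * d)))"
    by (simp add: add_divide_distrib algebra_simps)
  finally show ?thesis .
qed

lemma (in prob_space) integral_centered_square_le:
  fixes f :: "'a \<Rightarrow> real"
  assumes [measurable]: "f \<in> borel_measurable M" and f2: "integrable M (\<lambda>x. (f x)\<^sup>2)"
  shows "integrable M (\<lambda>x. (f x - expectation f)\<^sup>2)"
    and "(\<integral>x. (f x - expectation f)\<^sup>2 \<partial>M) \<le> (\<integral>x. (f x)\<^sup>2 \<partial>M)"
    and "(\<integral>x. f x - expectation f \<partial>M) = 0"
proof -
  have f1: "integrable M f" by (rule square_integrable_imp_integrable[OF _ f2]) measurable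
  show "integrable M (\<lambda>x. (f x - expectation f)\<^sup>2)"
    using f1 f2 by (simp add: power2_diff)
  show "(\<integral>x. (f x - expectation f)\<^sup>2 \<partial>M) \<le> (\<integral>x. (f x)\<^sup>2 \<partial>M)"
    using variance_eq[OF f1 f2] by simp
  show "(\<integral>x. f x - expectation f \<partial>M) = 0"
    using f1 prob_space by simp
qed

section \<open>Empirical means and the risk at a fixed frequency\<close>

context iid
begin

definition deviation :: "nat \<Rightarrow> (real \<Rightarrow> complex) \<Rightarrow> 'a \<Rightarrow> complex" where
  "deviation n F w = (\<Sum>k<n. F (Z k w)) / of_nat n - (CLINT z|\<mu>. F z)"

lemma \<mu>_prob:
  assumes "0 < N"
  shows "prob_space \<mu>" "sets \<mu> = sets borel"
  using prob_space_distr[OF Z_measurable[OF assms]] Z_distr[OF assms] by auto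

lemma deviation_sq:
  assumes [measurable]: "F \<in> borel_measurable borel" and Fi: "integrable \<mu> F" and n: "n \<ge> 1"
  shows "(cmod (deviation n F w))\<^sup>2 =
    ((\<Sum>k<n. Re (F (Z k w)) - (\<integral>z. Re (F z) \<partial>\<mu>))\<^sup>2 + (\<Sum>k<n. Im (F (Z k w)) - (\<integral>z. Im (F z) \<partial>\<mu>))\<^sup>2) / (real n)\<^sup>2"
proof -
  have "deviation n F w = (\<Sum>k<n. F (Z k w) - (CLINT z|\<mu>. F z)) / of_nat n"
    using n by (simp add: deviation_def sum_subtractf field_simps)
  then have "(cmod (deviation n F w))\<^sup>2 = (cmod (\<Sum>k<n. F (Z k w) - (CLINT z|\<mu>. F z)))\<^sup>2 / (real n)\<^sup>2"
    by (simp add: norm_divide power_divide)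
  then show ?thesis using Fi by (simp add: cmod_power2)
qed

text \<open>Real and imaginary parts are treated separately, whence the 2 and the four mixed
  products. A centred part of G is bounded by 2, so each mixed product contributes
  \<open>3 * 2^2 = 12\<close> through \<open>iid_mixed\<close>, in total 48.\<close>

lemma deviation_moments:
  assumes F[measurable]: "F \<in> borel_measurable borel" and F2: "integrable \<mu> (\<lambda>z. (cmod (F z))\<^sup>2)"
    and n: "n \<ge> 1" "n \<le> N"
  shows "integrable M (\<lambda>w. (cmod (deviation n F w))\<^sup>2)"
    and "expectation (\<lambda>w. (cmod (deviation n F w))\<^sup>2) \<le> 2 * (\<integral>z. (cmod (F z))\<^sup>2 \<partial>\<mu>) / n"
    and "\<And>G. G \<in> borel_measurable borel \<Longrightarrow> (\<And>z. cmod (G z) \<le> 1) \<Longrightarrow>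
      integrable M (\<lambda>w. (cmod (deviation n F w))\<^sup>2 * (cmod (deviation n G w))\<^sup>2) \<and>
      expectation (\<lambda>w. (cmod (deviation n F w))\<^sup>2 * (cmod (deviation n G w))\<^sup>2) \<le> 48 * (\<integral>z. (cmod (F z))\<^sup>2 \<partial>\<mu>) / (real n)\<^sup>2"
proof -
  have N0: "0 < N" using n by simp
  interpret \<mu>: prob_space \<mu> by (rule \<mu>_prob[OF N0])
  have [measurable_cong]: "sets \<mu> = sets borel" by (rule \<mu>_prob[OF N0])
  define s where "s = (\<integral>z. (cmod (F z))\<^sup>2 \<partial>\<mu>)"
  define f1 where "f1 z = Re (F z) - (\<integral>z. Re (F z) \<partial>\<mu>)" for z
  define f2 where "f2 z = Im (F z) - (\<integral>z. Im (F z) \<partial>\<mu>)" for z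
  have s0: "0 \<le> s" by (simp add: s_def)
  have "integrable \<mu> (\<lambda>z. cmod (F z))" by (rule \<mu>.square_integrable_imp_integrable[OF _ F2]) measurable
  then have Fi: "integrable \<mu> F" by (subst (asm) integrable_norm_iff) measurable
  have r2: "integrable \<mu> (\<lambda>z. (Re (F z))\<^sup>2)" "integrable \<mu> (\<lambda>z. (Im (F z))\<^sup>2)"
    by (rule Bochner_Integration.integrable_bound[OF F2]; simp add: cmod_power2)+
  have rs: "(\<integral>z. (Re (F z))\<^sup>2 \<partial>\<mu>) \<le> s" "(\<integral>z. (Im (F z))\<^sup>2 \<partial>\<mu>) \<le> s"
    unfolding s_def by (rule integral_mono[OF _ F2]; simp add: r2 cmod_power2)+
  have f1: "f1 \<in> borel_measurable borel" "integrable \<mu> (\<lambda>z. (f1 z)\<^sup>2)" "(\<integral>z. (f1 z)\<^sup>2 \<partial>\<mu>) \<le> s" "(\<integral>z. f1 z \<partial>\<mu>) = 0"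
    using \<mu>.integral_centered_square_le[OF _ r2(1)] rs(1) unfolding f1_def by auto
  have f2: "f2 \<in> borel_measurable borel" "integrable \<mu> (\<lambda>z. (f2 z)\<^sup>2)" "(\<integral>z. (f2 z)\<^sup>2 \<partial>\<mu>) \<le> s" "(\<integral>z. f2 z \<partial>\<mu>) = 0"
    using \<mu>.integral_centered_square_le[OF _ r2(2)] rs(2) unfolding f2_def by auto
  have dF: "(cmod (deviation n F w))\<^sup>2 = ((\<Sum>k<n. f1 (Z k w))\<^sup>2 + (\<Sum>k<n. f2 (Z k w))\<^sup>2) / (real n)\<^sup>2" for w
    unfolding deviation_sq[OF F Fi n(1)] f1_def f2_def ..
  note q1 = iid_square[OF f1(1,2,4) n(2)] and q2 = iid_square[OF f2(1,2,4) n(2)]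
  show "integrable M (\<lambda>w. (cmod (deviation n F w))\<^sup>2)"
    unfolding dF using q1(1) q2(1) by simp
  have "expectation (\<lambda>w. (cmod (deviation n F w))\<^sup>2) = (n * (\<integral>z. (f1 z)\<^sup>2 \<partial>\<mu>) + n * (\<integral>z. (f2 z)\<^sup>2 \<partial>\<mu>)) / (real n)\<^sup>2"
    unfolding dF using q1 q2 by simp
  also have "\<dots> \<le> (n * s + n * s) / (real n)\<^sup>2"
    using f1(3) f2(3) by (intro divide_right_mono add_mono mult_left_mono) auto
  also have "\<dots> = 2 * s / n" using n by (simp add: power2_eq_square field_simps)
  finally show "expectation (\<lambda>w. (cmod (deviation n F w))\<^sup>2) \<le> 2 * (\<integral>z. (cmod (F z))\<^sup>2 \<partial>\<mu>) / n"
    by (simp add: s_def)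
  fix G :: "real \<Rightarrow> complex" assume G[measurable]: "G \<in> borel_measurable borel" and G1: "\<And>z. cmod (G z) \<le> 1"
  define g1 where "g1 z = Re (G z) - (\<integral>z. Re (G z) \<partial>\<mu>)" for z
  define g2 where "g2 z = Im (G z) - (\<integral>z. Im (G z) \<partial>\<mu>)" for z
  have Gi: "integrable \<mu> G" by (rule \<mu>.integrable_const_bound[of _ 1]) (use G1 in auto)
  have Eb: "cmod (CLINT z|\<mu>. G z) \<le> 1"
    using order.trans[OF integral_norm_bound \<mu>.integral_le_const[of "\<lambda>z. cmod (G z)" 1]] Gi G1 by auto
  have g1: "g1 \<in> borel_measurable borel" "\<bar>g1 z\<bar> \<le> 2" "(\<integral>z. g1 z \<partial>\<mu>) = 0" for z
  proof -
    show "\<bar>g1 z\<bar> \<le> 2"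
      using order.trans[OF abs_Re_le_cmod G1[of z]] order.trans[OF abs_Re_le_cmod Eb] Gi
      by (simp add: g1_def)
  qed (use Gi \<mu>.prob_space in \<open>auto simp: g1_def[abs_def]\<close>)
  have g2: "g2 \<in> borel_measurable borel" "\<bar>g2 z\<bar> \<le> 2" "(\<integral>z. g2 z \<partial>\<mu>) = 0" for z
  proof -
    show "\<bar>g2 z\<bar> \<le> 2"
      using order.trans[OF abs_Im_le_cmod G1[of z]] order.trans[OF abs_Im_le_cmod Eb] Gi
      by (simp add: g2_def)
  qed (use Gi \<mu>.prob_space in \<open>auto simp: g2_def[abs_def]\<close>)
  have dG: "(cmod (deviation n G w))\<^sup>2 = ((\<Sum>k<n. g1 (Z k w))\<^sup>2 + (\<Sum>k<n. g2 (Z k w))\<^sup>2) / (real n)\<^sup>2" for w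
    unfolding deviation_sq[OF G Gi n(1)] g1_def g2_def ..
  have bound: "integrable M (\<lambda>w. (\<Sum>k<n. f (Z k w))\<^sup>2 * (\<Sum>k<n. g (Z k w))\<^sup>2) \<and>
      expectation (\<lambda>w. (\<Sum>k<n. f (Z k w))\<^sup>2 * (\<Sum>k<n. g (Z k w))\<^sup>2) \<le> 12 * (real n)\<^sup>2 * s"
    if f: "f \<in> borel_measurable borel" "integrable \<mu> (\<lambda>z. (f z)\<^sup>2)" "(\<integral>z. (f z)\<^sup>2 \<partial>\<mu>) \<le> s" "(\<integral>z. f z \<partial>\<mu>) = 0"
      and g: "g \<in> borel_measurable borel" "\<And>z. \<bar>g z\<bar> \<le> 2" "(\<integral>z. g z \<partial>\<mu>) = 0" for f g
  proof -
    note m = iid_mixed[OF f(1,2,4) g n(2)]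
    have "3 * (real n)\<^sup>2 * 2\<^sup>2 * (\<integral>z. (f z)\<^sup>2 \<partial>\<mu>) \<le> 12 * (real n)\<^sup>2 * s"
      using mult_left_mono[OF f(3), of "12 * (real n)\<^sup>2"] by simp
    then show ?thesis using m order.trans by blast
  qed
  note b = bound[OF f1 g1] bound[OF f1 g2] bound[OF f2 g1] bound[OF f2 g2]
  have prod: "(cmod (deviation n F w))\<^sup>2 * (cmod (deviation n G w))\<^sup>2 =
    ((\<Sum>k<n. f1 (Z k w))\<^sup>2 * (\<Sum>k<n. g1 (Z k w))\<^sup>2 + (\<Sum>k<n. f1 (Z k w))\<^sup>2 * (\<Sum>k<n. g2 (Z k w))\<^sup>2 +
    ((\<Sum>k<n. f2 (Z k w))\<^sup>2 * (\<Sum>k<n. g1 (Z k w))\<^sup>2 + (\<Sum>k<n. f2 (Z k w))\<^sup>2 * (\<Sum>k<n. g2 (Z k w))\<^sup>2)) / (real n) ^ 4" for w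
    unfolding dF dG by (simp add: algebra_simps add_divide_distrib flip: power_add)
  have "expectation (\<lambda>w. (cmod (deviation n F w))\<^sup>2 * (cmod (deviation n G w))\<^sup>2) \<le>
     (12 * (real n)\<^sup>2 * s + 12 * (real n)\<^sup>2 * s + (12 * (real n)\<^sup>2 * s + 12 * (real n)\<^sup>2 * s)) / (real n) ^ 4"
    unfolding prod integral_divide_zero
    by (subst Bochner_Integration.integral_add, (use b in simp), (use b in simp))+
       (use b in \<open>intro divide_right_mono add_mono, auto\<close>)
  also have "\<dots> = 48 * s / (real n)\<^sup>2" using n by (simp add: eval_nat_numeral field_simps)
  finally show "integrable M (\<lambda>w. (cmod (deviation n F w))\<^sup>2 * (cmod (deviation n G w))\<^sup>2) \<and>
      expectation (\<lambda>w. (cmod (deviation n F w))\<^sup>2 * (cmod (deviation n G w))\<^sup>2) \<le> 48 * (\<integral>z. (cmod (F z))\<^sup>2 \<partial>\<mu>) / (real n)\<^sup>2"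
    unfolding prod using b by (simp add: s_def)
qed

text \<open>With \<open>s^2 = \<kappa>^2 / n\<close>, the mixed terms of \<open>ratio_error\<close>,
  of mean order \<open>1 / n^2\<close> before division by \<open>s^2\<close>, become of order
  \<open>1 / n\<close> like the others. The result is grouped so that one factor
  \<open>1 / |char \<mu> u|^2\<close> stands in front and \<open>\<theta>\<close> survives only in
  the bounded ratio \<open>\<theta> / char \<mu> u\<close>.\<close>

lemma ratio_risk:
  assumes z2: "integrable \<mu> (\<lambda>z. z\<^sup>2)" and \<kappa>: "\<kappa> > 0" and n: "n \<ge> 1" "n \<le> N"
    and \<psi>0: "char \<mu> u \<noteq> 0"
  defines "\<theta> \<equiv> (CLINT z|\<mu>. of_real z * iexp (u * z))"
    and "\<psi>' \<equiv> \<lambda>w. (\<Sum>k<n. iexp (u * Z k w)) / of_nat n"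
    and "\<theta>' \<equiv> \<lambda>w. (\<Sum>k<n. of_real (Z k w) * iexp (u * Z k w)) / of_nat n"
  shows "(\<integral>\<^sup>+w. ennreal ((cmod (\<theta>' w * (if cmod (\<psi>' w) > \<kappa> * real n powr (-1/2) then 1 / \<psi>' w else 0)
      - \<theta> / char \<mu> u))\<^sup>2) \<partial>M) \<le>
    ennreal (3 * (12 + 2 * \<kappa>\<^sup>2 + 144 / \<kappa>\<^sup>2) / (n * (cmod (char \<mu> u))\<^sup>2) * ((\<integral>z. z\<^sup>2 \<partial>\<mu>) + (cmod (\<theta> / char \<mu> u))\<^sup>2))"
proof -
  have N0: "0 < N" using n by simp
  interpret \<mu>: prob_space \<mu> by (rule \<mu>_prob[OF N0])
  have [measurable_cong]: "sets \<mu> = sets borel" by (rule \<mu>_prob[OF N0])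
  define s where "s = \<kappa> * real n powr (-1/2)"
  define F where "F z = complex_of_real z * iexp (u * z)" for z
  define G where "G z = iexp (u * z)" for z
  have F_meas: "F \<in> borel_measurable borel" and G_meas: "G \<in> borel_measurable borel"
    unfolding F_def G_def by measurable
  have s0: "s > 0" using \<kappa> n by (simp add: s_def)
  have "(real n powr (-1/2))\<^sup>2 = 1 / n"
    using n by (simp add: power2_eq_square powr_minus field_simps flip: powr_add)
  then have s2: "s\<^sup>2 = \<kappa>\<^sup>2 / n" by (simp add: s_def power_mult_distrib)
  define m2 where "m2 = (\<integral>z. z\<^sup>2 \<partial>\<mu>)"
  have m20: "0 \<le> m2" by (simp add: m2_def)
  have Fn: "(\<lambda>z. (cmod (F z))\<^sup>2) = (\<lambda>z. z\<^sup>2)" and Gn: "(\<lambda>z. (cmod (G z))\<^sup>2) = (\<lambda>z. 1)"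
    by (auto simp: F_def G_def norm_mult)
  have F2: "integrable \<mu> (\<lambda>z. (cmod (F z))\<^sup>2)" "(\<integral>z. (cmod (F z))\<^sup>2 \<partial>\<mu>) = m2"
    unfolding Fn using z2 by (auto simp: m2_def)
  have G2: "integrable \<mu> (\<lambda>z. (cmod (G z))\<^sup>2)" "(\<integral>z. (cmod (G z))\<^sup>2 \<partial>\<mu>) = 1" "cmod (G z) \<le> 1" for z
    unfolding Gn using \<mu>.prob_space by (auto simp: G_def)
  define e where "e w = (cmod (deviation n F w))\<^sup>2" for w
  define d where "d w = (cmod (deviation n G w))\<^sup>2" for w
  have e: "integrable M e" "expectation e \<le> 2 * m2 / n"
    using deviation_moments(1,2)[OF F_meas F2(1) n] unfolding e_def F2(2) by auto
  have d: "integrable M d" "expectation d \<le> 2 / n"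
    using deviation_moments(1,2)[OF G_meas G2(1) n] unfolding d_def G2(2) by auto
  have ed: "integrable M (\<lambda>w. e w * d w)" "expectation (\<lambda>w. e w * d w) \<le> 48 * m2 / (real n)\<^sup>2"
    using deviation_moments(3)[OF F_meas F2(1) n G_meas G2(3)] unfolding d_def e_def F2(2) by auto
  have dd: "integrable M (\<lambda>w. d w * d w)" "expectation (\<lambda>w. d w * d w) \<le> 48 / (real n)\<^sup>2"
    using deviation_moments(3)[OF G_meas G2(1) n G_meas G2(3)] unfolding d_def G2(2) by auto
  have dev: "deviation n F w = \<theta>' w - \<theta>" "deviation n G w = \<psi>' w - char \<mu> u" for w
    by (auto simp: deviation_def F_def G_def \<theta>_def \<theta>'_def \<psi>'_def char_def)
  define p where "p = (cmod (char \<mu> u))\<^sup>2"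
  have p0: "p > 0" using \<psi>0 by (simp add: p_def)
  define t where "t = (cmod \<theta>)\<^sup>2 / p\<^sup>2"
  have t0: "0 \<le> t" by (simp add: t_def)
  let ?B = "\<lambda>w. 3 * (2 / p * e w + 1 / (s\<^sup>2 * p) * (e w * d w) + t * (2 * s\<^sup>2 + 4 * d w + 2 / s\<^sup>2 * (d w * d w)))"
  have "(\<integral>\<^sup>+w. ennreal ((cmod (\<theta>' w * (if cmod (\<psi>' w) > s then 1 / \<psi>' w else 0) - \<theta> / char \<mu> u))\<^sup>2) \<partial>M) \<le>
      (\<integral>\<^sup>+w. ennreal (?B w) \<partial>M)"
  proof (intro nn_integral_mono ennreal_leI)
    fix w
    show "(cmod (\<theta>' w * (if cmod (\<psi>' w) > s then 1 / \<psi>' w else 0) - \<theta> / char \<mu> u))\<^sup>2 \<le> ?B w"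
      using ratio_error[OF \<psi>0 s0, of "\<theta>' w" "\<psi>' w" \<theta>]
      by (simp add: e_def d_def p_def t_def dev)
  qed
  also have "\<dots> = ennreal (expectation ?B)"
  proof (intro nn_integral_eq_integral AE_I2)
    show "integrable M ?B"
      using e(1) d(1) ed(1) dd(1) by (intro integrable_mult_right Bochner_Integration.integrable_add integrable_const)
    show "0 \<le> ?B w" for w
      unfolding e_def d_def using t0 p0 by (intro mult_nonneg_nonneg add_nonneg_nonneg) auto
  qed
  also have "expectation ?B = 3 * (2 / p * expectation e + 1 / (s\<^sup>2 * p) * expectation (\<lambda>w. e w * d w)
      + t * (2 * s\<^sup>2 + 4 * expectation d + 2 / s\<^sup>2 * expectation (\<lambda>w. d w * d w)))"
  proof -
    have 1: "integrable M (\<lambda>w. 2 / p * e w)" "integrable M (\<lambda>w. 1 / (s\<^sup>2 * p) * (e w * d w))"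
      "integrable M (\<lambda>w. 4 * d w)" "integrable M (\<lambda>w. 2 / s\<^sup>2 * (d w * d w))" "integrable M (\<lambda>w. 2 * s\<^sup>2)"
      using e(1) d(1) ed(1) dd(1) by (auto intro: integrable_mult_right)
    have 2: "integrable M (\<lambda>w. 2 * s\<^sup>2 + 4 * d w)" "integrable M (\<lambda>w. 2 * s\<^sup>2 + 4 * d w + 2 / s\<^sup>2 * (d w * d w))"
      "integrable M (\<lambda>w. 2 / p * e w + 1 / (s\<^sup>2 * p) * (e w * d w))"
      using 1 by (auto intro: Bochner_Integration.integrable_add)
    show ?thesis
      unfolding integral_mult_right_zero
        Bochner_Integration.integral_add[OF 2(3) integrable_mult_right[OF 2(2)]]
        Bochner_Integration.integral_add[OF 1(1,2)] Bochner_Integration.integral_add[OF 2(1) 1(4)]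
        Bochner_Integration.integral_add[OF 1(5,3)] by (simp add: prob_space)
  qed
  also have "\<dots> \<le> 3 * (2 / p * (2 * m2 / n) + 1 / (s\<^sup>2 * p) * (48 * m2 / (real n)\<^sup>2)
      + t * (2 * s\<^sup>2 + 4 * (2 / n) + 2 / s\<^sup>2 * (48 / (real n)\<^sup>2)))"
    using p0 t0 by (intro mult_left_mono add_mono e d ed dd order.refl) auto
  also have "\<dots> = 3 * ((4 + 48 / \<kappa>\<^sup>2) * (m2 / (n * p)) + (2 * \<kappa>\<^sup>2 + 8 + 96 / \<kappa>\<^sup>2) * (t / n))"
    using n p0 \<kappa> unfolding s2 by (simp add: field_simps power2_eq_square)
  \<comment> \<open>The common constant is the sum of the two coefficients
    \<open>4 + 48 / \<kappa>^2\<close> and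
    \<open>2 \<kappa>^2 + 8 + 96 / \<kappa>^2\<close>.\<close>
  also have "\<dots> \<le> 3 * ((12 + 2 * \<kappa>\<^sup>2 + 144 / \<kappa>\<^sup>2) * (m2 / (n * p)) + (12 + 2 * \<kappa>\<^sup>2 + 144 / \<kappa>\<^sup>2) * (t / n))"
  proof -
    have "48 / \<kappa>\<^sup>2 \<le> 144 / \<kappa>\<^sup>2" "96 / \<kappa>\<^sup>2 \<le> 144 / \<kappa>\<^sup>2" "0 \<le> \<kappa>\<^sup>2"
      by (auto intro: divide_right_mono)
    then have c: "4 + 48 / \<kappa>\<^sup>2 \<le> 12 + 2 * \<kappa>\<^sup>2 + 144 / \<kappa>\<^sup>2" "2 * \<kappa>\<^sup>2 + 8 + 96 / \<kappa>\<^sup>2 \<le> 12 + 2 * \<kappa>\<^sup>2 + 144 / \<kappa>\<^sup>2"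
      by linarith+
    have "0 \<le> m2 / (n * p)" "0 \<le> t / n" using m20 p0 t0 by auto
    from mult_right_mono[OF c(1) this(1)] mult_right_mono[OF c(2) this(2)]
    show ?thesis by (intro mult_left_mono add_mono) auto
  qed
  also have "\<dots> = 3 * (12 + 2 * \<kappa>\<^sup>2 + 144 / \<kappa>\<^sup>2) / (n * p) * (m2 + (cmod (\<theta> / char \<mu> u))\<^sup>2)"
  proof -
    have "(cmod (\<theta> / char \<mu> u))\<^sup>2 = t * p"
      using p0 by (simp add: t_def norm_divide power_divide p_def power2_eq_square)
    moreover have "3 * (c * (m2 / (n * p)) + c * (t / n)) = 3 * c / (n * p) * (m2 + t * p)" for c :: real
      using p0 n by (simp add: field_simps)
    ultimately show ?thesis by (simp only:)
  qed
  finally show ?thesis unfolding s_def p_def m2_def by (simp add: ennreal_leI)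
qed

end

section \<open>The risk bound\<close>

text \<open>A continuous function without zeros has an inverse square that is integrable on compact
  intervals. So the Bochner integral in the risk bound is the genuine integral and not the default
  value 0.\<close>

lemma set_integral_inverse_char:
  assumes "real_distribution \<mu>" and nz: "\<And>u. char \<mu> u \<noteq> 0"
  shows "(\<integral>\<^sup>+x. ennreal (indicator {a..b} x / (cmod (char \<mu> x))\<^sup>2) \<partial>lborel) =
      ennreal (LBINT x:{a..b}. 1 / (cmod (char \<mu> x))\<^sup>2)"
proof -
  interpret real_distribution \<mu> by fact
  have "continuous_on {a..b} (\<lambda>x. 1 / (cmod (char \<mu> x))\<^sup>2)"
    by (intro continuous_intros continuous_at_imp_continuous_on ballI isCont_char) (use nz in auto)
  then have "set_integrable lborel {a..b} (\<lambda>x. 1 / (cmod (char \<mu> x))\<^sup>2)"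
    by (rule borel_integrable_atLeastAtMost')
  then show ?thesis
    unfolding set_integrable_def set_lebesgue_integral_def
    by (subst nn_integral_eq_integral[symmetric]) auto
qed

text \<open>The times \<open>k * \<Delta>\<close> form a monotone sequence starting at 0, to which
  the independence clause applies. The shift \<open>Suc k\<close> matches observations numbered from
  1 with sample indices from 0.\<close>

lemma levy_increments_iid:
  assumes L: "levy_process M L" and \<Delta>: "\<Delta> > 0"
  shows "iid M (\<lambda>k. increment L \<Delta> (Suc k)) (distr M borel (L \<Delta>)) N"
    and "increment L \<Delta> (Suc k) \<in> borel_measurable M"
    and "distr M borel (increment L \<Delta> (Suc k)) = distr M borel (L \<Delta>)"
proof -
  have inc: "increment L \<Delta> (Suc k) = (\<lambda>w. L (real (Suc k) * \<Delta>) w - L (real k * \<Delta>) w)" for k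
    by (simp add: increment_def fun_eq_iff)
  have meas: "L t \<in> borel_measurable M" if "t \<ge> 0" for t
    using L that by (simp add: levy_process_def)
  show "increment L \<Delta> (Suc k) \<in> borel_measurable M" for k
    unfolding inc using \<Delta> by (intro borel_measurable_diff meas) auto
  have "prob_space M" using L by (simp add: levy_process_def)
  have d: "distr M borel (increment L \<Delta> (Suc k)) = distr M borel (L \<Delta>)" for k
  proof -
    have "\<forall>s\<ge>0. \<forall>h\<ge>0. distr M borel (\<lambda>w. L (s + h) w - L s w) = distr M borel (L h)"
      using L by (simp add: levy_process_def)
    then have "distr M borel (\<lambda>w. L (real k * \<Delta> + \<Delta>) w - L (real k * \<Delta>) w) = distr M borel (L \<Delta>)"
      using \<Delta> by simp
    then show ?thesis unfolding inc by (simp add: algebra_simps)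
  qed
  then show "distr M borel (increment L \<Delta> (Suc k)) = distr M borel (L \<Delta>)" for k .
  have "mono (\<lambda>k. real k * \<Delta>)" using \<Delta> by (intro monoI mult_right_mono) auto
  moreover have ind: "prob_space.indep_vars M (\<lambda>_. borel) (\<lambda>k w. L (t (Suc k)) w - L (t k) w) {..<n}"
    if "0 \<le> t 0" "mono t" for n t
    using L that by (simp add: levy_process_def)
  ultimately have "prob_space.indep_vars M (\<lambda>_. borel) (\<lambda>k w. L (real (Suc k) * \<Delta>) w - L (real k * \<Delta>) w) {..<N}"
    by (intro ind[of "\<lambda>k. real k * \<Delta>"]) simp_all
  then show "iid M (\<lambda>k. increment L \<Delta> (Suc k)) (distr M borel (L \<Delta>)) N"
    using d \<open>prob_space M\<close> by (simp add: iid_def iid_axioms_def inc)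
qed

text \<open>The Fourier transform of \<open>g_hat\<close> is the band-limited function \<open>theta_hat / (\<Delta> psi_tilde)\<close>.\<close>

lemma g_hat_risk:
  assumes g: "g \<in> L2_space" and gi: "integrable lborel g" and \<Delta>: "\<Delta> > 0" and \<kappa>: "\<kappa> > 0"
    and n: "n \<ge> 1" and m: "m \<ge> 1"
  shows "L2_norm_sq (\<lambda>x. g x - g_hat \<Delta> \<kappa> n z m x) = L2_norm_sq (\<lambda>x. g x - L2_orth_proj (S_space m) g x) +
    ennreal (1 / (2 * pi)) * (\<integral>\<^sup>+y. ennreal (indicator {-pi * real m..pi * real m} y *
      (cmod (theta_hat n z y * inv_psi_tilde \<kappa> n z y - \<Delta> * ft g y))\<^sup>2 / \<Delta>\<^sup>2) \<partial>lborel)"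
proof -
  define s where "s = \<kappa> * real n powr (-1/2)"
  have s0: "s > 0" using \<kappa> n by (simp add: s_def)
  define T where "T y = theta_hat n z y * inv_psi_tilde \<kappa> n z y / \<Delta>" for y
  have T_meas: "T \<in> borel_measurable borel"
    unfolding T_def theta_hat_def inv_psi_tilde_def psi_hat_def by measurable
  \<comment> \<open>The truncation bounds the inverse by \<open>1 / s\<close>, so for every sample T
    is bounded, whatever the zeros of \<open>psi_hat\<close>.\<close>
  have "cmod (T y) \<le> (\<Sum>k=1..n. \<bar>z k\<bar>) / n * (1 / s) / \<Delta>" for y
  proof -
    have "cmod (theta_hat n z y) \<le> (\<Sum>k=1..n. \<bar>z k\<bar>) / n"
      unfolding theta_hat_def norm_divide using n
      by (intro frac_le order.trans[OF norm_sum] sum_mono) (auto simp: norm_mult)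
    moreover have "cmod (inv_psi_tilde \<kappa> n z y) \<le> 1 / s"
      unfolding inv_psi_tilde_def s_def[symmetric]
      using s0 by (auto simp: norm_divide intro!: divide_left_mono mult_pos_pos)
    ultimately have "cmod (theta_hat n z y) * cmod (inv_psi_tilde \<kappa> n z y) \<le> (\<Sum>k=1..n. \<bar>z k\<bar>) / n * (1 / s)"
      by (intro mult_mono) (auto intro!: divide_nonneg_nonneg sum_nonneg)
    then have "cmod (theta_hat n z y) * cmod (inv_psi_tilde \<kappa> n z y) / \<Delta> \<le> (\<Sum>k=1..n. \<bar>z k\<bar>) / n * (1 / s) / \<Delta>"
      using \<Delta> by (intro divide_right_mono) auto
    then show ?thesis using \<Delta> by (simp only: T_def norm_divide norm_mult norm_of_real abs_of_pos)
  qed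
  note T_bound = this
  define F where "F y = indicator {-(pi * real m)..pi * real m} y * T y" for y
  have F_L2: "F \<in> L2_on (pi * real m)"
    unfolding F_def[abs_def] by (rule L2_on_bounded[OF T_meas T_bound])
  have a: "a_hat \<Delta> \<kappa> n z m j = fcoeff m F j / (2 * pi)" for j
  proof -
    \<comment> \<open>The band is symmetric, hence \<open>phi_star m j (- x)\<close> is the
      conjugate of \<open>phi_star m j x\<close> and \<open>a_hat\<close> becomes a Fourier
      coefficient of F.\<close>
    have "theta_hat n z x * phi_star m j (- x) * inv_psi_tilde \<kappa> n z x = \<Delta> * (F x * cnj (phi_star m j x))" for x
      using \<Delta> by (auto simp: phi_star_def F_def T_def indicator_def exp_cnj)
    then have "(CLINT x|lborel. theta_hat n z x * phi_star m j (- x) * inv_psi_tilde \<kappa> n z x) = \<Delta> * fcoeff m F j"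
      unfolding fcoeff_def by simp
    then show ?thesis using \<Delta> by (simp add: a_hat_def)
  qed
  have gh: "g_hat \<Delta> \<kappa> n z m \<in> L2_space" "AE x in lborel. g_hat \<Delta> \<kappa> n z m x = ift F x"
    unfolding g_hat_def a using L2_series_fourier[OF F_L2 m] by auto
  have "L2_norm_sq (\<lambda>y. indicator {-(pi * real m)..pi * real m} y * ft g y - F y) =
    (\<integral>\<^sup>+y. ennreal (indicator {-pi * real m..pi * real m} y *
      (cmod (theta_hat n z y * inv_psi_tilde \<kappa> n z y - \<Delta> * ft g y))\<^sup>2 / \<Delta>\<^sup>2) \<partial>lborel)"
    unfolding L2_norm_sq_def
  proof (intro nn_integral_cong arg_cong[where f=ennreal])
    fix y
    have "cmod (ft g y - T y) = cmod (theta_hat n z y * inv_psi_tilde \<kappa> n z y - \<Delta> * ft g y) / \<Delta>"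
    proof -
      have "ft g y - T y = - ((theta_hat n z y * inv_psi_tilde \<kappa> n z y - \<Delta> * ft g y) / \<Delta>)"
        using \<Delta> by (simp add: T_def field_simps)
      then show ?thesis using \<Delta> by (simp only: norm_minus_cancel norm_divide) simp
    qed
    then show "(cmod (indicator {-(pi * real m)..pi * real m} y * ft g y - F y))\<^sup>2 =
      indicator {-pi * real m..pi * real m} y * (cmod (theta_hat n z y * inv_psi_tilde \<kappa> n z y - \<Delta> * ft g y))\<^sup>2 / \<Delta>\<^sup>2"
      by (auto simp: F_def indicator_def power_divide)
  qed
  then show ?thesis using L2_norm_sq_pythagoras[OF g gi gh(1) F_L2 gh(2)] by simp
qed

theorem proposition4p1:
  fixes M :: "'w measure" and L :: "real \<Rightarrow> 'w \<Rightarrow> real" and l :: "real \<Rightarrow> real"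
    and \<Delta> \<kappa> :: real
  assumes "pure_jump_fv_levy M L l"
    and "\<Delta> > 0" and "\<kappa> > 0"
    and "integrable lborel (\<lambda>x. \<bar>x\<bar> * l x)"
    and "integrable lborel (\<lambda>x. \<bar>x\<bar> ^ 3 * \<bar>jump_g l x\<bar>)"
    and "(\<lambda>x. complex_of_real (jump_g l x)) \<in> L2_space"
  shows "\<exists>K>0. \<forall>n\<ge>1. \<forall>m\<ge>1.
    (\<integral>\<^sup>+ w. L2_norm_sq (\<lambda>x. complex_of_real (jump_g l x)
                             - g_hat \<Delta> \<kappa> n (\<lambda>k. increment L \<Delta> k w) m x) \<partial>M)
    \<le> L2_norm_sq (\<lambda>x. complex_of_real (jump_g l x)
                       - L2_orth_proj (S_space m) (\<lambda>y. complex_of_real (jump_g l y)) x)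
      + ennreal (K * (sqrt (\<integral>w. (increment L \<Delta> 1 w) ^ 4 \<partial>M)
          * (LBINT x:{- pi * real m..pi * real m}.
               1 / (cmod (char (distr M borel (increment L \<Delta> 1)) x))\<^sup>2))
          / (real n * \<Delta>\<^sup>2))"
proof -
  have L: "levy_process M L" and lm: "l \<in> borel_measurable borel" and l0: "\<And>x. 0 \<le> l x"
    and lk: "\<forall>t\<ge>0. \<forall>u. char (distr M borel (L t)) u =
        exp (of_real t * (CLINT x|lborel. (iexp (u * x) - 1) * of_real (l x)))"
    using assms(1) by (auto simp: pure_jump_fv_levy_def)
  note \<Delta> = assms(2) and \<kappa> = assms(3) and l1 = assms(4)
  interpret prob_space M using L by (simp add: levy_process_def)
  define \<mu> where "\<mu> = distr M borel (L \<Delta>)"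
  note inc = levy_increments_iid[OF L \<Delta>, folded \<mu>_def]
  have inc1: "distr M borel (increment L \<Delta> 1) = \<mu>" using inc(3)[of 0] by simp
  have inc1m: "increment L \<Delta> 1 \<in> borel_measurable M" using inc(2)[of 0] by simp
  have \<mu>: "real_distribution \<mu>"
    unfolding inc1[symmetric] using inc1m by (rule real_distribution_distr)
  interpret \<mu>: real_distribution \<mu> by fact
  have char: "char \<mu> u = exp (of_real \<Delta> * (CLINT x|lborel. (iexp (u * x) - 1) * of_real (l x)))" for u
    using lk \<Delta> by (simp add: \<mu>_def)
  have nz: "char \<mu> u \<noteq> 0" for u by (simp add: char)
  have "(\<lambda>x. \<bar>x\<bar> ^ 3 * \<bar>jump_g l x\<bar>) = (\<lambda>x. x ^ 4 * l x)"
    using l0 by (auto simp: fun_eq_iff jump_g_def abs_mult power_even_abs eval_nat_numeral)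
  then have l4: "integrable lborel (\<lambda>x. x ^ 4 * l x)" using assms(5) by simp
  have z4: "integrable \<mu> (\<lambda>z. z ^ 4)"
    using integrable_fourth_moment[OF \<mu>] levy_cubic_at_0[OF lm l0 l1 l4, of \<Delta>] by (simp add: char[abs_def])
  have z2: "integrable \<mu> (\<lambda>z. z\<^sup>2)"
    by (rule \<mu>.square_integrable_imp_integrable) (use z4 in \<open>auto simp flip: power_mult\<close>)
  have z1: "integrable \<mu> (\<lambda>z. z)"
    by (rule \<mu>.square_integrable_imp_integrable[OF _ z2]) simp
  define g where "g x = complex_of_real (jump_g l x)" for x
  have g_eq: "(\<lambda>x. complex_of_real (jump_g l x)) = g" "g = (\<lambda>x. of_real (x * l x))"
    by (auto simp: g_def jump_g_def)
  have g: "g \<in> L2_space" using assms(6) by (simp add: g_eq(1))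
  have gi: "integrable lborel g"
    by (rule Bochner_Integration.integrable_bound[OF l1])
       (use L2_space_measurable[OF g] l0 in \<open>auto simp: g_def jump_g_def norm_mult\<close>)
  define \<theta> where "\<theta> u = (CLINT z|\<mu>. of_real z * iexp (u * z))" for u
  have ratio: "\<theta> u / char \<mu> u = \<Delta> * ft g u" for u
    using char_first_moment[OF \<mu> z1 lm l0 l1 char, of u] nz[of u] by (simp add: \<theta>_def g_eq(2))
  define m2 where "m2 = (\<integral>z. z\<^sup>2 \<partial>\<mu>)"
  define Q where "Q = sqrt (\<integral>z. z ^ 4 \<partial>\<mu>)"
  define G where "G = (\<integral>x. cmod (g x) \<partial>lborel)"
  have m20: "0 \<le> m2" by (simp add: m2_def)
  \<comment> \<open>The finite fourth moment makes Q the genuine \<open>E^(1/2)[Z^4]\<close>, which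
    dominates the second moment because variances are nonnegative.\<close>
  have "m2\<^sup>2 \<le> (\<integral>z. (z\<^sup>2)\<^sup>2 \<partial>\<mu>)"
    unfolding m2_def by (rule \<mu>.expectation_square_le) (use z4 in \<open>auto simp flip: power_mult\<close>)
  then have m2Q: "m2 \<le> Q" unfolding Q_def by (intro real_le_rsqrt) (simp flip: power_mult)
  then have Q0: "0 \<le> Q" using m20 by linarith
  define c where "c = 3 * (12 + 2 * \<kappa>\<^sup>2 + 144 / \<kappa>\<^sup>2)"
  have c0: "c > 0" unfolding c_def by (intro mult_pos_pos add_pos_nonneg) auto
  \<comment> \<open>The ratio contributes \<open>\<Delta>^2 G^2\<close>, with no moment in front;
    after division by Q the product \<open>K1 * Q\<close> carries it. For \<open>Q = 0\<close> the
    quotient is 0 by convention and \<open>K1\<close> is 1.\<close>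
  define K1 where "K1 = 1 + \<Delta>\<^sup>2 * G\<^sup>2 / Q"
  have K10: "K1 > 0" unfolding K1_def using Q0 by (intro add_pos_nonneg) auto
  have ratio_bound: "m2 + (cmod (\<theta> u / char \<mu> u))\<^sup>2 \<le> K1 * Q" for u
  proof (cases "Q = 0")
    case True
    \<comment> \<open>A vanishing fourth moment forces the second moment to vanish, hence also
      \<open>\<theta> u\<close>, and both sides are 0.\<close>
    have "cmod (\<theta> u) \<le> (\<integral>z. \<bar>z\<bar> \<partial>\<mu>)"
      unfolding \<theta>_def by (rule order.trans[OF integral_norm_bound]) (simp add: norm_mult)
    then have "(cmod (\<theta> u))\<^sup>2 \<le> (\<integral>z. \<bar>z\<bar> \<partial>\<mu>)\<^sup>2" by (intro power_mono) auto
    also have "\<dots> \<le> (\<integral>z. \<bar>z\<bar>\<^sup>2 \<partial>\<mu>)" by (rule \<mu>.expectation_square_le) (use z2 in auto)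
    also have "\<dots> = m2" by (simp add: m2_def)
    also have "m2 = 0" using True m2Q m20 by linarith
    finally have "\<theta> u = 0" by simp
    then show ?thesis using True m2Q by simp
  next
    case False
    have "cmod (\<Delta> * ft g u) \<le> \<Delta> * G"
      using cmod_ft_le[of g u] \<Delta> by (simp add: norm_mult G_def)
    then have "(cmod (\<theta> u / char \<mu> u))\<^sup>2 \<le> (\<Delta> * G)\<^sup>2"
      unfolding ratio by (intro power_mono) auto
    moreover have "K1 * Q = Q + (\<Delta> * G)\<^sup>2"
      using False by (simp add: K1_def distrib_right power_mult_distrib)
    ultimately show ?thesis using m2Q by linarith
  qed
  have Q_eq: "sqrt (\<integral>w. (increment L \<Delta> 1 w) ^ 4 \<partial>M) = Q"
    unfolding Q_def inc1[symmetric] using inc1m by (subst integral_distr) auto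
  show ?thesis
    unfolding g_def[symmetric] inc1 Q_eq
  \<comment> \<open>The witness collects the constant c of \<open>ratio_risk\<close>, the factor
    \<open>K1\<close> and the \<open>1 / (2 * pi)\<close> of Plancherel; none of them involves n or
    m.\<close>
  proof (intro exI[of _ "c * K1 / (2 * pi)"] conjI allI impI)
    show "c * K1 / (2 * pi) > 0" using c0 K10 by simp
    fix n m :: nat assume n: "n \<ge> 1" and m: "m \<ge> 1"
    let ?I = "{- pi * real m..pi * real m}"
    define Z where "Z k = increment L \<Delta> (Suc k)" for k
    have Zm[measurable]: "Z k \<in> borel_measurable M" for k unfolding Z_def by (rule inc(2))
    interpret iid M Z \<mu> n unfolding Z_def[abs_def] by (rule inc(1))
    define \<psi>' where "\<psi>' w u = (\<Sum>k<n. iexp (u * Z k w)) / of_nat n" for w u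
    define \<theta>' where "\<theta>' w u = (\<Sum>k<n. of_real (Z k w) * iexp (u * Z k w)) / of_nat n" for w u
    define R where "R w u = (cmod (\<theta>' w u * (if cmod (\<psi>' w u) > \<kappa> * real n powr (-1/2) then 1 / \<psi>' w u else 0)
      - \<theta> u / char \<mu> u))\<^sup>2" for w u
    define J where "J w y = ennreal (indicator ?I y * R w y / \<Delta>\<^sup>2)" for w y
    have th_meas[measurable]: "(\<lambda>y. \<theta> y / char \<mu> y) \<in> borel_measurable borel"
      unfolding ratio using borel_measurable_integrable[OF gi] by measurable
    have J_meas[measurable]: "(\<lambda>(w, y). J w y) \<in> borel_measurable (M \<Otimes>\<^sub>M lborel)"
      unfolding J_def R_def \<theta>'_def \<psi>'_def by measurable
    \<comment> \<open>Sums over \<open>{1..n}\<close> of the observations become sums over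
      \<open>{..<n}\<close> of the shifted sample.\<close>
    have hat: "theta_hat n (\<lambda>k. increment L \<Delta> k w) y * inv_psi_tilde \<kappa> n (\<lambda>k. increment L \<Delta> k w) y =
        \<theta>' w y * (if cmod (\<psi>' w y) > \<kappa> * real n powr (-1/2) then 1 / \<psi>' w y else 0)" for w y
      unfolding theta_hat_def inv_psi_tilde_def psi_hat_def \<theta>'_def \<psi>'_def Z_def
      by (simp only: One_nat_def sum.atLeast1_atMost_eq)
    let ?A = "L2_norm_sq (\<lambda>x. g x - L2_orth_proj (S_space m) g x)"
    have loss: "L2_norm_sq (\<lambda>x. g x - g_hat \<Delta> \<kappa> n (\<lambda>k. increment L \<Delta> k w) m x) =
        ?A + ennreal (1 / (2 * pi)) * (\<integral>\<^sup>+y. J w y \<partial>lborel)" for w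
      unfolding g_hat_risk[OF g gi \<Delta> \<kappa> n m] hat J_def R_def ratio ..
    interpret pair_sigma_finite M lborel ..
    have "(\<integral>\<^sup>+w. L2_norm_sq (\<lambda>x. g x - g_hat \<Delta> \<kappa> n (\<lambda>k. increment L \<Delta> k w) m x) \<partial>M) =
        ?A + ennreal (1 / (2 * pi)) * (\<integral>\<^sup>+w. (\<integral>\<^sup>+y. J w y \<partial>lborel) \<partial>M)"
      unfolding loss by (subst nn_integral_add) (auto simp: nn_integral_cmult emeasure_space_1)
    \<comment> \<open>Tonelli: the expectation is now taken at each fixed frequency, where
      \<open>ratio_risk\<close> applies. Joint measurability of J is what this exchange
      requires.\<close>
    also have "(\<integral>\<^sup>+w. (\<integral>\<^sup>+y. J w y \<partial>lborel) \<partial>M) = (\<integral>\<^sup>+y. (\<integral>\<^sup>+w. J w y \<partial>M) \<partial>lborel)"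
      by (rule Fubini'[symmetric]) measurable
    also have "\<dots> \<le> (\<integral>\<^sup>+y. ennreal (c * K1 * Q / (n * \<Delta>\<^sup>2)) * ennreal (indicator ?I y / (cmod (char \<mu> y))\<^sup>2) \<partial>lborel)"
    proof (rule nn_integral_mono)
      fix y
      have Rm: "(\<lambda>w. R w y) \<in> borel_measurable M" unfolding R_def \<theta>'_def \<psi>'_def by measurable
      have "(\<integral>\<^sup>+w. J w y \<partial>M) = (\<integral>\<^sup>+w. ennreal (indicator ?I y / \<Delta>\<^sup>2) * ennreal (R w y) \<partial>M)"
        unfolding J_def by (intro nn_integral_cong) (simp add: R_def ennreal_mult[symmetric])
      also have "\<dots> = ennreal (indicator ?I y / \<Delta>\<^sup>2) * (\<integral>\<^sup>+w. ennreal (R w y) \<partial>M)"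
        using Rm by (intro nn_integral_cmult) measurable
      also have "\<dots> \<le> ennreal (indicator ?I y / \<Delta>\<^sup>2) * ennreal (c / (n * (cmod (char \<mu> y))\<^sup>2) * (K1 * Q))"
      proof (intro mult_left_mono)
        have "(\<integral>\<^sup>+w. ennreal (R w y) \<partial>M) \<le> ennreal (c / (n * (cmod (char \<mu> y))\<^sup>2) * (m2 + (cmod (\<theta> y / char \<mu> y))\<^sup>2))"
          using ratio_risk[OF z2 \<kappa> n order.refl nz[of y]] unfolding R_def \<theta>'_def \<psi>'_def \<theta>_def c_def m2_def .
        also have "\<dots> \<le> ennreal (c / (n * (cmod (char \<mu> y))\<^sup>2) * (K1 * Q))"
          using c0 by (intro ennreal_leI mult_left_mono ratio_bound) auto
        finally show "(\<integral>\<^sup>+w. ennreal (R w y) \<partial>M) \<le> ennreal (c / (n * (cmod (char \<mu> y))\<^sup>2) * (K1 * Q))" .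
      qed simp
      also have "\<dots> = ennreal (c * K1 * Q / (n * \<Delta>\<^sup>2)) * ennreal (indicator ?I y / (cmod (char \<mu> y))\<^sup>2)"
        using c0 K10 Q0 by (simp add: ennreal_mult[symmetric] ac_simps)
      finally show "(\<integral>\<^sup>+w. J w y \<partial>M) \<le> ennreal (c * K1 * Q / (n * \<Delta>\<^sup>2)) * ennreal (indicator ?I y / (cmod (char \<mu> y))\<^sup>2)" .
    qed
    also have "\<dots> = ennreal (c * K1 * Q / (n * \<Delta>\<^sup>2)) * ennreal (LBINT x:?I. 1 / (cmod (char \<mu> x))\<^sup>2)"
      unfolding set_integral_inverse_char[OF \<mu> nz, symmetric]
      by (rule nn_integral_cmult) measurable
    finally have "(\<integral>\<^sup>+w. L2_norm_sq (\<lambda>x. g x - g_hat \<Delta> \<kappa> n (\<lambda>k. increment L \<Delta> k w) m x) \<partial>M) \<le>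
        ?A + ennreal (1 / (2 * pi)) * (ennreal (c * K1 * Q / (n * \<Delta>\<^sup>2)) * ennreal (LBINT x:?I. 1 / (cmod (char \<mu> x))\<^sup>2))"
      by (simp add: mult_left_mono)
    also have "ennreal (1 / (2 * pi)) * (ennreal (c * K1 * Q / (n * \<Delta>\<^sup>2)) * ennreal (LBINT x:?I. 1 / (cmod (char \<mu> x))\<^sup>2)) =
        ennreal (c * K1 / (2 * pi) * (Q * (LBINT x:?I. 1 / (cmod (char \<mu> x))\<^sup>2)) / (real n * \<Delta>\<^sup>2))"
    proof -
      have "0 \<le> (LBINT x:?I. 1 / (cmod (char \<mu> x))\<^sup>2)"
        unfolding set_lebesgue_integral_def by (intro Bochner_Integration.integral_nonneg) auto
      then show ?thesis using c0 K10 Q0 by (simp add: ennreal_mult[symmetric] ac_simps)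
    qed
    finally show "(\<integral>\<^sup>+w. L2_norm_sq (\<lambda>x. g x - g_hat \<Delta> \<kappa> n (\<lambda>k. increment L \<Delta> k w) m x) \<partial>M) \<le>
      ?A + ennreal (c * K1 / (2 * pi) * (Q * (LBINT x:?I. 1 / (cmod (char \<mu> x))\<^sup>2)) / (real n * \<Delta>\<^sup>2))" .
  qed
qed

end
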